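(* Let $\mathcal{C}$ be a reduced curve in $\mathbb{P}^2$ and $C_0 \subset \mathbb{P}^2$ a smooth conic such that $C_0 \notin \mathrm{Irr}(\mathcal{C})$. Then $$\sum_{P \in \mathcal{C} \cap C_0}\left[\mu_P(\mathcal{C} \cup C_0) - \mu_P(\mathcal{C})+1\right] = 4 \deg(\mathcal{C}).$$
   Context: $\mathbb{P}^2$ is the complex projective plane; all curves are assumed reduced. $\mathrm{Irr}(\mathcal{C})$ is the set of irreducible components of $\mathcal{C}$. $\mu_P(\mathcal{C})$ is the Milnor number of $\mathcal{C}$ at $P$ (zero if $P$ is a smooth point of $\mathcal{C}$). The sum runs over the points of the set $\mathcal{C}\cap C_0$. *)

theory Defs
  imports
    "HOL-Analysis.Analysis"
    "HOL-Computational_Algebra.Computational_Algebra"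
    "HOL-Algebra.Embedded_Algebras"
    "HOL-Algebra.QuotRing"
begin

unbundle no fps_syntax

subsection \<open>Homogeneous polynomials in three variables\<close>

text \<open>
  The ring \<open>\<complex>[X,Y,Z]\<close> is rendered as the iterated polynomial ring \<open>\<complex>[X][Y][Z]\<close>:
  the innermost variable is \<open>X\<close>, the outermost one is \<open>Z\<close>.  Thus the coefficient of
  \<open>X^i Y^j Z^k\<close> in \<open>F\<close> is \<open>coeff (coeff (coeff F k) j) i\<close>.
\<close>

type_synonym poly3 = "complex poly poly poly"

definition homogeneous :: "nat \<Rightarrow> poly3 \<Rightarrow> bool" where
  "homogeneous d F \<longleftrightarrow>
     (\<forall>i j k. Polynomial.coeff (Polynomial.coeff (Polynomial.coeff F k) j) i \<noteq> 0 \<longrightarrow> i + j + k = d)"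

text \<open>Evaluation at a triple of elements of a \<open>\<complex>\<close>-algebra with structure map \<open>e\<close>.\<close>

definition eval3 :: "(complex \<Rightarrow> 'a::comm_ring_1) \<Rightarrow> poly3 \<Rightarrow> 'a ^ 3 \<Rightarrow> 'a" where
  "eval3 e F a =
     poly (map_poly (\<lambda>q. poly (map_poly (\<lambda>p. poly (map_poly e p) (a $ 1)) q) (a $ 2)) F) (a $ 3)"

definition partial_X :: "poly3 \<Rightarrow> poly3" where
  "partial_X = map_poly (map_poly pderiv)"

definition partial_Y :: "poly3 \<Rightarrow> poly3" where
  "partial_Y = map_poly pderiv"

definition partial_Z :: "poly3 \<Rightarrow> poly3" where
  "partial_Z = pderiv"


subsection \<open>Curves in the projective plane\<close>

text \<open>A point of the projective plane is a line through the origin of \<open>\<complex>^3\<close>.\<close>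

definition proj_plane :: "(complex ^ 3) set set" where
  "proj_plane = {vec.span {v} | v. v \<noteq> 0}"

text \<open>Only used for homogeneous \<open>F\<close>.\<close>

definition zero_locus :: "poly3 \<Rightarrow> (complex ^ 3) set set" where
  "zero_locus F = {P \<in> proj_plane. \<forall>v\<in>P. eval3 id F v = 0}"

definition reduced_equation :: "poly3 \<Rightarrow> bool" where
  "reduced_equation F \<longleftrightarrow> (\<exists>d>0. homogeneous d F) \<and> squarefree F"

text \<open>
  Over \<open>\<complex>\<close> a reduced curve is determined by its set of points, and its reduced equation is
  determined up to a nonzero scalar.  Curves are therefore sets of points, and
  \<open>curve_eq\<close> picks one of the proportional reduced equations.
\<close>

definition reduced_curve :: "(complex ^ 3) set set \<Rightarrow> bool" where
  "reduced_curve C \<longleftrightarrow> (\<exists>F. reduced_equation F \<and> zero_locus F = C)"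

definition curve_eq :: "(complex ^ 3) set set \<Rightarrow> poly3" where
  "curve_eq C = (SOME F. reduced_equation F \<and> zero_locus F = C)"

definition curve_degree :: "(complex ^ 3) set set \<Rightarrow> nat" where
  "curve_degree C = (THE d. homogeneous d (curve_eq C))"

text \<open>
  The irreducible components are the zero loci of the irreducible factors of the equation;
  these factors are automatically homogeneous.
\<close>

definition Irr :: "(complex ^ 3) set set \<Rightarrow> (complex ^ 3) set set set" where
  "Irr C = {zero_locus H | H. Factorial_Ring.irreducible H \<and> H dvd curve_eq C}"

definition smooth_point :: "(complex ^ 3) set set \<Rightarrow> (complex ^ 3) set \<Rightarrow> bool" where
  "smooth_point C P \<longleftrightarrow> P \<in> C \<and>
     (\<forall>v\<in>P - {0}. \<exists>D\<in>{partial_X, partial_Y, partial_Z}. eval3 id (D (curve_eq C)) v \<noteq> 0)"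

definition smooth_conic :: "(complex ^ 3) set set \<Rightarrow> bool" where
  "smooth_conic C \<longleftrightarrow> reduced_curve C \<and> curve_degree C = 2 \<and> (\<forall>P\<in>C. smooth_point C P)"


subsection \<open>Milnor numbers\<close>

text \<open>
  The local ring \<open>\<complex>{x,y}\<close> is the subring of absolutely convergent series in
  \<open>\<complex>[[x]][[y]]\<close>; the coefficient of \<open>x^i y^j\<close> in \<open>f\<close> is \<open>fps_nth (fps_nth f j) i\<close>.
\<close>

type_synonym fps2 = "complex fps fps"

definition const2 :: "complex \<Rightarrow> fps2" where
  "const2 c = fps_const (fps_const c)"

definition var_x :: fps2 where
  "var_x = fps_const fps_X"

definition var_y :: fps2 where
  "var_y = fps_X"

definition deriv_x :: "fps2 \<Rightarrow> fps2" where
  "deriv_x f = Abs_fps (\<lambda>j. fps_deriv (fps_nth f j))"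

definition deriv_y :: "fps2 \<Rightarrow> fps2" where
  "deriv_y f = fps_deriv f"

definition convergent2 :: "fps2 \<Rightarrow> bool" where
  "convergent2 f \<longleftrightarrow>
     (\<exists>r>0. (\<lambda>(i, j). norm (fps_nth (fps_nth f j) i) * r ^ (i + j)) summable_on UNIV)"

definition conv_ring :: "fps2 ring" where
  "conv_ring = \<lparr>carrier = {f. convergent2 f}, mult = (*), one = 1, zero = 0, add = (+)\<rparr>"

definition jacobian_ideal :: "fps2 \<Rightarrow> fps2 set" where
  "jacobian_ideal f = Idl\<^bsub>conv_ring\<^esub> {deriv_x f, deriv_y f}"

definition milnor_algebra :: "fps2 \<Rightarrow> fps2 set ring" where
  "milnor_algebra f = conv_ring Quot jacobian_ideal f"

text \<open>
  The dimension is taken over the image of \<open>\<complex>\<close> in the quotient.  If \<open>f\<close> is smooth at the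
  origin, the quotient is the zero ring and the dimension is \<open>0\<close>.
\<close>

definition milnor_germ :: "fps2 \<Rightarrow> nat" where
  "milnor_germ f =
     ring.dim (milnor_algebra f)
       ((\<lambda>c. jacobian_ideal f +>\<^bsub>conv_ring\<^esub> const2 c) ` UNIV)
       (carrier (milnor_algebra f))"

text \<open>
  Affine coordinates \<open>x, y\<close> centred at the point \<open>[v$1 : v$2 : v$3]\<close>, in the standard chart
  given by the last nonvanishing homogeneous coordinate.  The result depends only on the point.
\<close>

definition local_coords :: "complex ^ 3 \<Rightarrow> fps2 ^ 3" where
  "local_coords v =
     (if v $ 3 \<noteq> 0 then
        vector [const2 (v $ 1 / v $ 3) + var_x, const2 (v $ 2 / v $ 3) + var_y, 1]
      else if v $ 2 \<noteq> 0 then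
        vector [const2 (v $ 1 / v $ 2) + var_x, 1, const2 (v $ 3 / v $ 2) + var_y]
      else
        vector [1, const2 (v $ 2 / v $ 1) + var_x, const2 (v $ 3 / v $ 1) + var_y])"

definition local_equation :: "(complex ^ 3) set set \<Rightarrow> (complex ^ 3) set \<Rightarrow> fps2" where
  "local_equation C P = eval3 const2 (curve_eq C) (local_coords (SOME v. v \<in> P \<and> v \<noteq> 0))"

definition milnor_number :: "(complex ^ 3) set set \<Rightarrow> (complex ^ 3) set \<Rightarrow> nat" where
  "milnor_number C P = milnor_germ (local_equation C P)"

end

theory Submission imports Defs "HOL-Computational_Algebra.Field_as_Ring" begin

text \<open>
  Let \<open>F = 0\<close> and \<open>Q = 0\<close> be the equations of \<open>C\<close> and \<open>C0\<close>, and \<open>d = deg F\<close>.  Choose a point \<open>u\<close>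
  of the conic off \<open>C\<close> and parametrize the other points of the conic by \<open>\<Theta>(\<tau>) = \<tau>\<^sup>2 u + \<tau> v + w\<close>.
  Then \<open>F(\<Theta>(\<tau>))\<close> is a polynomial of degree \<open>2d\<close> whose roots are the points of \<open>C \<inter> C0\<close>, so it is
  enough to show that the summand at a root equals twice its multiplicity \<open>m\<close>.

  Locally let \<open>f\<close> and \<open>q\<close> be the equations of the two germs, with \<open>q\<^sub>y\<close> a unit, and put
  \<open>g = q\<^sub>y f\<^sub>x - q\<^sub>x f\<^sub>y\<close> and \<open>k = q\<^sub>y f + q f\<^sub>y\<close>.  The Jacobian ideals of \<open>f\<close> and \<open>f q\<close> are \<open>(g, f\<^sub>y)\<close>
  and \<open>(q g, k)\<close>.  Writing \<open>(a . b)\<close> for the codimension of the ideal \<open>(a, b)\<close>, we have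
  \<open>(q g . k) = (q . k) + (g . k)\<close>, \<open>(q . k) = m\<close> and \<open>(q . g) = m - 1\<close>.  Along every Puiseux branch of
  \<open>g\<close> the chain rule gives \<open>q\<^sub>y df = f\<^sub>y dq\<close>, hence \<open>ord k = ord q + ord f\<^sub>y\<close>; summing over the branches,
  \<open>(g . k) = (g . q) + (g . f\<^sub>y)\<close>.  Together \<open>\<mu>(f q) = \<mu>(f) + 2m - 1\<close>.  Since \<open>F\<close> is squarefree, \<open>f\<close> and
  its derivatives vanish along no branch, so \<open>\<mu>(f)\<close> is finite.  Finite codimensions are the same for
  formal and for convergent power series.
\<close>


unbundle no fps_syntax

section \<open>Ring homomorphisms and derivations on iterated polynomials\<close>

text \<open>\<open>g\<close> is the derivative of \<open>f\<close> along the field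
  \<open>q_y d/dx - q_x d/dy\<close>, tangent to the level curves of \<open>q\<close>. On
  \<open>q = 0\<close> it is, up to a unit, the derivative of \<open>f\<close> in the parameter,
  whence \<open>(q . g) = m - 1\<close>. On \<open>g = 0\<close> the differentials of
  \<open>f\<close> and \<open>q\<close> are proportional, whence \<open>q_y df = f_y dq\<close>.
  This relation makes \<open>q_y f\<close> and \<open>q f_y\<close> have equal order along a branch,
  so \<open>ord k\<close> might exceed it; it does not, because the leading coefficients have a
  positive rational ratio. The obstacle is the sum over branches. Codimension is additive when a
  smooth germ is split off, but \<open>g\<close> splits into smooth germs only after a base change
  \<open>x = t^k\<close>. Series in \<open>x, y\<close> are free of rank \<open>k\<close> over
  series in \<open>x^k, y\<close>, so the base change multiplies every codimension by
  \<open>k\<close>; the same \<open>k\<close> serves \<open>(g . q)\<close>,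
  \<open>(g . f_y)\<close> and \<open>(g . k)\<close> and cancels. The point \<open>u\<close> is the
  parameter value infinity. As it lies off \<open>C\<close>, no intersection is missed there and the
  pullback of \<open>F\<close> has full degree, which gives \<open>2 * 2d\<close>.\<close>

locale rhom =
  fixes h :: "'a::comm_ring_1 \<Rightarrow> 'b::comm_ring_1"
  assumes one [simp]: "h 1 = 1"
    and add [simp]: "h (a + b) = h a + h b"
    and mult [simp]: "h (a * b) = h a * h b"
begin

lemma zero [simp]: "h 0 = 0"
  using add[of 0 0] by simp

lemma uminus [simp]: "h (- a) = - h a"
  using add[of a "- a"] by (simp add: eq_neg_iff_add_eq_0 add.commute)

lemma diff [simp]: "h (a - b) = h a - h b"
  using add[of a "- b"] by simp

lemma power [simp]: "h (a ^ n) = h a ^ n"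
  by (induction n) auto

lemma sum [simp]: "h (sum f A) = (\<Sum>x\<in>A. h (f x))"
  by (induction A rule: infinite_finite_induct) auto

lemma prod_list [simp]: "h (prod_list xs) = prod_list (map h xs)"
  by (induction xs) auto

lemma of_nat [simp]: "h (of_nat n) = of_nat n"
  by (induction n) auto

lemma dvd: "a dvd b \<Longrightarrow> h a dvd h b"
  by (auto simp: dvd_def)

end

lemma rhom_id [intro]: "rhom id" "rhom (\<lambda>x. x)"
  by (unfold_locales; simp)+

lemma rhom_comp: "rhom f \<Longrightarrow> rhom g \<Longrightarrow> rhom (\<lambda>x. f (g x))"
  by (simp add: rhom_def)

lemma rhom_pconst [intro]: "rhom (\<lambda>c. [:c:])"
  by unfold_locales auto

text \<open>One stage of \<open>eval3\<close>. As \<open>ev h z\<close> is again a homomorphism,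
  facts about three variables come from applying a one-variable fact three times.\<close>

definition ev :: "('a::comm_ring_1 \<Rightarrow> 'b::comm_ring_1) \<Rightarrow> 'b \<Rightarrow> 'a poly \<Rightarrow> 'b" where
  "ev h z p = poly (map_poly h p) z"

lemma eval3_ev: "eval3 e F a = ev (ev (ev e (a $ 1)) (a $ 2)) (a $ 3) F"
  unfolding eval3_def ev_def[abs_def] by simp

context rhom
begin

lemma ev_0 [simp]: "ev h z 0 = 0"
  by (simp add: ev_def)

lemma ev_pCons [simp]: "ev h z (pCons a p) = h a + z * ev h z p"
  by (simp add: ev_def map_poly_pCons)

lemma ev_add: "ev h z (p + q) = ev h z p + ev h z q"
  by (induction p q rule: poly_induct2) (auto simp: algebra_simps)

lemma ev_smult: "ev h z (Polynomial.smult a q) = h a * ev h z q"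
  by (induction q) (auto simp: algebra_simps)

lemma ev_mult: "ev h z (p * q) = ev h z p * ev h z q"
  by (induction p) (auto simp: algebra_simps ev_add ev_smult)

lemma rhom_ev: "rhom (ev h z)"
  by unfold_locales (auto simp: ev_add ev_mult one_pCons)

lemma ev_sum: "ev h z p = (\<Sum>i\<le>Polynomial.degree p. h (Polynomial.coeff p i) * z ^ i)"
proof (induction p)
  case (pCons a p)
  show ?case
  proof (cases "p = 0")
    case False
    then show ?thesis using pCons
      by (simp add: sum.atMost_Suc_shift sum_distrib_left mult_ac del: sum.atMost_Suc)
  qed auto
qed auto

end

lemma rhom_evI [intro]: "rhom h \<Longrightarrow> rhom (ev h z)"
  by (rule rhom.rhom_ev)

lemma rhom_eval3 [intro]: "rhom e \<Longrightarrow> rhom (\<lambda>F. eval3 e F a)"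
  unfolding eval3_ev by (intro rhom_evI)

lemma rhom_poly_eqI:
  assumes f: "rhom f" and g: "rhom g"
    and c: "\<And>c. f [:c:] = g [:c:]" and x: "f [:0, 1:] = g [:0, 1:]"
  shows "f p = g p"
proof -
  interpret f: rhom f by fact
  interpret g: rhom g by fact
  show ?thesis
  proof (induction p)
    case (pCons a p)
    have "pCons a p = [:a:] + [:0, 1:] * p" by simp
    then show ?case using pCons c x by (metis f.add f.mult g.add g.mult)
  qed auto
qed

definition "C3 c = [:[:[:c:]:]:]" for c :: complex
definition X3 :: poly3 where "X3 = [:[:[:0, 1:]:]:]"
definition Y3 :: poly3 where "Y3 = [:[:0, 1:]:]"
definition Z3 :: poly3 where "Z3 = [:0, 1:]"

text \<open>Polynomial rings are free: the one-variable uniqueness is applied at each nesting level.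
  Identities between evaluations are thereby checked on generators only.\<close>

lemma rhom_poly3_eqI:
  assumes f: "rhom f" and g: "rhom g"
    and "\<And>c. f (C3 c) = g (C3 c)" "f X3 = g X3" "f Y3 = g Y3" "f Z3 = g Z3"
  shows "f F = g F"
proof (rule rhom_poly_eqI[OF f g])
  fix q :: "complex poly poly"
  show "f [:q:] = g [:q:]"
  proof (rule rhom_poly_eqI[of "\<lambda>q. f [:q:]" "\<lambda>q. g [:q:]"])
    fix p :: "complex poly"
    show "f [:[:p:]:] = g [:[:p:]:]"
    proof (rule rhom_poly_eqI[of "\<lambda>p. f [:[:p:]:]" "\<lambda>p. g [:[:p:]:]"])
      show "rhom (\<lambda>p. f [:[:p:]:])" "rhom (\<lambda>p. g [:[:p:]:])"
        using rhom_comp[OF f rhom_comp[OF rhom_pconst rhom_pconst]]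
          rhom_comp[OF g rhom_comp[OF rhom_pconst rhom_pconst]] by auto
    qed (use assms in \<open>auto simp: C3_def X3_def\<close>)
    show "rhom (\<lambda>q. f [:q:])" "rhom (\<lambda>q. g [:q:])"
      using rhom_comp[OF f rhom_pconst] rhom_comp[OF g rhom_pconst] by auto
  qed (use assms in \<open>auto simp: Y3_def\<close>)
qed (use assms in \<open>auto simp: Z3_def\<close>)

lemma eval3_simps:
  assumes "rhom e"
  shows "eval3 e (C3 c) a = e c" "eval3 e X3 a = a $ 1" "eval3 e Y3 a = a $ 2" "eval3 e Z3 a = a $ 3"
proof -
  interpret rhom e by fact
  interpret h1: rhom "ev e z" for z by (rule rhom_evI) fact
  interpret h2: rhom "ev (ev e z) w" for z w by (intro rhom_evI) fact
  show "eval3 e (C3 c) a = e c" "eval3 e X3 a = a $ 1" "eval3 e Y3 a = a $ 2" "eval3 e Z3 a = a $ 3"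
    by (simp_all add: eval3_ev C3_def X3_def Y3_def Z3_def)
qed

text \<open>Carries a form between complex numbers, power series in one or two variables and
  polynomial rings: constant terms, pullbacks to branches and the exchange of coordinates are all
  instances of \<open>h\<close>.\<close>

lemma rhom_eval3_push:
  assumes h: "rhom h" and e: "rhom e"
  shows "h (eval3 e F a) = eval3 (\<lambda>c. h (e c)) F (\<chi> i. h (a $ i))"
proof -
  have he: "rhom (\<lambda>c. h (e c))" by (rule rhom_comp[OF h e])
  show ?thesis
    by (rule rhom_poly3_eqI[of "\<lambda>F. h (eval3 e F a)"])
      (use rhom_comp[OF h rhom_eval3[OF e]] rhom_eval3[OF he] in \<open>auto simp: eval3_simps[OF e] eval3_simps[OF he]\<close>)
qed

text \<open>A derivation with values in the target of \<open>h\<close>, regarded as a module through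
  \<open>h\<close>. Both sides of a chain rule are derivations of this kind along one
  evaluation.\<close>

definition hderiv :: "('a::comm_ring_1 \<Rightarrow> 'b::comm_ring_1) \<Rightarrow> ('a \<Rightarrow> 'b) \<Rightarrow> bool" where
  "hderiv h D \<longleftrightarrow> (\<forall>a b. D (a + b) = D a + D b) \<and> (\<forall>a b. D (a * b) = h a * D b + h b * D a)"

lemma hderiv_comp1: "hderiv id D \<Longrightarrow> rhom h \<Longrightarrow> hderiv h (\<lambda>a. D (h a))"
  by (auto simp: hderiv_def rhom_def algebra_simps)

lemma hderiv_comp2:
  "hderiv id D \<Longrightarrow> rhom h \<Longrightarrow> hderiv h (\<lambda>a. h (D a) * w)"
  by (auto simp: hderiv_def rhom_def algebra_simps)

lemma hderiv_inner: "hderiv h D \<Longrightarrow> rhom k \<Longrightarrow> hderiv (\<lambda>x. h (k x)) (\<lambda>x. D (k x))"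
  by (auto simp: hderiv_def rhom_def)

lemma hderiv_add: "hderiv h D \<Longrightarrow> hderiv h D' \<Longrightarrow> hderiv h (\<lambda>a. D a + D' a)"
  by (auto simp: hderiv_def algebra_simps)

lemma hderiv_poly_eqI:
  assumes D: "hderiv h D" and D': "hderiv h D'"
    and c: "\<And>c. D [:c:] = D' [:c:]" and x: "D [:0, 1:] = D' [:0, 1:]"
  shows "D p = D' p"
proof (induction p)
  case 0
  show ?case using c[of 0] by simp
next
  case (pCons a p)
  have "pCons a p = [:a:] + [:0, 1:] * p" by simp
  moreover have "D ([:a:] + [:0, 1:] * p) = D' ([:a:] + [:0, 1:] * p)"
    using D D' unfolding hderiv_def by (simp only: c x pCons.IH)
  ultimately show ?case by simp
qed

lemma hderiv_poly3_eqI: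
  assumes f: "hderiv h f" and g: "hderiv h g"
    and "\<And>c. f (C3 c) = g (C3 c)" "f X3 = g X3" "f Y3 = g Y3" "f Z3 = g Z3"
  shows "f F = g F"
proof (rule hderiv_poly_eqI[OF f g])
  fix q :: "complex poly poly"
  show "f [:q:] = g [:q:]"
  proof (rule hderiv_poly_eqI[of "\<lambda>q. h [:q:]" "\<lambda>q. f [:q:]" "\<lambda>q. g [:q:]"])
    fix p :: "complex poly"
    show "f [:[:p:]:] = g [:[:p:]:]"
    proof (rule hderiv_poly_eqI[of "\<lambda>p. h [:[:p:]:]" "\<lambda>p. f [:[:p:]:]" "\<lambda>p. g [:[:p:]:]"])
      show "hderiv (\<lambda>p. h [:[:p:]:]) (\<lambda>p. f [:[:p:]:])" "hderiv (\<lambda>p. h [:[:p:]:]) (\<lambda>p. g [:[:p:]:])"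
        using hderiv_inner[OF f rhom_comp[OF rhom_pconst rhom_pconst]]
          hderiv_inner[OF g rhom_comp[OF rhom_pconst rhom_pconst]] by auto
    qed (use assms in \<open>auto simp: C3_def X3_def\<close>)
    show "hderiv (\<lambda>q. h [:q:]) (\<lambda>q. f [:q:])" "hderiv (\<lambda>q. h [:q:]) (\<lambda>q. g [:q:])"
      using hderiv_inner[OF f rhom_pconst] hderiv_inner[OF g rhom_pconst] by auto
  qed (use assms in \<open>auto simp: Y3_def\<close>)
qed (use assms in \<open>auto simp: Z3_def\<close>)

lemma hderiv_map_poly:
  assumes "hderiv id D"
  shows "hderiv id (map_poly D)"
proof -
  have add: "D (a + b) = D a + D b" and mult: "D (a * b) = a * D b + b * D a" for a b
    using assms by (auto simp: hderiv_def)
  have z: "D 0 = 0" using add[of 0 0] by simp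
  have sum: "D (sum f A) = (\<Sum>x\<in>A. D (f x))" for f and A :: "nat set"
    by (induction A rule: infinite_finite_induct) (auto simp: z add)
  show ?thesis unfolding hderiv_def
  proof (intro conjI allI poly_eqI)
    fix a b n
    show "Polynomial.coeff (map_poly D (a + b)) n = Polynomial.coeff (map_poly D a + map_poly D b) n"
      by (simp add: coeff_map_poly z add)
    have "Polynomial.coeff (map_poly D (a * b)) n =
        (\<Sum>i\<le>n. Polynomial.coeff a i * D (Polynomial.coeff b (n - i))) + (\<Sum>i\<le>n. Polynomial.coeff b (n - i) * D (Polynomial.coeff a i))"
      by (simp add: coeff_map_poly z coeff_mult sum mult sum.distrib)
    also have "(\<Sum>i\<le>n. Polynomial.coeff b (n - i) * D (Polynomial.coeff a i)) = Polynomial.coeff (map_poly D a * b) n"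
      by (simp add: coeff_mult coeff_map_poly z mult.commute[of "Polynomial.coeff b _"])
    also have "(\<Sum>i\<le>n. Polynomial.coeff a i * D (Polynomial.coeff b (n - i))) = Polynomial.coeff (a * map_poly D b) n"
      by (simp add: coeff_mult coeff_map_poly z)
    finally show "Polynomial.coeff (map_poly D (a * b)) n = Polynomial.coeff (id a * map_poly D b + id b * map_poly D a) n"
      by (simp add: mult.commute)
  qed
qed

lemma hderiv_partial:
  "hderiv id partial_X" "hderiv id partial_Y" "hderiv id partial_Z"
proof -
  have p: "hderiv id (pderiv :: 'b::idom poly \<Rightarrow> _)"
    by (auto simp: hderiv_def pderiv_add pderiv_mult)
  show "hderiv id partial_X" "hderiv id partial_Y" "hderiv id partial_Z"
    unfolding partial_X_def partial_Y_def partial_Z_def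
    using hderiv_map_poly[OF hderiv_map_poly[OF p]] hderiv_map_poly[OF p] p by auto
qed

lemma partial_simps:
  "partial_X (C3 c) = 0" "partial_X X3 = 1" "partial_X Y3 = 0" "partial_X Z3 = 0"
  "partial_Y (C3 c) = 0" "partial_Y X3 = 0" "partial_Y Y3 = 1" "partial_Y Z3 = 0"
  "partial_Z (C3 c) = 0" "partial_Z X3 = 0" "partial_Z Y3 = 0" "partial_Z Z3 = 1"
  by (simp_all add: partial_X_def partial_Y_def partial_Z_def C3_def X3_def Y3_def Z3_def
      map_poly_pCons pderiv_pCons map_poly_1 one_pCons)

lemma partials_mult:
  "partial_X (F * G) = F * partial_X G + G * partial_X F"
  "partial_Y (F * G) = F * partial_Y G + G * partial_Y F"
  "partial_Z (F * G) = F * partial_Z G + G * partial_Z F"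
  using hderiv_partial by (auto simp: hderiv_def)

text \<open>Both sides are derivations along the evaluation at \<open>a\<close>, so it is enough to
  compare them on constants and variables.\<close>

lemma eval3_chain:
  fixes D :: "'a::comm_ring_1 \<Rightarrow> 'a"
  assumes e: "rhom e" and D: "hderiv id D" and c: "\<And>c. D (e c) = 0"
  shows "D (eval3 e F a) = eval3 e (partial_X F) a * D (a $ 1) + eval3 e (partial_Y F) a * D (a $ 2)
    + eval3 e (partial_Z F) a * D (a $ 3)"
proof -
  have h: "rhom (\<lambda>F. eval3 e F a)" by (rule rhom_eval3[OF e])
  interpret h: rhom "\<lambda>F. eval3 e F a" by (rule h)
  show ?thesis
    by (rule hderiv_poly3_eqI[of "\<lambda>F. eval3 e F a"])
      (auto intro!: hderiv_comp1[where h="\<lambda>F. eval3 e F a"] hderiv_comp2[where h="\<lambda>F. eval3 e F a"] hderiv_add h D hderiv_partial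
         simp: partial_simps eval3_simps[OF e] c)
qed

section \<open>Homogeneous polynomials\<close>

lemma eval3_sum:
  assumes "rhom e"
  shows "eval3 e F v = (\<Sum>k\<le>Polynomial.degree F. (\<Sum>j\<le>Polynomial.degree (Polynomial.coeff F k).
    (\<Sum>i\<le>Polynomial.degree (Polynomial.coeff (Polynomial.coeff F k) j).
      e (Polynomial.coeff (Polynomial.coeff (Polynomial.coeff F k) j) i) * (v $ 1) ^ i) * (v $ 2) ^ j) * (v $ 3) ^ k)"
proof -
  interpret rhom e by fact
  interpret h1: rhom "ev e z" for z by (rule rhom_evI) fact
  interpret h2: rhom "ev (ev e z) w" for z w by (intro rhom_evI) fact
  show ?thesis unfolding eval3_ev by (simp only: h2.ev_sum h1.ev_sum ev_sum)
qed

lemma eval3_scale: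
  assumes e: "rhom e" and F: "homogeneous d F"
  shows "eval3 e F (s *s v) = s ^ d * eval3 e F v"
proof -
  interpret rhom e by fact
  have *: "e c * (s * v $ 1) ^ i * (s * v $ 2) ^ j * (s * v $ 3) ^ k
     = s ^ d * (e c * (v $ 1) ^ i * (v $ 2) ^ j * (v $ 3) ^ k)"
    if "c = Polynomial.coeff (Polynomial.coeff (Polynomial.coeff F k) j) i" for c i j k
  proof (cases "c = 0")
    case False
    then have "d = i + j + k" using F that by (auto simp: homogeneous_def)
    then show ?thesis by (simp add: power_mult_distrib power_add mult_ac)
  qed auto
  show ?thesis
    unfolding eval3_sum[OF e] sum_distrib_left sum_distrib_right vector_smult_component
    by (rule sum.cong[OF refl], rule sum.cong[OF refl], rule sum.cong[OF refl], rule *[OF refl])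
qed

lemma homogeneous_mult:
  assumes "homogeneous d F" "homogeneous d' G"
  shows "homogeneous (d + d') (F * G)"
  unfolding homogeneous_def
proof (intro allI impI)
  fix i j k
  assume "Polynomial.coeff (Polynomial.coeff (Polynomial.coeff (F * G) k) j) i \<noteq> 0"
  then obtain a b c where abc: "a \<le> k" "b \<le> j" "c \<le> i"
     and nz: "Polynomial.coeff (Polynomial.coeff (Polynomial.coeff F a) b) c
      * Polynomial.coeff (Polynomial.coeff (Polynomial.coeff G (k - a)) (j - b)) (i - c) \<noteq> 0"
    unfolding coeff_mult coeff_sum by (metis (mono_tags, lifting) atMost_iff sum.neutral)
  then have "c + b + a = d" "(i - c) + (j - b) + (k - a) = d'"
    using assms unfolding homogeneous_def by (metis mult_zero_left mult_zero_right)+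
  then show "i + j + k = d + d'" using abc by linarith
qed

lemma coeff_of_nat_mult: "Polynomial.coeff (of_nat n * p) i = of_nat n * Polynomial.coeff p i"
  by (simp add: of_nat_poly)

abbreviation cf :: "poly3 \<Rightarrow> nat \<Rightarrow> nat \<Rightarrow> nat \<Rightarrow> complex" where
  "cf F i j k \<equiv> Polynomial.coeff (Polynomial.coeff (Polynomial.coeff F k) j) i"

lemma cf_partial:
  "cf (partial_X F) i j k = of_nat (Suc i) * cf F (Suc i) j k"
  "cf (partial_Y F) i j k = of_nat (Suc j) * cf F i (Suc j) k"
  "cf (partial_Z F) i j k = of_nat (Suc k) * cf F i j (Suc k)"
  by (simp_all add: partial_X_def partial_Y_def partial_Z_def coeff_map_poly coeff_pderiv
      coeff_of_nat_mult del: of_nat_Suc)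

lemma cf_var_mult:
  "cf (X3 * G) i j k = (case i of 0 \<Rightarrow> 0 | Suc i \<Rightarrow> cf G i j k)"
  "cf (Y3 * G) i j k = (case j of 0 \<Rightarrow> 0 | Suc j \<Rightarrow> cf G i j k)"
  "cf (Z3 * G) i j k = (case k of 0 \<Rightarrow> 0 | Suc k \<Rightarrow> cf G i j k)"
  by (auto simp: X3_def Y3_def Z3_def coeff_pCons split: nat.splits)

text \<open>For \<open>d = 0\<close> the derivatives vanish, and zero is homogeneous of every
  degree, so the truncated \<open>d - 1\<close> does no harm.\<close>

lemma homogeneous_partial:
  assumes "homogeneous d F"
  shows "homogeneous (d - 1) (partial_X F)" "homogeneous (d - 1) (partial_Y F)" "homogeneous (d - 1) (partial_Z F)"
proof -
  have F: "cf F i j k \<noteq> 0 \<Longrightarrow> i + j + k = d" for i j k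
    using assms by (simp add: homogeneous_def)
  show "homogeneous (d - 1) (partial_X F)" "homogeneous (d - 1) (partial_Y F)" "homogeneous (d - 1) (partial_Z F)"
    unfolding homogeneous_def cf_partial mult_eq_0_iff de_Morgan_disj by (safe; drule F; simp)+
qed

lemma euler:
  assumes "homogeneous d F"
  shows "X3 * partial_X F + Y3 * partial_Y F + Z3 * partial_Z F = of_nat d * F"
proof (intro poly_eqI)
  fix i j k
  have "of_nat i * cf F i j k + of_nat j * cf F i j k + of_nat k * cf F i j k = of_nat d * cf F i j k"
  proof (cases "cf F i j k = 0")
    case False
    then have "d = i + j + k" using assms by (simp add: homogeneous_def)
    then show ?thesis by (simp add: algebra_simps)
  qed simp
  moreover have "cf (X3 * partial_X F) i j k = of_nat i * cf F i j k"
    "cf (Y3 * partial_Y F) i j k = of_nat j * cf F i j k"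
    "cf (Z3 * partial_Z F) i j k = of_nat k * cf F i j k"
    unfolding cf_var_mult cf_partial by (auto split: nat.splits)
  ultimately show "cf (X3 * partial_X F + Y3 * partial_Y F + Z3 * partial_Z F) i j k = cf (of_nat d * F) i j k"
    by (simp add: coeff_of_nat_mult)
qed

section \<open>Elimination and the Nullstellensatz for a hypersurface\<close>

lemma prime_factor_pos_degree:
  fixes m :: "'a::{factorial_ring_gcd,semiring_gcd_mult_normalize} poly"
  assumes "Polynomial.degree m > 0"
  shows "\<exists>\<pi>. prime_elem \<pi> \<and> \<pi> dvd m \<and> Polynomial.degree \<pi> > 0"
  using assms
proof (induction m rule: prime_divisors_induct)
  case (unit x)
  then show ?case by (auto simp: is_unit_poly_iff)
next
  case (factor p x)
  show ?case
  proof (cases "Polynomial.degree p > 0")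
    case True
    then show ?thesis using factor by (auto intro!: exI[of _ p])
  next
    case False
    then have "Polynomial.degree x > 0" using factor degree_mult_le[of p x] by linarith
    then show ?thesis using factor by (auto intro: dvd_mult)
  qed
qed auto

text \<open>Bezout over the fraction field with denominators cleared. By pseudo-division, an element
  \<open>m\<close> of least degree in the ideal of \<open>p\<close> and \<open>g\<close> divides
  every element up to a nonzero scalar; a prime factor of \<open>m\<close> of positive degree would
  therefore be common to \<open>p\<close> and \<open>g\<close>.\<close>

lemma elimination:
  fixes p g :: "'a::{factorial_ring_gcd,semiring_gcd_mult_normalize} poly"
  assumes "p \<noteq> 0"
    and nocommon: "\<And>\<pi>. prime_elem \<pi> \<Longrightarrow> \<pi> dvd p \<Longrightarrow> \<pi> dvd g \<Longrightarrow> Polynomial.degree \<pi> = 0"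
  shows "\<exists>\<alpha> \<beta> r. r \<noteq> 0 \<and> \<alpha> * p + \<beta> * g = [:r:]"
proof -
  define S where "S = {m. m \<noteq> 0 \<and> (\<exists>\<alpha> \<beta>. m = \<alpha> * p + \<beta> * g)}"
  have pS: "p \<in> S" using assms(1) unfolding S_def mem_Collect_eq by (metis add.right_neutral mult_1 mult_zero_left)
  obtain m where m: "m \<in> S" and min: "\<And>y. y \<in> S \<Longrightarrow> Polynomial.degree m \<le> Polynomial.degree y"
    using ex_has_least_nat[of "\<lambda>x. x \<in> S" p Polynomial.degree] pS by blast
  obtain \<alpha> \<beta> where m0: "m \<noteq> 0" and mab: "m = \<alpha> * p + \<beta> * g" using m by (auto simp: S_def)
  have div: "\<exists>c q. c \<noteq> 0 \<and> Polynomial.smult c f = m * q" if f: "f = \<gamma> * p + \<delta> * g" for f \<gamma> \<delta>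
  proof -
    obtain q r where qr: "pseudo_divmod f m = (q, r)" by fastforce
    define c where "c = Polynomial.coeff m (Polynomial.degree m) ^ (Suc (Polynomial.degree f) - Polynomial.degree m)"
    have rd: "Polynomial.smult c f = m * q + r" "r = 0 \<or> Polynomial.degree r < Polynomial.degree m"
      using pseudo_divmod[OF m0 qr] by (auto simp: c_def)
    moreover have "r = 0"
    proof (rule ccontr)
      assume "r \<noteq> 0"
      have "r = Polynomial.smult c f - m * q" using \<open>Polynomial.smult c f = m * q + r\<close> by simp
      also have "\<dots> = ([:c:] * \<gamma> - \<alpha> * q) * p + ([:c:] * \<delta> - \<beta> * q) * g"
        unfolding f mab by (simp add: algebra_simps smult_add_right)
      finally have "r \<in> S" using \<open>r \<noteq> 0\<close> unfolding S_def by blast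
      then show False using min[of r] rd \<open>r \<noteq> 0\<close> by simp
    qed
    ultimately show ?thesis using m0 by (intro exI[of _ c] exI[of _ q]) (auto simp: c_def)
  qed
  have "Polynomial.degree m = 0"
  proof (rule ccontr)
    assume "Polynomial.degree m \<noteq> 0"
    then obtain \<pi> where \<pi>: "prime_elem \<pi>" "\<pi> dvd m" "Polynomial.degree \<pi> > 0"
      using prime_factor_pos_degree[of m] by auto
    have "\<pi> dvd f" if fgd: "f = \<gamma> * p + \<delta> * g" for f \<gamma> \<delta>
    proof -
      obtain c q where c: "c \<noteq> 0" "[:c:] * f = m * q" using div[OF fgd] by auto
      have "\<pi> dvd [:c:] * f" using \<pi>(2) unfolding c(2) by (rule dvd_mult2)
      then have "\<pi> dvd [:c:] \<or> \<pi> dvd f" using \<pi>(1) by (rule prime_elem_dvd_multD[rotated])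
      moreover have "\<not> \<pi> dvd [:c:]" using \<pi>(3) c(1) dvd_imp_degree_le[of \<pi> "[:c:]"] by auto
      ultimately show ?thesis by blast
    qed
    from this[of p 1 0] this[of g 0 1] nocommon[OF \<pi>(1)] \<pi>(3) show False by simp
  qed
  then obtain r where "m = [:r:]" by (meson degree_eq_zeroE)
  then show ?thesis using m0 mab by (intro exI[of _ \<alpha>] exI[of _ \<beta>] exI[of _ r]) auto
qed

text \<open>In characteristic zero a prime of positive degree does not divide its own derivative, so
  a common factor of \<open>F\<close> and its derivative would divide \<open>F\<close>
  twice.\<close>

lemma elimination_squarefree:
  fixes F :: "'a::{factorial_ring_gcd,semiring_gcd_mult_normalize,ring_char_0} poly"
  assumes "squarefree F" "F \<noteq> 0"
  shows "\<exists>\<alpha> \<beta> r. r \<noteq> 0 \<and> \<alpha> * F + \<beta> * pderiv F = [:r:]"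
proof (rule elimination[OF assms(2)], rule ccontr)
  fix \<pi> assume \<pi>: "prime_elem \<pi>" "\<pi> dvd F" "\<pi> dvd pderiv F" and d: "Polynomial.degree \<pi> \<noteq> 0"
  obtain k where k: "F = \<pi> * k" using \<pi> by auto
  have "pderiv F = \<pi> * pderiv k + k * pderiv \<pi>" by (simp add: k pderiv_mult)
  then have "\<pi> dvd k * pderiv \<pi>" using \<pi>(3) by (metis dvd_add_right_iff dvd_triv_left)
  moreover have "\<not> \<pi> dvd pderiv \<pi>"
  proof
    assume "\<pi> dvd pderiv \<pi>"
    moreover have "pderiv \<pi> \<noteq> 0" using d by (simp add: pderiv_eq_0_iff)
    ultimately show False using dvd_imp_degree_le[of \<pi> "pderiv \<pi>"] d by (simp add: degree_pderiv)
  qed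
  ultimately have "\<pi> dvd k" using \<pi>(1) by (simp add: prime_elem_dvd_mult_iff)
  then have "\<pi> ^ 2 dvd F" by (auto simp: k power2_eq_square)
  then show False using assms(1) \<pi>(1) by (auto simp: squarefree_def)
qed

lemma squarefree_dvd_if_primes:
  fixes F G :: "'a::factorial_semiring"
  assumes "squarefree F" "F \<noteq> 0" and "\<And>p. prime_elem p \<Longrightarrow> p dvd F \<Longrightarrow> p dvd G"
  shows "F dvd G"
proof (cases "G = 0")
  case False
  show ?thesis
  proof (rule multiplicity_le_imp_dvd)
    fix p :: 'a assume p: "prime p"
    have "multiplicity p F \<le> 1"
      using assms(1,2) p squarefree_factorial_semiring''[of F] by simp
    moreover have "multiplicity p F = 0" if "\<not> p dvd G"
      using assms(3)[of p] that p by (auto intro!: not_dvd_imp_multiplicity_0)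
    moreover have "multiplicity p G \<ge> 1" if "p dvd G"
      using that False p prime_multiplicity_gt_zero_iff[of p G] by (simp add: Suc_le_eq)
    ultimately show "multiplicity p F \<le> multiplicity p G" by fastforce
  qed (use assms in auto)
qed auto

text \<open>\<open>E\<close> plays the part of the points of the ring. Its second clause says that
  values determine functions, its third is the Nullstellensatz for one prime element; the two are
  carried together to one more variable.\<close>

definition separating :: "('a::comm_ring_1 \<Rightarrow> complex) set \<Rightarrow> bool" where
  "separating E \<longleftrightarrow> (\<forall>h\<in>E. rhom h) \<and> (\<forall>g. g \<noteq> 0 \<longrightarrow> (\<exists>h\<in>E. h g \<noteq> 0))
     \<and> (\<forall>p g. prime_elem p \<longrightarrow> (\<forall>h\<in>E. h p = 0 \<longrightarrow> h g = 0) \<longrightarrow> p dvd g)"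

text \<open>If \<open>p\<close> has positive degree and does not divide \<open>g\<close>, eliminate
  to \<open>r = \<alpha> p + \<beta> g\<close>. At a point where neither \<open>r\<close> nor the
  leading coefficient of \<open>p\<close> vanishes, \<open>p\<close> stays nonconstant and has a
  root; there \<open>g\<close> vanishes too, which forces \<open>r\<close> to vanish. For constant
  \<open>p\<close> one argues coefficient by coefficient.\<close>

lemma separating_ev:
  fixes E :: "('a::{factorial_ring_gcd,semiring_gcd_mult_normalize} \<Rightarrow> complex) set"
  assumes E: "separating E"
  shows "separating ((\<lambda>(h, z). ev h z) ` (E \<times> UNIV))"
proof -
  have hom: "rhom h" if "h \<in> E" for h using E that by (auto simp: separating_def)
  have sep: "\<exists>h\<in>E. h g \<noteq> 0" if "g \<noteq> 0" for g using E that by (auto simp: separating_def)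
  have ns: "p dvd g" if "prime_elem p" "\<And>h. h \<in> E \<Longrightarrow> h p = 0 \<Longrightarrow> h g = 0" for p g
    using E that by (auto simp: separating_def)
  have van0: "map_poly h g = 0" if "h \<in> E" "\<And>z. ev h z g = 0" for h g
    using that(2) poly_all_0_iff_0[of "map_poly h g"] by (auto simp: ev_def)
  show ?thesis unfolding separating_def
  proof (intro conjI ballI allI impI)
    fix f assume "f \<in> (\<lambda>(h, z). ev h z) ` (E \<times> UNIV)"
    then show "rhom f" using hom by auto
  next
    fix g :: "'a poly" assume "g \<noteq> 0"
    then obtain h where h: "h \<in> E" "h (Polynomial.lead_coeff g) \<noteq> 0"
      using sep[of "Polynomial.lead_coeff g"] by auto
    interpret rhom h using h hom by auto
    have "Polynomial.coeff (map_poly h g) (Polynomial.degree g) \<noteq> 0"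
      using h by (simp add: coeff_map_poly)
    then have "map_poly h g \<noteq> 0" by auto
    then obtain z where "ev h z g \<noteq> 0" using van0[OF h(1)] by blast
    then show "\<exists>f\<in>(\<lambda>(h, z). ev h z) ` (E \<times> UNIV). f g \<noteq> 0" using h by auto
  next
    fix p g :: "'a poly"
    assume p: "prime_elem p" and *: "\<forall>f\<in>(\<lambda>(h, z). ev h z) ` (E \<times> UNIV). f p = 0 \<longrightarrow> f g = 0"
    then have van: "ev h z g = 0" if "h \<in> E" "ev h z p = 0" for h z using that by auto
    show "p dvd g"
    proof (cases "Polynomial.degree p = 0")
      case True
      then obtain c where c: "p = [:c:]" by (meson degree_eq_zeroE)
      have "c dvd Polynomial.coeff g n" for n
      proof (rule ns)
        show "prime_elem c" using p by (simp add: c prime_elem_const_poly_iff)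
        fix h assume h: "h \<in> E" "h c = 0"
        interpret rhom h using h hom by auto
        have "map_poly h g = 0" using h van by (intro van0) (auto simp: c)
        then have "Polynomial.coeff (map_poly h g) n = 0" by simp
        then show "h (Polynomial.coeff g n) = 0" by (simp add: coeff_map_poly)
      qed
      then show ?thesis by (simp add: c const_poly_dvd_iff)
    next
      case False
      show ?thesis
      proof (rule ccontr)
        assume ndvd: "\<not> p dvd g"
        have "\<exists>\<alpha> \<beta> r. r \<noteq> 0 \<and> \<alpha> * p + \<beta> * g = [:r:]"
        proof (rule elimination)
          show "p \<noteq> 0" using p by auto
          fix \<pi> assume \<pi>: "prime_elem \<pi>" "\<pi> dvd p" "\<pi> dvd g"
          then have "p dvd \<pi>" 
            using irreducibleD'[OF prime_elem_imp_irreducible[OF p] \<pi>(2)] prime_elem_not_unit[OF \<pi>(1)] by blast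
          then show "Polynomial.degree \<pi> = 0" using ndvd \<pi>(3) dvd_trans by blast
        qed
        then obtain \<alpha> \<beta> r where r: "r \<noteq> 0" "\<alpha> * p + \<beta> * g = [:r:]" by blast
        define l where "l = Polynomial.lead_coeff p"
        have "r * l \<noteq> 0" using r(1) False by (auto simp: l_def)
        then obtain h where h: "h \<in> E" "h (r * l) \<noteq> 0" using sep by blast
        interpret rhom h using h hom by auto
        interpret e: rhom "ev h z" for z using h hom by auto
        have "Polynomial.coeff (map_poly h p) (Polynomial.degree p) \<noteq> 0"
          using h(2) by (auto simp: coeff_map_poly l_def)
        from le_degree[OF this] have "Polynomial.degree (map_poly h p) \<noteq> 0" using False by linarith
        then have "\<not> constant (poly (map_poly h p))" by (simp add: constant_degree)
        then obtain z where z: "ev h z p = 0" unfolding ev_def using fundamental_theorem_of_algebra by blast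
        have "ev h z (\<alpha> * p + \<beta> * g) = 0" using z van[OF h(1) z] by simp
        then have "h r = 0" unfolding r(2) by simp
        then show False using h(2) by simp
      qed
    qed
  qed
qed

lemma separating_eval3: "separating (range (\<lambda>v. \<lambda>F. eval3 id F v))"
proof -
  \<comment> \<open>A field has no prime elements, so the last clause of \<open>separating\<close>
    is vacuous.\<close>
  have "separating {id :: complex \<Rightarrow> complex}"
    unfolding separating_def using field_class.field_inverse
    by (auto simp: prime_elem_def dvd_field_iff)
  from separating_ev[OF separating_ev[OF separating_ev[OF this]]]
  have "separating ((\<lambda>(h, z). ev h z) ` ((\<lambda>(h, z). ev h z) ` ((\<lambda>(h, z). ev h z) ` ({id} \<times> UNIV) \<times> UNIV) \<times> UNIV)
    :: (poly3 \<Rightarrow> complex) set)" .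
  moreover have "\<dots> = range (\<lambda>v. \<lambda>F. eval3 id F v)"
  proof -
    have "(\<lambda>F. eval3 id F v) = ev (ev (ev id (v $ 1)) (v $ 2)) (v $ 3)" for v :: "complex ^ 3"
      by (simp add: eval3_ev fun_eq_iff)
    moreover have "ev (ev (ev id x) y) z = (\<lambda>F. eval3 id F (vector [x, y, z]))" for x y z :: complex
      by (simp add: eval3_ev fun_eq_iff)
    ultimately show ?thesis
      by (intro equalityI subsetI) (force simp: image_iff)+
  qed
  ultimately show ?thesis by simp
qed

lemma eval3_id_hom: "rhom (\<lambda>F. eval3 id F v)"
  by (intro rhom_eval3) auto

lemma nullstellensatz:
  assumes "squarefree F" "F \<noteq> 0" and "\<And>v. eval3 id F v = 0 \<Longrightarrow> eval3 id G v = 0"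
  shows "F dvd G"
proof (rule squarefree_dvd_if_primes[OF assms(1,2)])
  fix p assume p: "prime_elem p" "p dvd F"
  have "eval3 id G v = 0" if "eval3 id p v = 0" for v
    using rhom.dvd[OF eval3_id_hom p(2), of v] that assms(3) by simp
  then show "p dvd G" using separating_eval3 p(1) by (auto simp: separating_def)
qed

section \<open>Equations of curves\<close>

lemma squarefree_poly3_nonzero: "squarefree (F :: poly3) \<Longrightarrow> F \<noteq> 0"
proof
  assume "squarefree F" "F = 0"
  then have "[:0, 1:] dvd (1 :: poly3)" unfolding squarefree_def by auto
  then show False by (auto simp: is_unit_poly_iff)
qed

lemma zero_locus_iff:
  assumes "homogeneous d F" "v \<noteq> 0"
  shows "vec.span {v} \<in> zero_locus F \<longleftrightarrow> eval3 id F v = 0"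
proof
  assume "vec.span {v} \<in> zero_locus F"
  then show "eval3 id F v = 0" by (auto simp: zero_locus_def vec.span_base)
next
  assume *: "eval3 id F v = 0"
  have "eval3 id F w = 0" if w: "w \<in> vec.span {v}" for w
  proof -
    obtain s where "w = s *s v" using w by (auto simp: vec.span_singleton)
    then show ?thesis using eval3_scale[OF rhom_id(1) assms(1)] * by simp
  qed
  then show "vec.span {v} \<in> zero_locus F" using assms(2) by (auto simp: zero_locus_def proj_plane_def)
qed

lemma eval3_zero:
  assumes "homogeneous d F" "d > 0"
  shows "eval3 id F 0 = 0"
  using eval3_scale[OF rhom_id(1) assms(1), of 0 0] assms(2) by (simp add: power_0_left)

lemma zero_locus_mult: 
  assumes "homogeneous d F" "homogeneous d' G"
  shows "zero_locus (F * G) = zero_locus F \<union> zero_locus G"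
proof -
  interpret rhom "\<lambda>F. eval3 id F v" for v by (rule eval3_id_hom)
  have "P \<in> zero_locus (F * G) \<longleftrightarrow> P \<in> zero_locus F \<union> zero_locus G" for P
  proof (cases "P \<in> proj_plane")
    case True
    then obtain v where "P = vec.span {v}" "v \<noteq> 0" by (auto simp: proj_plane_def)
    then show ?thesis
      using zero_locus_iff[OF homogeneous_mult[OF assms]] zero_locus_iff[OF assms(1)] zero_locus_iff[OF assms(2)] by simp
  qed (auto simp: zero_locus_def)
  then show ?thesis by blast
qed

text \<open>Two squarefree forms with the same zeros divide each other, and units are constants.
  This removes the arbitrariness in the choice made by \<open>curve_eq\<close>.\<close>

lemma reduced_equation_unique:
  assumes F: "reduced_equation F" and G: "reduced_equation G" and eq: "zero_locus F = zero_locus G"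
  shows "\<exists>c. c \<noteq> 0 \<and> G = C3 c * F"
proof -
  obtain d where d: "homogeneous d F" "d > 0" "squarefree F" using F by (auto simp: reduced_equation_def)
  obtain d' where d': "homogeneous d' G" "d' > 0" "squarefree G" using G by (auto simp: reduced_equation_def)
  \<comment> \<open>The zero vector spans no point and is treated apart; both forms vanish there
    because their degrees are positive.\<close>
  have iff: "eval3 id F v = 0 \<longleftrightarrow> eval3 id G v = 0" for v
    using zero_locus_iff[OF d(1), of v] zero_locus_iff[OF d'(1), of v] eq
    by (cases "v = 0") (auto simp: eval3_zero[OF d(1,2)] eval3_zero[OF d'(1,2)])
  have F0: "F \<noteq> 0" "G \<noteq> 0" using d d' squarefree_poly3_nonzero by auto
  have "F dvd G" "G dvd F"
    using nullstellensatz[OF d(3) F0(1)] nullstellensatz[OF d'(3) F0(2)] iff by auto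
  from this(1) obtain k where k: "G = F * k" by (rule dvdE)
  from \<open>G dvd F\<close> obtain l where l: "F = G * l" by (rule dvdE)
  have "F * (k * l) = F * 1" using k l by (simp add: mult.assoc[symmetric])
  then have "k * l = 1" using F0 by (metis mult_cancel_left)
  then have "k dvd 1" by (metis dvd_triv_left)
  then obtain a where "k = [:[:[:a:]:]:]" "a dvd 1" by (auto simp: is_unit_poly_iff)
  moreover from this have "a \<noteq> 0" by auto
  ultimately show ?thesis using k by (auto simp: C3_def mult.commute)
qed

lemma curve_eq_reduced:
  assumes "reduced_curve C"
  shows "reduced_equation (curve_eq C)" "zero_locus (curve_eq C) = C"
  using someI_ex[of "\<lambda>F. reduced_equation F \<and> zero_locus F = C"] assms
  by (auto simp: reduced_curve_def curve_eq_def)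

lemma curve_degreeI:
  assumes "homogeneous d (curve_eq C)" "curve_eq C \<noteq> 0"
  shows "curve_degree C = d"
  unfolding curve_degree_def
proof (rule the_equality)
  fix d' assume d': "homogeneous d' (curve_eq C)"
  obtain i j k where "cf (curve_eq C) i j k \<noteq> 0" using assms(2) by (metis poly_eqI coeff_0)
  then show "d' = d" using d' assms(1) unfolding homogeneous_def by metis
qed (rule assms)

section \<open>Codimension of subspaces of power series\<close>

lemma const2_simps [simp]:
  "const2 0 = 0" "const2 1 = 1" "const2 (a + b) = const2 a + const2 b" "const2 (a * b) = const2 a * const2 b"
  "const2 (- a) = - const2 a" "const2 (a - b) = const2 a - const2 b"
  by (simp_all add: const2_def)

lemma rhom_const2 [intro]: "rhom const2"
  by unfold_locales auto

definition csub :: "fps2 set \<Rightarrow> bool" where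
  "csub V \<longleftrightarrow> 0 \<in> V \<and> (\<forall>f\<in>V. \<forall>g\<in>V. f + g \<in> V) \<and> (\<forall>c. \<forall>f\<in>V. const2 c * f \<in> V)"

lemma csub_UNIV [simp]: "csub UNIV" by (simp add: csub_def)

lemma csub_uminus: "csub V \<Longrightarrow> f \<in> V \<Longrightarrow> - f \<in> V"
  unfolding csub_def by (metis const2_simps(2,5) mult_minus1)

lemma csub_diff: "csub V \<Longrightarrow> f \<in> V \<Longrightarrow> g \<in> V \<Longrightarrow> f - g \<in> V"
  using csub_uminus[of V g] unfolding csub_def by (metis diff_conv_add_uminus)

lemma csub_sum: "csub V \<Longrightarrow> (\<And>i. i \<in> A \<Longrightarrow> f i \<in> V) \<Longrightarrow> sum f A \<in> V"
  by (induction A rule: infinite_finite_induct) (auto simp: csub_def)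

definition clin :: "fps2 set \<Rightarrow> (fps2 \<Rightarrow> nat \<Rightarrow> complex) \<Rightarrow> bool" where
  "clin V L \<longleftrightarrow> (\<forall>f\<in>V. \<forall>g\<in>V. \<forall>i. L (f + g) i = L f i + L g i) \<and> (\<forall>c. \<forall>f\<in>V. \<forall>i. L (const2 c * f) i = c * L f i)"

lemma clin_add: "clin V L \<Longrightarrow> f \<in> V \<Longrightarrow> g \<in> V \<Longrightarrow> L (f + g) i = L f i + L g i"
  and clin_scale: "clin V L \<Longrightarrow> f \<in> V \<Longrightarrow> L (const2 c * f) i = c * L f i"
  by (auto simp: clin_def)

lemma clin_0: "clin V L \<Longrightarrow> 0 \<in> V \<Longrightarrow> L 0 i = 0"
  using clin_scale[of V L 0 0 i] by simp

lemma clin_diff: "clin V L \<Longrightarrow> csub V \<Longrightarrow> f \<in> V \<Longrightarrow> g \<in> V \<Longrightarrow> L (f - g) i = L f i - L g i"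
  using clin_add[of V L "f - g" g i] csub_diff[of V f g] by simp

lemma clin_sum:
  assumes "clin V L" "csub V" "\<And>i. i \<in> A \<Longrightarrow> f i \<in> V"
  shows "L (sum f A) k = (\<Sum>i\<in>A. L (f i) k)"
  using assms(3)
proof (induction A rule: infinite_finite_induct)
  case (insert x F)
  then show ?case using clin_add[OF assms(1), of "f x" "sum f F" k] csub_sum[OF assms(2), of F f] by simp
qed (use assms clin_0[of V L k] in \<open>auto simp: csub_def\<close>)

lemma clin_comb:
  assumes "clin V L" "csub V" "\<And>i. i \<in> A \<Longrightarrow> e i \<in> V"
  shows "L (\<Sum>i\<in>A. const2 (c i) * e i) k = (\<Sum>i\<in>A. c i * L (e i) k)"
proof -
  have "L (\<Sum>i\<in>A. const2 (c i) * e i) k = (\<Sum>i\<in>A. L (const2 (c i) * e i) k)"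
    using assms by (intro clin_sum) (auto simp: csub_def)
  also have "\<dots> = (\<Sum>i\<in>A. c i * L (e i) k)"
    by (intro sum.cong refl clin_scale[OF assms(1)] assms(3))
  finally show ?thesis .
qed

definition coords :: "nat \<Rightarrow> (nat \<Rightarrow> complex) set" where
  "coords n = {c. \<forall>i\<ge>n. c i = 0}"

text \<open>\<open>V/I\<close> has dimension \<open>n\<close>, witnessed by coordinates on
  \<open>V\<close> with kernel \<open>I\<close> and image the sequences supported below
  \<open>n\<close>; no quotient space is formed. Being a relation, it also asserts
  finiteness.\<close>

definition codim :: "fps2 set \<Rightarrow> fps2 set \<Rightarrow> nat \<Rightarrow> bool" where
  "codim V I n \<longleftrightarrow> (\<exists>L. clin V L \<and> (\<forall>f\<in>V. (\<forall>i. L f i = 0) \<longleftrightarrow> f \<in> I) \<and> L ` V = coords n)"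

lemma codim_refl: "V \<noteq> {} \<Longrightarrow> codim V V 0"
  unfolding codim_def by (rule exI[of _ "\<lambda>_ _. 0"]) (auto simp: clin_def coords_def)

lemma codim_basis:
  assumes "L ` V = coords n"
  shows "\<exists>e. (\<forall>i<n. e i \<in> V \<and> L (e i) = (\<lambda>k. if k = i then 1 else 0))"
proof -
  have "\<exists>v. v \<in> V \<and> L v = (\<lambda>k. if k = i then 1 else 0)" if "i < n" for i
  proof -
    have "(\<lambda>k. if k = i then 1 else 0) \<in> L ` V" using that by (auto simp: assms coords_def)
    then show ?thesis by (auto simp: image_iff)
  qed
  then show ?thesis by metis
qed

text \<open>Gaussian elimination: a vector with nonzero last coordinate clears that coordinate from
  the others, and the induction on \<open>n\<close> takes over.\<close>

lemma more_vectors_dependent: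
  fixes a :: "'i \<Rightarrow> nat \<Rightarrow> complex"
  assumes "finite S" "card S > n" "\<And>i. i \<in> S \<Longrightarrow> a i \<in> coords n"
  shows "\<exists>c. (\<exists>i\<in>S. c i \<noteq> 0) \<and> (\<forall>k. (\<Sum>i\<in>S. c i * a i k) = 0)"
  using assms
proof (induction n arbitrary: S a)
  case 0
  then have "S \<noteq> {}" by auto
  then show ?case using 0 by (intro exI[of _ "\<lambda>_. 1"]) (auto simp: coords_def)
next
  case (Suc n)
  show ?case
  proof (cases "\<forall>i\<in>S. a i n = 0")
    case True
    have "a i k = 0" if "i \<in> S" "n \<le> k" for i k
      using True Suc.prems(3)[OF that(1)] that by (cases "k = n") (auto simp: coords_def)
    then have "a i \<in> coords n" if "i \<in> S" for i using that by (auto simp: coords_def)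
    then show ?thesis using Suc by (intro Suc.IH) auto
  next
    case False
    then obtain p where p: "p \<in> S" "a p n \<noteq> 0" by auto
    define b where "b i k = a i k - a i n / a p n * a p k" for i k
    have "b i k = 0" if "i \<in> S" "n \<le> k" for i k
      using Suc.prems(3)[OF that(1)] Suc.prems(3)[OF p(1)] p(2) that
      by (cases "k = n") (auto simp: coords_def b_def)
    then have "b i \<in> coords n" if "i \<in> S" for i using that by (auto simp: coords_def)
    moreover have "card (S - {p}) > n" using Suc.prems p by simp
    ultimately obtain c where c: "\<exists>i\<in>S - {p}. c i \<noteq> 0" "\<And>k. (\<Sum>i\<in>S - {p}. c i * b i k) = 0"
      using Suc.IH[of "S - {p}" b] Suc.prems(1) by auto
    define c' where "c' i = (if i = p then - (\<Sum>i\<in>S - {p}. c i * (a i n / a p n)) else c i)" for i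
    have "(\<Sum>i\<in>S. c' i * a i k) = 0" for k
    proof -
      have "(\<Sum>i\<in>S. c' i * a i k) = c' p * a p k + (\<Sum>i\<in>S - {p}. c' i * a i k)"
        using p Suc.prems by (intro sum.remove) auto
      also have "(\<Sum>i\<in>S - {p}. c' i * a i k) = (\<Sum>i\<in>S - {p}. c i * a i k)"
        by (intro sum.cong) (auto simp: c'_def)
      also have "\<dots> = (\<Sum>i\<in>S - {p}. c i * b i k + c i * (a i n / a p n) * a p k)"
        by (intro sum.cong) (auto simp: b_def algebra_simps)
      also have "\<dots> = (\<Sum>i\<in>S - {p}. c i * b i k) + (\<Sum>i\<in>S - {p}. c i * (a i n / a p n)) * a p k"
        by (simp add: sum.distrib sum_distrib_right)
      finally show ?thesis by (simp add: c(2) c'_def)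
    qed
    moreover have "\<exists>i\<in>S. c' i \<noteq> 0" using c(1) by (auto simp: c'_def)
    ultimately show ?thesis by blast
  qed
qed

text \<open>If \<open>m > n\<close>, some combination of vectors dual to the coordinates
  \<open>M\<close> is killed by \<open>L\<close>. It lies in \<open>I\<close>, so \<open>M\<close>
  kills it as well, although \<open>M\<close> reads off its coefficients.\<close>

lemma codim_le:
  assumes V: "csub V" and n: "codim V I n" and m: "codim V I m"
  shows "m \<le> n"
proof (rule ccontr)
  assume "\<not> m \<le> n"
  obtain L where L: "clin V L" "\<And>f. f \<in> V \<Longrightarrow> (\<forall>i. L f i = 0) \<longleftrightarrow> f \<in> I" "L ` V = coords n"
    using n by (auto simp: codim_def)
  obtain M where M: "clin V M" "\<And>f. f \<in> V \<Longrightarrow> (\<forall>i. M f i = 0) \<longleftrightarrow> f \<in> I" "M ` V = coords m"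
    using m by (auto simp: codim_def)
  obtain e where e: "\<And>i. i < m \<Longrightarrow> e i \<in> V" "\<And>i. i < m \<Longrightarrow> M (e i) = (\<lambda>k. if k = i then 1 else 0)"
    using codim_basis[OF M(3)] by blast
  obtain c where c: "\<exists>i\<in>{..<m}. c i \<noteq> 0" "\<And>k. (\<Sum>i\<in>{..<m}. c i * L (e i) k) = 0"
    using more_vectors_dependent[of "{..<m}" n "\<lambda>i. L (e i)"] \<open>\<not> m \<le> n\<close> L(3) e(1) by fastforce
  define v where "v = (\<Sum>i<m. const2 (c i) * e i)"
  have vV: "v \<in> V" unfolding v_def using V e(1) by (intro csub_sum) (auto simp: csub_def)
  have "L v k = 0" for k
    unfolding v_def using clin_comb[OF L(1) V, of "{..<m}" e c k] e(1) c(2) by simp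
  then have "M v k = 0" for k using L(2)[OF vV] M(2)[OF vV] by blast
  moreover have "M v k = c k" if "k < m" for k
  proof -
    have "M v k = (\<Sum>i<m. c i * M (e i) k)"
      unfolding v_def using clin_comb[OF M(1) V, of "{..<m}" e c k] e(1) by simp
    also have "\<dots> = (\<Sum>i<m. if i = k then c i else 0)"
      by (intro sum.cong) (auto simp: e(2))
    finally show ?thesis using that by simp
  qed
  ultimately show False using c(1) by auto
qed

lemma codim_unique: "csub V \<Longrightarrow> codim V I n \<Longrightarrow> codim V I m \<Longrightarrow> n = m"
  using codim_le[of V I n m] codim_le[of V I m n] by simp

text \<open>Additivity of dimension along \<open>I \<subseteq> J \<subseteq> V\<close>, with
  \<open>J/I\<close> identified with \<open>W/I'\<close> through \<open>\<phi>\<close>. In this form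
  it directly accepts multiplication by a germ as \<open>\<phi>\<close>.\<close>

lemma codim_add:
  assumes V: "csub V" and W: "csub W" and I: "csub I" and JV: "J \<subseteq> V" and IJ: "I \<subseteq> J"
    and \<phi>: "\<And>f g. f \<in> W \<Longrightarrow> g \<in> W \<Longrightarrow> \<phi> (f + g) = \<phi> f + \<phi> g" "\<And>c f. f \<in> W \<Longrightarrow> \<phi> (const2 c * f) = const2 c * \<phi> f"
    and \<phi>J: "\<And>w. w \<in> W \<Longrightarrow> \<phi> w \<in> J"
    and onto: "\<And>j. j \<in> J \<Longrightarrow> \<exists>w\<in>W. j - \<phi> w \<in> I"
    and ker: "\<And>w. w \<in> W \<Longrightarrow> \<phi> w \<in> I \<longleftrightarrow> w \<in> I'"
    and n: "codim V J n" and m: "codim W I' m"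
  shows "codim V I (n + m)"
proof -
  obtain L where L: "clin V L" "\<And>f. f \<in> V \<Longrightarrow> (\<forall>i. L f i = 0) \<longleftrightarrow> f \<in> J" "L ` V = coords n"
    using n by (auto simp: codim_def)
  obtain M where M: "clin W M" "\<And>f. f \<in> W \<Longrightarrow> (\<forall>i. M f i = 0) \<longleftrightarrow> f \<in> I'" "M ` W = coords m"
    using m by (auto simp: codim_def)
  obtain e where e: "\<And>i. i < n \<Longrightarrow> e i \<in> V" "\<And>i. i < n \<Longrightarrow> L (e i) = (\<lambda>k. if k = i then 1 else 0)"
    using codim_basis[OF L(3)] by blast
  have Ln: "L v k = 0" if "v \<in> V" "k \<ge> n" for v k
    using that L(3) by (auto simp: coords_def image_def set_eq_iff)
  have Mm: "M w k = 0" if "w \<in> W" "k \<ge> m" for w k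
    using that M(3) by (auto simp: coords_def image_def set_eq_iff)
  \<comment> \<open>A linear section of the coordinates \<open>L\<close>.\<close>
  define s where "s c = (\<Sum>i<n. const2 (c i) * e i)" for c
  have sV: "s c \<in> V" for c unfolding s_def using V e(1) by (intro csub_sum) (auto simp: csub_def)
  have Ls: "L (s c) k = (if k < n then c k else 0)" for c k
  proof -
    have "L (s c) k = (\<Sum>i<n. c i * L (e i) k)"
      unfolding s_def using clin_comb[OF L(1) V, of "{..<n}" e c k] e(1) by simp
    also have "\<dots> = (\<Sum>i<n. if i = k then c i else 0)"
      by (intro sum.cong) (auto simp: e(2))
    finally show ?thesis by simp
  qed
  \<comment> \<open>Removing the lift of its own coordinates projects \<open>v\<close> into
    \<open>J\<close>.\<close>
  define r where "r v = v - s (L v)" for v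
  have rJ: "r v \<in> J" if "v \<in> V" for v
  proof -
    have "r v \<in> V" unfolding r_def using V that sV by (intro csub_diff) auto
    moreover have "L (r v) k = 0" for k
      unfolding r_def using clin_diff[OF L(1) V that sV] Ls Ln[OF that] by (cases "k < n") auto
    ultimately show ?thesis using L(2) by blast
  qed
  \<comment> \<open>An arbitrary preimage modulo \<open>I\<close>. It is not linear, but
    \<open>Mw\<close> shows that its \<open>M\<close>-coordinates do not depend on the
    choice.\<close>
  define w where "w j = (SOME w. w \<in> W \<and> j - \<phi> w \<in> I)" for j
  have w: "w j \<in> W" "j - \<phi> (w j) \<in> I" if "j \<in> J" for j
    using someI_ex[of "\<lambda>w. w \<in> W \<and> j - \<phi> w \<in> I"] onto[OF that] unfolding w_def by blast+
  have \<phi>diff: "\<phi> (f - g) = \<phi> f - \<phi> g" if "f \<in> W" "g \<in> W" for f g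
    using \<phi>(1)[of "f - g" g] that csub_diff[OF W] by simp
  have Mw: "M (w j) k = M x k" if "j \<in> J" "x \<in> W" "j - \<phi> x \<in> I" for j x k
  proof -
    have "\<phi> (x - w j) \<in> I"
      using csub_diff[OF I w(2)[OF that(1)] that(3)] \<phi>diff[OF that(2) w(1)[OF that(1)]] by simp
    then have "x - w j \<in> I'" using ker csub_diff[OF W that(2) w(1)[OF that(1)]] by blast
    then have "M (x - w j) k = 0" using M(2) csub_diff[OF W that(2) w(1)[OF that(1)]] by blast
    then show ?thesis using clin_diff[OF M(1) W that(2) w(1)[OF that(1)]] by simp
  qed
  have Jadd: "f + g \<in> J" "const2 c * f \<in> J" if "f \<in> J" "g \<in> J" for f g c
  proof -
    have fV: "f \<in> V" "g \<in> V" using that JV by auto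
    have "f + g \<in> V" "const2 c * f \<in> V" using fV V by (auto simp: csub_def)
    moreover have "L f k = 0" "L g k = 0" for k using L(2) fV that by blast+
    then have "L (f + g) k = 0" "L (const2 c * f) k = 0" for k
      using clin_add[OF L(1) fV] clin_scale[OF L(1) fV(1)] by auto
    ultimately show "f + g \<in> J" "const2 c * f \<in> J" using L(2) by blast+
  qed
  define N where "N v k = (if k < n then L v k else M (w (r v)) (k - n))" for v k
  have sadd: "s (\<lambda>k. a k + b k) = s a + s b" for a b
    by (simp add: s_def sum.distrib algebra_simps)
  have sscale: "s (\<lambda>k. a * b k) = const2 a * s b" for a b
    by (simp add: s_def sum_distrib_left algebra_simps)
  have "clin V N" unfolding clin_def
  proof (intro conjI ballI allI)
    fix f g i assume fg: "f \<in> V" "g \<in> V"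
    have "L (f + g) = (\<lambda>k. L f k + L g k)" using clin_add[OF L(1) fg] by auto
    then have r: "r (f + g) = r f + r g" by (simp add: r_def sadd)
    have "r f + r g - \<phi> (w (r f) + w (r g)) = (r f - \<phi> (w (r f))) + (r g - \<phi> (w (r g)))"
      using \<phi>(1) w rJ fg by simp
    also have "\<dots> \<in> I" using w(2) rJ fg I unfolding csub_def by blast
    finally have "M (w (r (f + g))) k = M (w (r f) + w (r g)) k" for k
      using w(1) rJ fg W Jadd unfolding r csub_def by (intro Mw) auto
    then show "N (f + g) i = N f i + N g i"
      using clin_add[OF L(1) fg] clin_add[OF M(1) w(1)[OF rJ[OF fg(1)]] w(1)[OF rJ[OF fg(2)]]]
      by (auto simp: N_def)
  next
    fix c f i assume f: "f \<in> V"
    have "L (const2 c * f) = (\<lambda>k. c * L f k)" using clin_scale[OF L(1) f] by auto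
    then have r: "r (const2 c * f) = const2 c * r f" by (simp add: r_def sscale algebra_simps)
    have "const2 c * r f - \<phi> (const2 c * w (r f)) = const2 c * (r f - \<phi> (w (r f)))"
      by (simp add: \<phi>(2)[OF w(1)[OF rJ[OF f]]] right_diff_distrib)
    also have "\<dots> \<in> I" using w(2) rJ f I unfolding csub_def by blast
    finally have "M (w (r (const2 c * f))) k = M (const2 c * w (r f)) k" for k
      using w(1) rJ f W Jadd(2)[OF rJ[OF f] rJ[OF f]] unfolding r csub_def by (intro Mw) auto
    then show "N (const2 c * f) i = c * N f i"
      using clin_scale[OF L(1) f] clin_scale[OF M(1) w(1)[OF rJ[OF f]]] by (auto simp: N_def)
  qed
  moreover have "(\<forall>i. N f i = 0) \<longleftrightarrow> f \<in> I" if f: "f \<in> V" for f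
  proof
    assume N0: "\<forall>i. N f i = 0"
    have L0: "L f k = 0" for k
    proof (cases "k < n")
      case True
      then show ?thesis using N0 by (metis N_def)
    qed (use Ln[OF f] in auto)
    then have "r f = f" by (simp add: r_def s_def)
    have "M (w f) k = 0" for k
      using N0[rule_format, of "k + n"] by (simp add: N_def \<open>r f = f\<close>)
    moreover have fJ: "f \<in> J" using L0 L(2) f by blast
    ultimately have "w f \<in> I'" using M(2) w(1) by blast
    then have "\<phi> (w f) \<in> I" using ker w(1) fJ by blast
    then have "(f - \<phi> (w f)) + \<phi> (w f) \<in> I" using w(2)[OF fJ] I unfolding csub_def by blast
    then show "f \<in> I" by simp
  next
    assume fI: "f \<in> I"
    then have fJ: "f \<in> J" using IJ by auto
    then have L0: "L f k = 0" for k using L(2) f by blast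
    then have "r f = f" by (simp add: r_def s_def)
    have 0: "0 \<in> W" "0 \<in> V" using W V by (auto simp: csub_def)
    have "\<phi> 0 = 0" using \<phi>(2)[OF 0(1), of 0] by simp
    then have "M (w f) k = M 0 k" for k using fI 0 by (intro Mw fJ) auto
    then show "\<forall>i. N f i = 0" using L0 clin_0[OF M(1) 0(1)] by (simp add: N_def \<open>r f = f\<close>)
  qed
  moreover have "N ` V = coords (n + m)"
  proof (intro equalityI subsetI)
    fix c assume "c \<in> N ` V"
    then obtain v where v: "v \<in> V" "c = N v" by auto
    then show "c \<in> coords (n + m)" using Mm[OF w(1)[OF rJ[OF v(1)]]] by (auto simp: coords_def N_def)
  next
    fix c assume c: "c \<in> coords (n + m)"
    then have "(\<lambda>i. c (n + i)) \<in> coords m" by (auto simp: coords_def)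
    then obtain x where x: "x \<in> W" "M x = (\<lambda>i. c (n + i))" using M(3) by (metis imageE)
    define v where "v = \<phi> x + s c"
    have \<phi>xV: "\<phi> x \<in> V" using \<phi>J[OF x(1)] JV by auto
    then have vV: "v \<in> V" using V sV by (auto simp: v_def csub_def)
    have L\<phi>: "L (\<phi> x) k = 0" for k using L(2)[OF \<phi>xV] \<phi>J[OF x(1)] by blast
    have Lv: "L v k = (if k < n then c k else 0)" for k
      unfolding v_def using clin_add[OF L(1) \<phi>xV sV] L\<phi> Ls by simp
    have "s (L v) = s c" unfolding s_def by (intro sum.cong) (auto simp: Lv)
    then have "r v = \<phi> x" by (simp add: r_def v_def)
    moreover have "M (w (\<phi> x)) k = M x k" for k
      using x(1) \<phi>J I by (intro Mw) (auto simp: csub_def)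
    ultimately have "N v = c" by (auto simp: N_def Lv x(2) fun_eq_iff)
    then show "c \<in> N ` V" using vV by auto
  qed
  ultimately show ?thesis unfolding codim_def by blast
qed

text \<open>The functional \<open>L\<close> need not map onto the first \<open>n\<close>
  coordinates. Adding them one at a time, each either leaves the kernel unchanged or cuts it down by
  one dimension.\<close>

lemma codim_of_kernel:
  assumes "clin UNIV L" "\<And>f i. i \<ge> n \<Longrightarrow> L f i = 0"
  shows "\<exists>m. codim UNIV {f. \<forall>i. L f i = 0} m"
  using assms
proof (induction n arbitrary: L)
  case 0
  then have "{f. \<forall>i. L f i = 0} = UNIV" by auto
  then show ?case using codim_refl[of UNIV] by (intro exI[of _ 0]) simp
next
  case (Suc n)
  define L' where "L' f i = (if i < n then L f i else 0)" for f i
  define J where "J = {f. \<forall>i. L' f i = 0}"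
  define I where "I = {f. \<forall>i. L f i = 0}"
  have "clin UNIV L'" using Suc.prems(1) by (auto simp: clin_def L'_def)
  then have "\<exists>m. codim UNIV J m" unfolding J_def by (rule Suc.IH) (simp add: L'_def)
  then obtain m where m: "codim UNIV J m" ..
  have sub: "csub I" "csub J"
    using Suc.prems(1) clin_0[OF Suc.prems(1)] by (auto simp: csub_def I_def J_def L'_def clin_def)
  have J: "f \<in> J \<longleftrightarrow> (\<forall>i<n. L f i = 0)" for f by (auto simp: J_def L'_def)
  have I: "f \<in> I \<longleftrightarrow> f \<in> J \<and> L f n = 0" for f
    using Suc.prems(2)[of _ f] by (auto simp: J I_def not_less_eq_eq[symmetric] less_Suc_eq) (metis linorder_not_less nat_less_le Suc_leI)
  show ?case
  proof (cases "\<exists>j\<in>J. L j n \<noteq> 0")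
    case False
    then have "I = J" using I by auto
    then show ?thesis using m unfolding I_def by auto
  next
    case True
    then obtain j where j: "j \<in> J" "L j n \<noteq> 0" by auto
    have "codim J I 1" unfolding codim_def
    proof (intro exI[of _ "\<lambda>f i. if i = 0 then L f n else 0"] conjI ballI)
      show "clin J (\<lambda>f i. if i = 0 then L f n else 0)" using Suc.prems(1) by (auto simp: clin_def)
      show "(\<forall>i. (if i = 0 then L f n else 0) = 0) \<longleftrightarrow> f \<in> I" if "f \<in> J" for f using that I by auto
      show "(\<lambda>f i. if i = 0 then L f n else 0) ` J = coords 1"
      proof (intro equalityI subsetI)
        fix c :: "nat \<Rightarrow> complex" assume c: "c \<in> coords 1"
        define f where "f = const2 (c 0 / L j n) * j"
        have "f \<in> J" using j sub by (auto simp: f_def csub_def)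
        moreover have "L f n = c 0" using j clin_scale[OF Suc.prems(1)] by (simp add: f_def)
        moreover have "c = (\<lambda>i. if i = 0 then c 0 else 0)" using c by (auto simp: coords_def fun_eq_iff)
        ultimately have "c = (\<lambda>i. if i = 0 then L f n else 0)" by metis
        then show "c \<in> (\<lambda>f i. if i = 0 then L f n else 0) ` J" using \<open>f \<in> J\<close> by blast
      qed (auto simp: coords_def)
    qed
    have "codim UNIV I (m + 1)"
    proof (rule codim_add[OF csub_UNIV sub(2) sub(1) _ _ _ _ _ _ _ m \<open>codim J I 1\<close>, of "\<lambda>f. f"])
      show "\<exists>w\<in>J. f - w \<in> I" if "f \<in> J" for f
        using that sub by (intro bexI[of _ f]) (auto simp: csub_def)
    qed (use I in auto)
    then show ?thesis unfolding I_def by auto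
  qed
qed

section \<open>Ideals with two generators and intersection with a smooth branch\<close>

definition ideal2 :: "fps2 \<Rightarrow> fps2 \<Rightarrow> fps2 set" where
  "ideal2 a b = {a * u + b * v | u v. True}"

lemma ideal2_iff: "f \<in> ideal2 a b \<longleftrightarrow> (\<exists>u v. f = a * u + b * v)"
  by (auto simp: ideal2_def)

lemma ideal2_add: "f \<in> ideal2 a b \<Longrightarrow> g \<in> ideal2 a b \<Longrightarrow> f + g \<in> ideal2 a b"
proof -
  assume "f \<in> ideal2 a b" "g \<in> ideal2 a b"
  then obtain u v u' v' where "f = a * u + b * v" "g = a * u' + b * v'" by (auto simp: ideal2_def)
  then have "f + g = a * (u + u') + b * (v + v')" by (simp add: algebra_simps)
  then show ?thesis by (auto simp: ideal2_def)
qed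

lemma ideal2_mult: "f \<in> ideal2 a b \<Longrightarrow> g * f \<in> ideal2 a b"
proof -
  assume "f \<in> ideal2 a b"
  then obtain u v where "f = a * u + b * v" by (auto simp: ideal2_def)
  then have "g * f = a * (g * u) + b * (g * v)" by (simp add: algebra_simps)
  then show ?thesis by (auto simp: ideal2_def)
qed

lemma ideal2_mult': "f \<in> ideal2 a b \<Longrightarrow> f * g \<in> ideal2 a b"
  using ideal2_mult[of f a b g] by (simp add: mult.commute)

lemma ideal2_gen: "a \<in> ideal2 a b" "b \<in> ideal2 a b" "0 \<in> ideal2 a b"
proof -
  have "a = a * 1 + b * 0" "b = a * 0 + b * 1" "0 = a * 0 + b * 0" by simp_all
  then show "a \<in> ideal2 a b" "b \<in> ideal2 a b" "0 \<in> ideal2 a b" unfolding ideal2_def by blast+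
qed

lemma csub_ideal2 [simp]: "csub (ideal2 a b)"
  by (auto simp: csub_def ideal2_gen ideal2_add ideal2_mult)

lemma ideal2_subset:
  assumes "a \<in> ideal2 c d" "b \<in> ideal2 c d"
  shows "ideal2 a b \<subseteq> ideal2 c d"
  using assms by (auto simp: ideal2_iff[of _ a b] intro!: ideal2_add ideal2_mult')

lemma ideal2_commute: "ideal2 a b = ideal2 b a"
  by (intro equalityI ideal2_subset) (auto simp: ideal2_gen)

text \<open>A smooth branch \<open>p = 0\<close> with its normalization \<open>E\<close>.\<close>

definition smooth_germ :: "fps2 \<Rightarrow> (fps2 \<Rightarrow> complex fps) \<Rightarrow> bool" where
  "smooth_germ p E \<longleftrightarrow> rhom E \<and> (\<forall>c. E (const2 c) = fps_const c) \<and> surj E \<and> (\<forall>f. E f = 0 \<longleftrightarrow> p dvd f)"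

text \<open>\<open>E\<close> identifies the quotient by \<open>p\<close> with power series in one
  variable, so the ideal of \<open>p\<close> and \<open>c\<close> is the preimage of the principal
  ideal of \<open>E c\<close>.\<close>

lemma smooth_germ_ideal:
  assumes "smooth_germ p E"
  shows "f \<in> ideal2 p c \<longleftrightarrow> E c dvd E f"
proof -
  interpret rhom E using assms by (simp add: smooth_germ_def)
  have 0: "E f = 0 \<longleftrightarrow> p dvd f" for f using assms by (simp add: smooth_germ_def)
  show ?thesis
  proof
    assume "f \<in> ideal2 p c"
    then obtain u v where "f = p * u + c * v" by (auto simp: ideal2_def)
    then show "E c dvd E f" using 0[of p] by simp
  next
    assume "E c dvd E f"
    then obtain s where s: "E f = E c * s" by (auto elim: dvdE)
    obtain g where "s = E g" using assms unfolding smooth_germ_def by (metis surjD)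
    then have "E (f - c * g) = 0" using s by simp
    then have "p dvd f - c * g" using 0[of "f - c * g"] by blast
    then obtain u where "f - c * g = p * u" by (auto elim: dvdE)
    then have "f = p * u + c * g" by (simp add: algebra_simps)
    then show "f \<in> ideal2 p c" by (auto simp: ideal2_def)
  qed
qed

text \<open>The coefficients of \<open>E f\<close> below the order of \<open>E c\<close> serve as
  coordinates of \<open>f\<close> modulo the ideal.\<close>

lemma codim_smooth_germ:
  assumes g: "smooth_germ p E" and c: "E c \<noteq> 0"
  shows "codim UNIV (ideal2 p c) (subdegree (E c))"
proof -
  interpret rhom E using g by (simp add: smooth_germ_def)
  define n where "n = subdegree (E c)"
  have const: "E (const2 a) = fps_const a" for a using g by (simp add: smooth_germ_def)
  show ?thesis unfolding n_def[symmetric] codim_def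
  proof (intro exI[of _ "\<lambda>f i. if i < n then fps_nth (E f) i else 0"] conjI ballI)
    show "clin UNIV (\<lambda>f i. if i < n then fps_nth (E f) i else 0)"
      by (auto simp: clin_def const)
    show "(\<forall>i. (if i < n then fps_nth (E f) i else 0) = 0) \<longleftrightarrow> f \<in> ideal2 p c" for f
    proof -
      have "f \<in> ideal2 p c \<longleftrightarrow> E f = 0 \<or> n \<le> subdegree (E f)"
        using smooth_germ_ideal[OF g] fps_dvd_iff[OF c, of "E f"] by (cases "E f = 0") (auto simp: n_def)
      also have "\<dots> \<longleftrightarrow> (\<forall>i<n. fps_nth (E f) i = 0)"
        by (metis fps_zero_nth linorder_not_le nth_less_subdegree_zero nth_subdegree_nonzero order_less_le_trans)
      finally show ?thesis by auto
    qed
    show "(\<lambda>f i. if i < n then fps_nth (E f) i else 0) ` UNIV = coords n"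
    proof (intro equalityI subsetI)
      fix a :: "nat \<Rightarrow> complex" assume a: "a \<in> coords n"
      obtain f where "E f = Abs_fps a" using g unfolding smooth_germ_def by (metis surjD)
      then have "a = (\<lambda>i. if i < n then fps_nth (E f) i else 0)" using a by (auto simp: coords_def fun_eq_iff)
      then show "a \<in> (\<lambda>f i. if i < n then fps_nth (E f) i else 0) ` UNIV" by auto
    qed (auto simp: coords_def)
  qed
qed

text \<open>With \<open>R\<close> the power series ring, multiplication by \<open>p\<close> embeds
  \<open>R/(b, c)\<close> into \<open>R/(p b, c)\<close> with cokernel \<open>R/(p, c)\<close>.
  Injectivity uses that \<open>p\<close> divides \<open>v\<close> whenever it divides
  \<open>c v\<close>, because \<open>E c\<close> is nonzero in a domain.\<close>

lemma codim_mult_smooth_germ: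
  assumes g: "smooth_germ p E" and c: "E c \<noteq> 0" and m: "codim UNIV (ideal2 b c) m" and p: "p \<noteq> 0"
  shows "codim UNIV (ideal2 (p * b) c) (subdegree (E c) + m)"
proof (rule codim_add[where \<phi> = "\<lambda>f. p * f", OF _ _ _ _ _ _ _ _ _ _ codim_smooth_germ[OF g c] m])
  interpret rhom E using g by (simp add: smooth_germ_def)
  have 0: "E f = 0 \<longleftrightarrow> p dvd f" for f using g by (simp add: smooth_germ_def)
  show "ideal2 (p * b) c \<subseteq> ideal2 p c" by (intro ideal2_subset ideal2_mult' ideal2_gen)
  show "p * w \<in> ideal2 p c" for w by (intro ideal2_mult' ideal2_gen)
  show "\<exists>w\<in>UNIV. j - p * w \<in> ideal2 (p * b) c" if j: "j \<in> ideal2 p c" for j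
  proof -
    obtain u v where "j = p * u + c * v" using j by (auto simp: ideal2_def)
    then have "j - p * u = p * b * 0 + c * v" by simp
    then show ?thesis unfolding ideal2_def by blast
  qed
  show "p * w \<in> ideal2 (p * b) c \<longleftrightarrow> w \<in> ideal2 b c" for w
  proof
    assume "p * w \<in> ideal2 (p * b) c"
    then obtain u v where uv: "p * w = p * b * u + c * v" by (auto simp: ideal2_def)
    then have "c * v = p * (w - b * u)" by (simp add: algebra_simps)
    then have "E (c * v) = 0" using 0 by simp
    then have "E v = 0" using c by simp
    then obtain v' where "v = p * v'" using 0 by (auto elim: dvdE)
    then have "p * w = p * (b * u + c * v')" using uv by (simp add: algebra_simps)
    then have "w = b * u + c * v'" using p by (simp only: mult_cancel_left) simp
    then show "w \<in> ideal2 b c" by (auto simp: ideal2_def)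
  next
    assume "w \<in> ideal2 b c"
    then obtain u v where "w = b * u + c * v" by (auto simp: ideal2_def)
    then have "p * w = p * b * u + c * (p * v)" by (simp add: algebra_simps)
    then show "p * w \<in> ideal2 (p * b) c" by (auto simp: ideal2_def)
  qed
qed (auto simp: algebra_simps)

section \<open>Smooth germs \<open>y = \<phi>(x)\<close> and \<open>x = 0\<close>\<close>

text \<open>Substitution of \<open>\<phi>\<close> for \<open>y\<close>. When \<open>\<phi>\<close>
  has zero constant term, its \<open>j\<close>-th power has order at least \<open>j\<close>, so
  \<open>j \<le> n\<close> exhausts the contributions to coefficient \<open>n\<close>.\<close>

definition evs :: "complex fps \<Rightarrow> fps2 \<Rightarrow> complex fps" where
  "evs \<phi> a = Abs_fps (\<lambda>n. \<Sum>j\<le>n. fps_nth (fps_nth a j * \<phi> ^ j) n)"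

lemma fps_nth_mult_power_0:
  fixes \<phi> :: "'a::idom fps"
  assumes "fps_nth \<phi> 0 = 0" "n < j"
  shows "fps_nth (b * \<phi> ^ j) n = 0"
  using startsby_zero_power_prefix[OF assms(1), of j] assms(2) by (auto simp: fps_mult_nth intro!: sum.neutral)

lemma evs_upper:
  assumes "fps_nth \<phi> 0 = 0" "n \<le> N"
  shows "fps_nth (evs \<phi> a) n = (\<Sum>j\<le>N. fps_nth (fps_nth a j * \<phi> ^ j) n)"
  unfolding evs_def fps_nth_Abs_fps
  by (rule sum.mono_neutral_left) (use assms fps_nth_mult_power_0[OF assms(1)] in auto)

lemma mult_evs_nth:
  assumes "fps_nth \<phi> 0 = 0" "n \<le> N"
  shows "fps_nth (c * evs \<phi> a) n = (\<Sum>j\<le>N. fps_nth (c * (fps_nth a j * \<phi> ^ j)) n)"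
proof -
  have "fps_nth (c * evs \<phi> a) n = (\<Sum>i\<le>n. fps_nth c i * (\<Sum>j\<le>N. fps_nth (fps_nth a j * \<phi> ^ j) (n - i)))"
    unfolding fps_mult_nth[of c] atLeast0AtMost
    using assms by (intro sum.cong refl arg_cong2[of _ _ _ _ "(*)"] evs_upper) auto
  also have "\<dots> = (\<Sum>j\<le>N. \<Sum>i\<le>n. fps_nth c i * fps_nth (fps_nth a j * \<phi> ^ j) (n - i))"
    unfolding sum_distrib_left by (rule sum.swap)
  finally show ?thesis by (simp only: fps_mult_nth[of c] atLeast0AtMost)
qed

lemma evs_scale: 
  assumes "fps_nth \<phi> 0 = 0"
  shows "evs \<phi> (fps_const c * a) = c * evs \<phi> a"
  by (rule fps_ext) (simp add: mult_evs_nth[OF assms order_refl] evs_upper[OF assms order_refl] mult.assoc del: sum.atMost_Suc)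

lemma evs_rec:
  assumes "fps_nth \<phi> 0 = 0"
  shows "evs \<phi> a = fps_nth a 0 + \<phi> * evs \<phi> (fps_shift 1 a)"
proof (rule fps_ext)
  fix n
  have "fps_nth (evs \<phi> a) n = (\<Sum>j\<le>Suc n. fps_nth (fps_nth a j * \<phi> ^ j) n)"
    by (rule evs_upper[OF assms]) auto
  also have "\<dots> = fps_nth (fps_nth a 0) n + (\<Sum>j\<le>n. fps_nth (fps_nth a (Suc j) * \<phi> ^ Suc j) n)"
    by (subst sum.atMost_Suc_shift) simp
  also have "(\<Sum>j\<le>n. fps_nth (fps_nth a (Suc j) * \<phi> ^ Suc j) n) = fps_nth (\<phi> * evs \<phi> (fps_shift 1 a)) n"
    unfolding mult_evs_nth[OF assms order_refl] by (intro sum.cong) (simp_all add: mult_ac)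
  finally show "fps_nth (evs \<phi> a) n = fps_nth (fps_nth a 0 + \<phi> * evs \<phi> (fps_shift 1 a)) n" by simp
qed

lemma evs_add: "evs \<phi> (a + b) = evs \<phi> a + evs \<phi> b"
  by (rule fps_ext) (simp add: evs_def algebra_simps sum.distrib)

lemma evs_X_mult:
  assumes "fps_nth \<phi> 0 = 0"
  shows "evs \<phi> (fps_X * a) = \<phi> * evs \<phi> a"
proof -
  have "fps_shift 1 (fps_X * a) = a" by (rule fps_ext) simp
  then show ?thesis using evs_rec[OF assms, of "fps_X * a"] by simp
qed

lemma evs_const:
  assumes "fps_nth \<phi> 0 = 0"
  shows "evs \<phi> (fps_const c) = c"
proof -
  have "fps_shift 1 (fps_const c) = 0" by (rule fps_ext) simp
  moreover have "evs \<phi> 0 = 0" by (rule fps_ext) (simp add: evs_def)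
  ultimately show ?thesis using evs_rec[OF assms, of "fps_const c"] by simp
qed

text \<open>Division with remainder by \<open>y - \<phi>\<close>. Coefficient \<open>j\<close> of
  the quotient is the value at \<open>\<phi>\<close> of the tail of \<open>a\<close> beyond
  \<open>j\<close>; the Horner step \<open>evs_rec\<close> makes the product telescope.\<close>

lemma evs_divide:
  assumes "fps_nth \<phi> 0 = 0"
  shows "\<exists>b. a = (fps_X - fps_const \<phi>) * b + fps_const (evs \<phi> a)"
proof -
  define b where "b = Abs_fps (\<lambda>j. evs \<phi> (fps_shift (Suc j) a))"
  have r: "evs \<phi> (fps_shift j a) = fps_nth a j + \<phi> * evs \<phi> (fps_shift (Suc j) a)" for j
    using evs_rec[OF assms, of "fps_shift j a"] fps_shift_fps_shift[of 1 j a] by simp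
  have "a = (fps_X - fps_const \<phi>) * b + fps_const (evs \<phi> a)"
  proof (rule fps_ext)
    fix j
    show "fps_nth a j = fps_nth ((fps_X - fps_const \<phi>) * b + fps_const (evs \<phi> a)) j"
      using r[of j] by (cases j) (simp_all add: left_diff_distrib b_def)
  qed
  then show ?thesis ..
qed

lemma evs_kernel:
  assumes "fps_nth \<phi> 0 = 0"
  shows "evs \<phi> ((fps_X - fps_const \<phi>) * b) = 0"
proof -
  have "evs \<phi> ((fps_X - fps_const \<phi>) * b + fps_const \<phi> * b) = evs \<phi> (fps_X * b)" by (simp add: left_diff_distrib)
  then show ?thesis by (simp add: evs_add evs_scale[OF assms] evs_X_mult[OF assms])
qed

lemma smooth_germ_graph:
  assumes "fps_nth \<phi> 0 = 0"
  shows "smooth_germ (fps_X - fps_const \<phi>) (evs \<phi>)"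
  unfolding smooth_germ_def
proof (intro conjI allI)
  show "rhom (evs \<phi>)"
  proof unfold_locales
    show "evs \<phi> 1 = 1" using evs_const[OF assms, of 1] by simp
    show "evs \<phi> (a + b) = evs \<phi> a + evs \<phi> b" for a b by (rule evs_add)
    \<comment> \<open>Modulo \<open>y - \<phi>\<close> every series is congruent to its value, so
      multiplicativity follows from division with remainder.\<close>
    show "evs \<phi> (a * b) = evs \<phi> a * evs \<phi> b" for a b
    proof -
      define w where "w = fps_X - fps_const \<phi>"
      obtain u where u: "a = w * u + fps_const (evs \<phi> a)" unfolding w_def using evs_divide[OF assms] by blast
      obtain v where v: "b = w * v + fps_const (evs \<phi> b)" unfolding w_def using evs_divide[OF assms] by blast
      have "a * b = (w * u + fps_const (evs \<phi> a)) * b" using u by simp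
      also have "\<dots> = w * (u * b) + fps_const (evs \<phi> a) * b" by (simp add: algebra_simps)
      also have "fps_const (evs \<phi> a) * b = fps_const (evs \<phi> a) * (w * v + fps_const (evs \<phi> b))" using v by simp
      finally have ab: "a * b = w * (u * b + fps_const (evs \<phi> a) * v) + fps_const (evs \<phi> a * evs \<phi> b)"
        by (simp add: algebra_simps)
      show ?thesis unfolding ab evs_add evs_const[OF assms] by (simp add: w_def evs_kernel[OF assms])
    qed
  qed
  show "evs \<phi> (const2 c) = fps_const c" for c by (simp add: const2_def evs_const[OF assms])
  show "surj (evs \<phi>)" using evs_const[OF assms] by (metis surjI)
  show "evs \<phi> f = 0 \<longleftrightarrow> fps_X - fps_const \<phi> dvd f" for f
  proof
    assume "evs \<phi> f = 0"
    then show "fps_X - fps_const \<phi> dvd f" using evs_divide[OF assms, of f] by auto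
  qed (auto simp: evs_kernel[OF assms] elim!: dvdE)
qed

definition ev_x0 :: "fps2 \<Rightarrow> complex fps" where
  "ev_x0 a = Abs_fps (\<lambda>j. fps_nth (fps_nth a j) 0)"

text \<open>The line \<open>x = 0\<close> is no graph over the \<open>x\<close>-axis, yet it occurs
  as a factor of germs; it is parametrized by \<open>y\<close>.\<close>

lemma smooth_germ_x: "smooth_germ var_x ev_x0"
  unfolding smooth_germ_def
proof (intro conjI allI)
  show "rhom ev_x0"
  proof unfold_locales
    show "ev_x0 (a * b) = ev_x0 a * ev_x0 b" for a b
      by (rule fps_ext) (simp add: ev_x0_def fps_mult_nth fps_sum_nth)
  qed (auto simp: ev_x0_def fps_eq_iff)
  show "ev_x0 (const2 c) = fps_const c" for c by (auto simp: ev_x0_def const2_def fps_eq_iff)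
  show "surj ev_x0"
  proof (rule surjI)
    show "ev_x0 (Abs_fps (\<lambda>j. fps_const (fps_nth s j))) = s" for s
      by (auto simp: ev_x0_def fps_eq_iff)
  qed
  show "ev_x0 f = 0 \<longleftrightarrow> var_x dvd f" for f
  proof
    assume "ev_x0 f = 0"
    then have 0: "fps_nth (fps_nth f j) 0 = 0" for j by (simp add: ev_x0_def fps_eq_iff)
    have "f = var_x * Abs_fps (\<lambda>j. fps_shift 1 (fps_nth f j))"
    proof (intro fps_ext)
      fix j n
      show "fps_nth (fps_nth f j) n = fps_nth (fps_nth (var_x * Abs_fps (\<lambda>j. fps_shift 1 (fps_nth f j))) j) n"
        using 0[of j] by (cases n) (simp_all add: var_x_def)
    qed
    then show "var_x dvd f" by (rule dvdI)
  qed (auto simp: ev_x0_def var_x_def fps_eq_iff elim!: dvdE)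
qed

section \<open>The base change \<open>x = t^k\<close>\<close>

definition expand :: "nat \<Rightarrow> complex fps \<Rightarrow> complex fps" where
  "expand k f = fps_compose f (fps_X ^ k)"

lemma expand_nth:
  assumes "k > 0"
  shows "fps_nth (expand k f) n = (if k dvd n then fps_nth f (n div k) else 0)"
proof -
  have "fps_nth (expand k f) n = (\<Sum>i=0..n. if n = k * i then fps_nth f i else 0)"
    unfolding expand_def fps_compose_nth power_mult[symmetric] fps_X_power_nth by (intro sum.cong) auto
  also have "\<dots> = (\<Sum>i=0..n. if i = n div k \<and> k dvd n then fps_nth f i else 0)"
    using assms by (intro sum.cong refl if_cong) auto
  finally show ?thesis by (auto simp: div_le_dividend)
qed

lemma rhom_expand: "k > 0 \<Longrightarrow> rhom (expand k)"
  by unfold_locales (auto simp: expand_def fps_compose_add_distrib fps_compose_mult_distrib)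

text \<open>The coefficients of \<open>g\<close> in the basis \<open>1, X, ..., X^(k-1)\<close> of
  the power series ring over the subring of series in \<open>X^k\<close>.\<close>

definition part :: "nat \<Rightarrow> nat \<Rightarrow> complex fps \<Rightarrow> complex fps" where
  "part k r g = Abs_fps (\<lambda>n. fps_nth g (k * n + r))"

lemma part_add: "part k r (f + g) = part k r f + part k r g"
  by (simp add: part_def fps_eq_iff)

lemma part_sum: "part k r (sum f A) = (\<Sum>i\<in>A. part k r (f i))"
  by (induction A rule: infinite_finite_induct) (auto simp: part_add, auto simp: part_def fps_eq_iff)

text \<open>Linearity over series in \<open>X^k\<close>: only indices \<open>k * m\<close>
  contribute, and \<open>k * m \<le> k * n + r\<close> with \<open>r < k\<close> means
  \<open>m \<le> n\<close>.\<close>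

lemma part_expand_mult:
  assumes "r < k"
  shows "part k r (expand k a * g) = a * part k r g"
proof (rule fps_ext)
  fix n
  have k: "k > 0" using assms by auto
  have "fps_nth (part k r (expand k a * g)) n
     = (\<Sum>i\<le>k * n + r. fps_nth (expand k a) i * fps_nth g (k * n + r - i))"
    by (simp add: part_def fps_mult_nth atLeast0AtMost)
  also have "\<dots> = (\<Sum>i\<in>(*) k ` {..n}. fps_nth (expand k a) i * fps_nth g (k * n + r - i))"
  proof (rule sum.mono_neutral_right)
    show "(*) k ` {..n} \<subseteq> {..k * n + r}" by (auto intro: trans_le_add1)
    show "\<forall>i\<in>{..k * n + r} - (*) k ` {..n}. fps_nth (expand k a) i * fps_nth g (k * n + r - i) = 0"
    proof
      fix i assume i: "i \<in> {..k * n + r} - (*) k ` {..n}"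
      have "\<not> k dvd i"
      proof
        assume "k dvd i"
        then obtain m where m: "i = k * m" by (auto elim: dvdE)
        then have "k * m < k * (n + 1)" using i assms by (simp add: algebra_simps)
        then have "m \<le> n" using mult_less_cancel1[of k m "n + 1"] by linarith
        then show False using i m by auto
      qed
      then show "fps_nth (expand k a) i * fps_nth g (k * n + r - i) = 0" by (simp add: expand_nth[OF k])
    qed
  qed auto
  also have "\<dots> = (\<Sum>m\<le>n. fps_nth a m * fps_nth g (k * n + r - k * m))"
    using k by (subst sum.reindex) (auto simp: inj_on_def expand_nth)
  also have "\<dots> = (\<Sum>m\<le>n. fps_nth a m * fps_nth g (k * (n - m) + r))"
    by (intro sum.cong refl) (simp add: diff_mult_distrib2)
  finally show "fps_nth (part k r (expand k a * g)) n = fps_nth (a * part k r g) n"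
    by (simp add: part_def fps_mult_nth atLeast0AtMost)
qed

lemma part_decomp:
  assumes "k > 0"
  shows "g = (\<Sum>r<k. fps_X ^ r * expand k (part k r g))"
proof (rule fps_ext)
  fix n
  have "fps_nth (\<Sum>r<k. fps_X ^ r * expand k (part k r g)) n
     = (\<Sum>r<k. if r = n mod k then fps_nth g n else 0)"
    unfolding fps_sum_nth
  proof (intro sum.cong refl)
    fix r assume r: "r \<in> {..<k}"
    show "fps_nth (fps_X ^ r * expand k (part k r g)) n = (if r = n mod k then fps_nth g n else 0)"
    proof (cases "n \<ge> r \<and> k dvd n - r")
      case True
      have n: "k * ((n - r) div k) + r = n" using True by simp
      have "fps_nth (fps_X ^ r * expand k (part k r g)) n = fps_nth (expand k (part k r g)) (n - r)"
        using True by (simp add: fps_X_power_mult_nth)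
      also have "\<dots> = fps_nth g (k * ((n - r) div k) + r)"
        using True by (simp add: expand_nth[OF assms] part_def)
      also have "\<dots> = fps_nth g n" by (simp only: n)
      finally show ?thesis using True r by (metis lessThan_iff mod_eq_dvd_iff_nat mod_less)
    next
      case False
      have "r \<noteq> n mod k"
      proof
        assume "r = n mod k"
        then have "r \<le> n" "k dvd n - r" by (auto simp: mod_less_eq_dividend dvd_minus_mod)
        then show False using False by blast
      qed
      moreover have "fps_nth (fps_X ^ r * expand k (part k r g)) n = 0"
        using False by (auto simp: fps_X_power_mult_nth expand_nth[OF assms])
      ultimately show ?thesis by simp
    qed
  qed
  then show "fps_nth g n = fps_nth (\<Sum>r<k. fps_X ^ r * expand k (part k r g)) n"
    using assms by simp
qed

lemma part_X_expand:
  assumes "r < k" "s < k"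
  shows "part k r (fps_X ^ s * expand k f) = (if r = s then f else 0)"
proof -
  have "part k r (expand k f * fps_X ^ s) = f * part k r (fps_X ^ s)"
    by (rule part_expand_mult[OF assms(1)])
  also have "part k r (fps_X ^ s) = (if r = s then 1 else 0)"
  proof (rule fps_ext)
    fix n
    have "k * n + r = s \<longleftrightarrow> n = 0 \<and> r = s" using assms by (cases n) auto
    then show "fps_nth (part k r (fps_X ^ s)) n = fps_nth (if r = s then 1 else 0) n"
      by (auto simp: part_def fps_X_power_nth)
  qed
  finally show ?thesis by (simp add: mult.commute)
qed

definition expand2 :: "nat \<Rightarrow> fps2 \<Rightarrow> fps2" where
  "expand2 k a = Abs_fps (\<lambda>j. expand k (fps_nth a j))"

definition part2 :: "nat \<Rightarrow> nat \<Rightarrow> fps2 \<Rightarrow> fps2" where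
  "part2 k r a = Abs_fps (\<lambda>j. part k r (fps_nth a j))"

lemma rhom_expand2:
  assumes "k > 0"
  shows "rhom (expand2 k)"
proof -
  interpret rhom "expand k" by (rule rhom_expand[OF assms])
  show ?thesis
    by unfold_locales (auto simp: expand2_def fps_eq_iff fps_mult_nth)
qed

lemma expand2_simps:
  assumes "k > 0"
  shows "expand2 k (const2 c) = const2 c" "expand2 k var_x = var_x ^ k" "expand2 k var_y = var_y"
proof -
  interpret rhom "expand k" by (rule rhom_expand[OF assms])
  have "expand k (fps_const c) = fps_const c" "expand k fps_X = fps_X ^ k"
    using assms by (auto simp: expand_def)
  then show "expand2 k (const2 c) = const2 c" "expand2 k var_x = var_x ^ k" "expand2 k var_y = var_y"
    unfolding expand2_def const2_def var_x_def var_y_def fps_const_power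
    by (auto intro!: fps_ext)
qed

lemma part2_add: "part2 k r (f + g) = part2 k r f + part2 k r g"
  by (simp add: part2_def fps_eq_iff[of "Abs_fps _"] part_add)

lemma part2_sum: "part2 k r (sum f A) = (\<Sum>i\<in>A. part2 k r (f i))"
  by (rule fps_ext) (simp add: part2_def part_sum fps_sum_nth)

lemma part2_expand_mult:
  assumes "r < k"
  shows "part2 k r (expand2 k a * g) = a * part2 k r g"
  by (rule fps_ext) (simp add: part2_def expand2_def fps_mult_nth part_sum part_expand_mult[OF assms])

lemma part2_scale: "r < k \<Longrightarrow> part2 k r (const2 c * g) = const2 c * part2 k r g"
  using part2_expand_mult[of r k "const2 c" g] expand2_simps(1)[of k c] by simp

lemma var_x_power_mult_nth: "fps_nth (var_x ^ r * a) j = fps_X ^ r * fps_nth a j"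
  by (simp add: var_x_def)

lemma part2_decomp:
  assumes "k > 0"
  shows "g = (\<Sum>r<k. var_x ^ r * expand2 k (part2 k r g))"
proof (rule fps_ext)
  fix j
  show "fps_nth g j = fps_nth (\<Sum>r<k. var_x ^ r * expand2 k (part2 k r g)) j"
    using part_decomp[OF assms, of "fps_nth g j"]
    by (simp add: fps_sum_nth var_x_power_mult_nth expand2_def part2_def)
qed

lemma part2_X_expand:
  assumes "r < k" "s < k"
  shows "part2 k r (var_x ^ s * expand2 k f) = (if r = s then f else 0)"
  by (rule fps_ext) (simp add: part2_def var_x_power_mult_nth expand2_def part_X_expand[OF assms])

text \<open>Series in \<open>x\<close> and \<open>y\<close> are free over those in
  \<open>x^k\<close> and \<open>y\<close>, with basis the powers of \<open>x\<close> below
  \<open>k\<close>. Membership in an extended ideal is therefore tested component by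
  component.\<close>

lemma ideal2_expand:
  assumes "k > 0"
  shows "f \<in> ideal2 (expand2 k g) (expand2 k a) \<longleftrightarrow> (\<forall>r<k. part2 k r f \<in> ideal2 g a)"
proof
  assume "f \<in> ideal2 (expand2 k g) (expand2 k a)"
  then obtain u v where "f = expand2 k g * u + expand2 k a * v" by (auto simp: ideal2_def)
  then have "part2 k r f = g * part2 k r u + a * part2 k r v" if "r < k" for r
    using part2_expand_mult[OF that] by (simp add: part2_add)
  then show "\<forall>r<k. part2 k r f \<in> ideal2 g a" by (auto simp: ideal2_def)
next
  interpret rhom "expand2 k" by (rule rhom_expand2[OF assms])
  assume *: "\<forall>r<k. part2 k r f \<in> ideal2 g a"
  have "expand2 k h \<in> ideal2 (expand2 k g) (expand2 k a)" if "h \<in> ideal2 g a" for h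
    using that by (auto simp: ideal2_def) blast
  then have "(\<Sum>r<k. var_x ^ r * expand2 k (part2 k r f)) \<in> ideal2 (expand2 k g) (expand2 k a)"
    using * by (intro csub_sum csub_ideal2 ideal2_mult) auto
  then show "f \<in> ideal2 (expand2 k g) (expand2 k a)" using part2_decomp[OF assms, of f] by simp
qed

lemma codim_expand_mult:
  assumes k: "k > 0" and m: "codim UNIV (ideal2 g a) m"
  shows "codim UNIV (ideal2 (expand2 k g) (expand2 k a)) (k * m)"
proof -
  obtain L where L: "clin UNIV L" "\<And>f. (\<forall>i. L f i = 0) \<longleftrightarrow> f \<in> ideal2 g a" "range L = coords m"
    using m by (auto simp: codim_def)
  have Lm: "L f i = 0" if "i \<ge> m" for f i using L(3) that by (auto simp: coords_def set_eq_iff image_def)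
  \<comment> \<open>Index \<open>i\<close> stands for coordinate \<open>i mod m\<close> of component
    \<open>i div m\<close>.\<close>
  define N where "N f i = (if i < k * m then L (part2 k (i div m) f) (i mod m) else 0)" for f i
  have idx: "i div m < k" "0 < m" if "i < k * m" for i
    using that by (auto simp: less_mult_imp_div_less intro: gr0I)
  show ?thesis unfolding codim_def
  proof (intro exI[of _ N] conjI ballI)
    show "clin UNIV N"
      using clin_add[OF L(1)] clin_scale[OF L(1)] idx
      by (auto simp: clin_def N_def part2_add part2_scale)
    show "(\<forall>i. N f i = 0) \<longleftrightarrow> f \<in> ideal2 (expand2 k g) (expand2 k a)" for f
    proof -
      have "(\<forall>i. N f i = 0) \<longleftrightarrow> (\<forall>r<k. \<forall>i. L (part2 k r f) i = 0)"
      proof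
        assume N0: "\<forall>i. N f i = 0"
        show "\<forall>r<k. \<forall>i. L (part2 k r f) i = 0"
        proof (intro allI impI)
          fix r i assume r: "r < k"
          show "L (part2 k r f) i = 0"
          proof (cases "i < m")
            case True
            have "r * m + i < (r + 1) * m" using True by simp
            also have "\<dots> \<le> k * m" using r by (intro mult_right_mono) auto
            finally show ?thesis using N0[rule_format, of "r * m + i"] True by (simp add: N_def)
          qed (simp add: Lm)
        qed
      qed (auto simp: N_def idx)
      then show ?thesis using L(2) ideal2_expand[OF k] by auto
    qed
    show "range N = coords (k * m)"
    proof (intro equalityI subsetI)
      fix c :: "nat \<Rightarrow> complex" assume c: "c \<in> coords (k * m)"
      have "\<exists>f. L f = (\<lambda>i. if i < m then c (r * m + i) else 0)" for r
      proof -
        have "(\<lambda>i. if i < m then c (r * m + i) else 0) \<in> range L" unfolding L(3) by (auto simp: coords_def)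
        then show ?thesis by (auto simp: image_def eq_commute)
      qed
      then obtain F where F: "\<And>r. L (F r) = (\<lambda>i. if i < m then c (r * m + i) else 0)" by metis
      define f where "f = (\<Sum>s<k. var_x ^ s * expand2 k (F s))"
      have pf: "part2 k r f = F r" if "r < k" for r
        using that by (simp add: f_def part2_sum part2_X_expand)
      have "N f i = c i" for i
      proof (cases "i < k * m")
        case True
        then show ?thesis using idx[OF True] by (simp add: N_def pf F)
      qed (use c in \<open>auto simp: N_def coords_def\<close>)
      then show "c \<in> range N" by (intro image_eqI[of _ _ f]) auto
    qed (auto simp: coords_def N_def)
  qed
qed

text \<open>Finiteness has to descend first: the coordinates of the larger quotient, restricted to
  series in \<open>x^k\<close> and \<open>y\<close>, have kernel \<open>ideal2 g a\<close>. The
  value then comes from \<open>codim_expand_mult\<close> and uniqueness.\<close>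

lemma codim_expand:
  assumes k: "k > 0" and n: "codim UNIV (ideal2 (expand2 k g) (expand2 k a)) n"
  shows "\<exists>m. codim UNIV (ideal2 g a) m \<and> n = k * m"
proof -
  interpret rhom "expand2 k" by (rule rhom_expand2[OF k])
  obtain L where L: "clin UNIV L" "\<And>f. (\<forall>i. L f i = 0) \<longleftrightarrow> f \<in> ideal2 (expand2 k g) (expand2 k a)" "range L = coords n"
    using n by (auto simp: codim_def)
  have "clin UNIV (\<lambda>f. L (expand2 k f))"
    using L(1) expand2_simps(1)[OF k] by (auto simp: clin_def)
  moreover have "L f i = 0" if "i \<ge> n" for f i using L(3) that by (auto simp: coords_def set_eq_iff image_def)
  ultimately obtain m where m: "codim UNIV {f. \<forall>i. L (expand2 k f) i = 0} m"
    using codim_of_kernel[of "\<lambda>f. L (expand2 k f)" n] by auto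
  have "{f. \<forall>i. L (expand2 k f) i = 0} = ideal2 g a"
  proof -
    have "part2 k r (expand2 k f) = (if r = 0 then f else 0)" if "r < k" for r f
      using part2_X_expand[OF that k, of f] by simp
    then show ?thesis using L(2) ideal2_expand[OF k] k by (auto simp: ideal2_gen)
  qed
  then have m': "codim UNIV (ideal2 g a) m" using m by simp
  then show ?thesis using codim_unique[OF csub_UNIV n codim_expand_mult[OF k m']] by blast
qed

section \<open>Hensel's lemma and Puiseux's theorem\<close>

abbreviation pc :: "'a::zero poly \<Rightarrow> nat \<Rightarrow> 'a" where "pc \<equiv> Polynomial.coeff"

text \<open>\<open>P\<close> is a polynomial in \<open>y\<close> over series in \<open>x\<close>.
  Read as a series in \<open>x\<close> instead, it has the slices as coefficients; Hensel lifting
  proceeds along \<open>n\<close>.\<close>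

definition slice :: "nat \<Rightarrow> complex fps poly \<Rightarrow> complex poly" where
  "slice n P = map_poly (\<lambda>c. fps_nth c n) P"

lemma coeff_slice [simp]: "pc (slice n P) j = fps_nth (pc P j) n"
  by (simp add: slice_def coeff_map_poly)

lemma slice_mult: "slice n (P * Q) = (\<Sum>i\<le>n. slice i P * slice (n - i) Q)"
proof (rule poly_eqI)
  fix j
  have "pc (slice n (P * Q)) j = (\<Sum>m\<le>j. \<Sum>i\<le>n. fps_nth (pc P m) i * fps_nth (pc Q (j - m)) (n - i))"
    by (simp add: coeff_mult fps_sum_nth fps_mult_nth atLeast0AtMost)
  also have "\<dots> = (\<Sum>i\<le>n. \<Sum>m\<le>j. fps_nth (pc P m) i * fps_nth (pc Q (j - m)) (n - i))"
    by (rule sum.swap)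
  also have "\<dots> = pc (\<Sum>i\<le>n. slice i P * slice (n - i) Q) j"
    by (simp add: coeff_sum coeff_mult)
  finally show "pc (slice n (P * Q)) j = pc (\<Sum>i\<le>n. slice i P * slice (n - i) Q) j" .
qed

lemma slice_eqI: "(\<And>n. slice n P = slice n Q) \<Longrightarrow> P = Q"
  by (intro poly_eqI fps_ext) (metis coeff_slice)

text \<open>Degree below \<open>d\<close>, phrased so that zero qualifies even for
  \<open>d = 0\<close> and that sums cause no case distinction.\<close>

definition lt :: "nat \<Rightarrow> 'a::zero poly \<Rightarrow> bool" where
  "lt d p \<longleftrightarrow> (\<forall>j\<ge>d. pc p j = 0)"

lemma lt_diff: "lt d p \<Longrightarrow> lt d q \<Longrightarrow> lt d (p - q :: 'a::comm_ring_1 poly)"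
  by (simp add: lt_def)

lemma lt_sum: "(\<And>i. i \<in> A \<Longrightarrow> lt d (f i)) \<Longrightarrow> lt d (sum f A)"
  by (simp add: lt_def coeff_sum)

lemma lt_iff: "lt d p \<longleftrightarrow> p = 0 \<or> degree p < d"
  
proof
  assume "lt d p"
  then have "p = 0" if "d \<le> degree p" using that leading_coeff_0_iff[of p] by (simp add: lt_def)
  then show "p = 0 \<or> degree p < d" by (meson not_le)
qed (auto simp: lt_def coeff_eq_0)

lemma lt_mult_le:
  fixes p q :: "'a::comm_ring_1 poly"
  assumes "degree p \<le> a" "lt b q"
  shows "lt (a + b) (p * q)"
  using assms degree_mult_le[of p q] unfolding lt_iff by (cases "q = 0") auto

text \<open>The degree bound common to all slices is what makes the assembled object a polynomial in
  \<open>y\<close>.\<close>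

lemma slices_realize:
  assumes "\<And>n. lt (Suc d) (s n)"
  shows "\<exists>P. \<forall>n. slice n P = s n"
proof (intro exI allI poly_eqI)
  fix n j
  show "pc (slice n (\<Sum>j\<le>d. Polynomial.monom (Abs_fps (\<lambda>n. pc (s n) j)) j)) j = pc (s n) j"
    using assms[of n] by (auto simp: coeff_sum lt_def)
qed

text \<open>Reducing \<open>v S\<close> modulo \<open>A\<close> bounds \<open>x\<close>; the degree
  of \<open>S\<close> then bounds the cofactor \<open>y\<close>.\<close>

lemma bezout_degree:
  fixes A B S u v :: "complex poly"
  assumes uv: "u * A + v * B = 1" and A: "A \<noteq> 0" and B: "B \<noteq> 0" and S: "lt (degree A + degree B) S"
  shows "\<exists>x y. lt (degree A) x \<and> lt (degree B) y \<and> A * y + B * x = S"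
proof -
  define x where "x = (v * S) mod A"
  have x: "lt (degree A) x" unfolding x_def lt_iff using degree_mod_less[OF A] by auto
  have "S - B * x = S - B * (v * S - A * (v * S div A))"
    by (simp add: x_def minus_mult_div_eq_mod)
  also have "\<dots> = (u * A + v * B) * S - B * (v * S - A * (v * S div A))" by (simp add: uv)
  also have "\<dots> = A * (u * S + B * (v * S div A))" by (simp add: algebra_simps)
  finally obtain y where y: "S - B * x = A * y" by blast
  have "lt (degree A + degree B) (S - B * x)"
    using lt_mult_le[of B "degree B" "degree A" x] x S by (intro lt_diff) (auto simp: add.commute)
  then have "lt (degree B) y" using A unfolding y lt_iff by (cases "y = 0") (auto simp: degree_mult_eq)
  moreover have "A * y + B * x = S" using y by (simp add: algebra_simps)
  ultimately show ?thesis using x by blast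
qed

text \<open>The slices of \<open>A\<close> and \<open>B\<close> are found recursively: slice
  \<open>n\<close> of \<open>R = A B\<close> is a linear equation for the two new slices with
  coefficients \<open>A0\<close> and \<open>B0\<close>, solvable with degree control because these
  are coprime.\<close>

lemma hensel:
  assumes R: "lead_coeff R = 1" and R0: "slice 0 R = A0 * B0"
    and A0: "lead_coeff A0 = 1" and B0: "lead_coeff B0 = 1" and uv: "u * A0 + v * B0 = 1"
  shows "\<exists>A B. R = A * B \<and> lead_coeff A = 1 \<and> lead_coeff B = 1 \<and> degree A = degree A0 \<and> degree B = degree B0"
proof -
  define a b where "a = degree A0" and "b = degree B0"
  have nz: "A0 \<noteq> 0" "B0 \<noteq> 0" using A0 B0 by auto
  have dR: "degree R = a + b"
  proof -
    have "degree (slice 0 R) = a + b" using nz by (simp add: R0 degree_mult_eq a_def b_def)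
    moreover have "degree (slice 0 R) = degree R"
    proof (rule antisym)
      show "degree (slice 0 R) \<le> degree R" by (intro degree_le) (simp add: coeff_eq_0)
      show "degree R \<le> degree (slice 0 R)" by (rule le_degree) (simp add: R)
    qed
    ultimately show ?thesis by simp
  qed
  have Rlt: "lt (a + b) (slice n R)" if "n > 0" for n
    unfolding lt_def
  proof (intro allI impI)
    fix j assume "a + b \<le> j"
    then show "pc (slice n R) j = 0"
      using R dR that coeff_eq_0[of R j] by (cases "j = a + b") auto
  qed
  \<comment> \<open>What the products of earlier slices leave of slice \<open>n\<close>; the range
    \<open>{1..<n}\<close> omits the two products involving slice 0, which contain the
    unknowns.\<close>
  define rest where "rest f n = slice n R - (\<Sum>i\<in>{1..<n}. fst (f i) * snd (f (n - i)))"
    for f :: "nat \<Rightarrow> complex poly \<times> complex poly" and n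
  \<comment> \<open>The degree bounds belong to the recursion, since the bound on
    \<open>rest\<close> and hence solvability depends on those of the earlier slices.\<close>
  define step where "step f n r \<longleftrightarrow> (if n = 0 then r = (A0, B0) else lt a (fst r) \<and> lt b (snd r) \<and>
      A0 * snd r + B0 * fst r = rest f n)" for f n and r :: "complex poly \<times> complex poly"
  have "\<exists>f. \<forall>n. step f n (f n)"
  proof (rule dependent_wellorder_choice)
    fix r and f g :: "nat \<Rightarrow> complex poly \<times> complex poly" and n :: nat assume fg: "\<And>m. m < n \<Longrightarrow> f m = g m"
    have "rest f n = rest g n" unfolding rest_def by (intro arg_cong2[of _ _ _ _ "(-)"] sum.cong refl) (auto simp: fg)
    then show "step f n r = step g n r" by (simp add: step_def)
  next
    fix n :: nat and f :: "nat \<Rightarrow> complex poly \<times> complex poly" assume *: "\<And>m. m < n \<Longrightarrow> step f m (f m)"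
    show "\<exists>r. step f n r"
    proof (cases "n = 0")
      case False
      have "lt (a + b) (fst (f i) * snd (f (n - i)))" if "i \<in> {1..<n}" for i
      proof (rule lt_mult_le)
        show "degree (fst (f i)) \<le> a" "lt b (snd (f (n - i)))"
          using *[of i] *[of "n - i"] that by (auto simp: step_def lt_iff)
      qed
      then have "lt (a + b) (rest f n)" unfolding rest_def using Rlt False by (intro lt_diff lt_sum) auto
      then obtain x y where "lt a x" "lt b y" "A0 * y + B0 * x = rest f n"
        using bezout_degree[OF uv nz] unfolding a_def b_def by blast
      then show ?thesis using False by (intro exI[of _ "(x, y)"]) (simp add: step_def)
    qed (simp add: step_def)
  qed
  then obtain f where f: "\<And>n. step f n (f n)" by blast
  have f0: "f 0 = (A0, B0)" using f[of 0] by (simp add: step_def)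
  have fn: "lt a (fst (f n))" "lt b (snd (f n))" "A0 * snd (f n) + B0 * fst (f n) = rest f n" if "n > 0" for n
    using f[of n] that by (simp_all add: step_def)
  have ltf: "lt (Suc a) (fst (f n))" "lt (Suc b) (snd (f n))" for n
    using fn[of n] f0 by (cases "n = 0"; force simp: lt_iff a_def b_def)+
  obtain A where A: "\<And>n. slice n A = fst (f n)" using slices_realize[of a "\<lambda>n. fst (f n)"] ltf by blast
  obtain B where B: "\<And>n. slice n B = snd (f n)" using slices_realize[of b "\<lambda>n. snd (f n)"] ltf by blast
  have "R = A * B"
  proof (rule slice_eqI)
    fix n
    show "slice n R = slice n (A * B)"
    proof (cases "n = 0")
      case True
      then show ?thesis by (simp add: slice_mult A B f0 R0)
    next
      case False
      have "slice n (A * B) = (\<Sum>i\<le>n. fst (f i) * snd (f (n - i)))" by (simp add: slice_mult A B)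
      also have "{..n} = insert 0 (insert n {1..<n})" using False by auto
      also have "(\<Sum>i\<in>insert 0 (insert n {1..<n}). fst (f i) * snd (f (n - i)))
        = A0 * snd (f n) + (fst (f n) * B0 + (\<Sum>i\<in>{1..<n}. fst (f i) * snd (f (n - i))))"
        using False by (simp add: f0)
      also have "\<dots> = slice n R" using fn(3)[of n] False by (simp add: rest_def algebra_simps)
      finally show ?thesis by simp
    qed
  qed
  \<comment> \<open>Positive slices stay below degree \<open>d\<close>, so the coefficient of
    \<open>y^d\<close> comes from slice 0 alone.\<close>
  moreover have monic: "lead_coeff Q = 1 \<and> degree Q = d" if "\<And>n. slice n Q = g n" "\<And>n. n > 0 \<Longrightarrow> lt d (g n)"
    "lead_coeff (g 0) = 1" "degree (g 0) = d" for Q d g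
  proof -
    have c: "fps_nth (pc Q j) n = pc (g n) j" for j n using that(1)[of n] by (metis coeff_slice)
    have "pc Q j = 0" if "j > d" for j
    proof (rule fps_ext)
      fix n
      show "fps_nth (pc Q j) n = fps_nth 0 n"
        using \<open>\<And>n. n > 0 \<Longrightarrow> lt d (g n)\<close>[of n] \<open>degree (g 0) = d\<close> that
        by (cases "n = 0") (auto simp: c lt_def coeff_eq_0)
    qed
    then have "degree Q \<le> d" by (intro degree_le) auto
    moreover have "pc Q d = 1"
    proof (rule fps_ext)
      fix n
      show "fps_nth (pc Q d) n = fps_nth 1 n"
        using that(2)[of n] that(3,4) by (cases "n = 0") (auto simp: c lt_def)
    qed
    moreover from this have "d \<le> degree Q" by (intro le_degree) auto
    ultimately show ?thesis by auto
  qed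
  have "lead_coeff A = 1 \<and> degree A = a" 
    by (rule monic[of A "\<lambda>n. fst (f n)"]) (auto simp: A f0 A0 a_def intro: fn(1)[unfolded a_def])
  moreover have "lead_coeff B = 1 \<and> degree B = b"
    by (rule monic[of B "\<lambda>n. snd (f n)"]) (auto simp: B f0 B0 b_def intro: fn(2)[unfolded b_def])
  ultimately show ?thesis unfolding a_def b_def by blast
qed

text \<open>Split off the full power of one root. The rest is constant only if \<open>R\<close> is a
  power of one linear factor; the vanishing coefficient \<open>n\<close> then makes the root zero,
  which is excluded.\<close>

lemma coprime_factorization:
  fixes R :: "complex poly"
  assumes R: "lead_coeff R = 1" and N: "degree R = Suc n" and c: "pc R n = 0" and ne: "R \<noteq> Polynomial.monom 1 (Suc n)"
  shows "\<exists>A B u v. R = A * B \<and> lead_coeff A = 1 \<and> lead_coeff B = 1 \<and> u * A + v * B = 1 \<and> degree A > 0 \<and> degree B > 0"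
proof -
  have R0: "R \<noteq> 0" using R by auto
  have "\<not> constant (poly R)" using N by (simp add: constant_degree)
  then obtain r where r: "poly R r = 0" using fundamental_theorem_of_algebra by blast
  define m where "m = Polynomial.order r R"
  obtain B where B: "R = [:- r, 1:] ^ m * B" "\<not> [:- r, 1:] dvd B"
    using order_decomp[OF R0, of r] by (auto simp: m_def)
  define A where "A = [:- r, 1:] ^ m"
  have m: "m > 0" using r R0 by (auto simp: m_def order_root)
  have lA: "lead_coeff A = 1" by (simp add: A_def lead_coeff_power)
  have dA: "degree A = m" by (simp add: A_def degree_linear_power)
  have lB: "lead_coeff B = 1" using R lA by (simp add: B(1) A_def[symmetric] lead_coeff_mult)
  have "degree B > 0"
  proof (rule ccontr)
    assume "\<not> degree B > 0"
    then have "B = 1" using lB by (metis degree_eq_zeroE gr0I lead_coeff_pCons(2) one_pCons)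
    then have R': "R = [:- r, 1:] ^ Suc n" using dA N B(1) by (simp add: A_def)
    \<comment> \<open>For \<open>R = (y - r)^(n+1)\<close> this coefficient is
      \<open>-(n+1) r\<close>.\<close>
    have "pc R n = of_nat (Suc n choose n) * (- r)"
      unfolding R' by (subst coeff_linear_poly_power) auto
    then have "r = 0" using c by (simp add: binomial_Suc_n del: of_nat_Suc)
    then show False using ne R' by (simp add: monom_altdef)
  qed
  moreover have "coprime A B"
  proof -
    have "prime_elem [:- r, 1:]" by (rule prime_elem_linear_field_poly) simp
    then show ?thesis unfolding A_def using B(2) by (intro coprime_power_left_iff[THEN iffD2] disjI1 prime_elem_imp_coprime)
  qed
  then have "fst (bezout_coefficients A B) * A + snd (bezout_coefficients A B) * B = 1"
    by (simp add: bezout_coefficients_fst_snd)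
  ultimately show ?thesis using lA lB dA m B(1) unfolding A_def[symmetric] by metis
qed

section \<open>Substitutions in polynomials and products of linear factors\<close>

lemma rhom_map_poly:
  assumes "rhom h"
  shows "rhom (map_poly h)"
proof -
  interpret rhom h by fact
  have sm: "map_poly h (Polynomial.smult c q) = Polynomial.smult (h c) (map_poly h q)" for c q
    by (rule poly_eqI) (simp add: coeff_map_poly)
  have a: "map_poly h (p + q) = map_poly h p + map_poly h q" for p q
    by (rule poly_eqI) (simp add: coeff_map_poly)
  show ?thesis
  proof unfold_locales
    show "map_poly h (p * q) = map_poly h p * map_poly h q" for p q
      by (induction p) (auto simp: map_poly_pCons a sm)
  qed (auto simp: a)
qed

lemma rhom_pcompose: "rhom (\<lambda>p. pcompose p q)"
  by unfold_locales (auto simp: pcompose_1 pcompose_add pcompose_mult)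

lemma map_poly_pcompose:
  assumes "rhom h"
  shows "map_poly h (pcompose p q) = pcompose (map_poly h p) (map_poly h q)"
proof -
  interpret rhom h by fact
  interpret m: rhom "map_poly h" by (rule rhom_map_poly) fact
  show ?thesis by (induction p) (auto simp: pcompose_pCons map_poly_pCons)
qed

lemma coeff_pcompose_scale: "pc (pcompose p [:0, c:]) i = c ^ i * pc p i" for c :: "'a::comm_ring_1"
proof (induction p arbitrary: i)
  case (pCons a p)
  then show ?case by (cases i) (auto simp: pcompose_pCons coeff_pCons mult_ac)
qed auto

definition linprod :: "'a::comm_ring_1 list \<Rightarrow> 'a poly" where
  "linprod \<phi>s = prod_list (map (\<lambda>\<phi>. [:- \<phi>, 1:]) \<phi>s)"

lemma linprod_append: "linprod (xs @ ys) = linprod xs * linprod ys"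
  by (simp add: linprod_def)

lemma map_poly_linprod:
  assumes "rhom h"
  shows "map_poly h (linprod xs) = linprod (map h xs)"
proof -
  interpret rhom h by fact
  interpret m: rhom "map_poly h" by (rule rhom_map_poly) fact
  show ?thesis by (simp add: linprod_def o_def map_poly_pCons)
qed

lemma linprod_shift: "pcompose (linprod xs) [:- s, 1:] = linprod (map (\<lambda>x. x + s) xs)"
proof -
  interpret rhom "\<lambda>p. pcompose p [:- s, 1:]" by (rule rhom_pcompose)
  show ?thesis by (simp add: linprod_def o_def pcompose_pCons)
qed

lemma linprod_Cons: "linprod (x # xs) = [:- x, 1:] * linprod xs"
  by (simp add: linprod_def del: mult_pCons_left)

lemma linprod_scale: "pcompose (linprod (map ((*) c) xs)) [:0, c:] = Polynomial.smult (c ^ length xs) (linprod xs)"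
proof (induction xs)
  case (Cons x xs)
  have "pcompose [:- (c * x), 1:] [:0, c:] = Polynomial.smult c [:- x, 1:]"
    by (simp add: pcompose_pCons)
  then show ?case using Cons
    by (simp only: linprod_Cons pcompose_mult list.map list.size mult_smult_left mult_smult_right
        Polynomial.smult_smult power_Suc One_nat_def add_Suc_right add_0_right mult.commute)
qed (simp add: linprod_def pcompose_1)

lemma degree_linprod: "linprod (xs :: 'a::idom list) \<noteq> 0 \<and> degree (linprod xs) = length xs"
proof (induction xs)
  case (Cons x xs)
  then show ?case using degree_mult_eq[of "[:- x, 1:]" "linprod xs"]
    by (simp add: linprod_Cons del: mult_pCons_left)
qed (simp add: linprod_def)

lemma expand_expand: "k > 0 \<Longrightarrow> l > 0 \<Longrightarrow> expand l (expand k f) = expand (k * l) f"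
proof (rule fps_ext)
  fix n assume kl: "k > 0" "l > 0"
  have "k * l dvd n \<longleftrightarrow> l dvd n \<and> k dvd n div l"
    using kl by (metis dvd_div_iff_mult dvd_mult_right mult.commute not_gr0)
  moreover have "n div (k * l) = n div l div k" by (metis div_mult2_eq mult.commute)
  ultimately show "fps_nth (expand l (expand k f)) n = fps_nth (expand (k * l) f) n"
    using kl by (auto simp: expand_nth)
qed

lemma map_poly_expand_expand:
  "k > 0 \<Longrightarrow> l > 0 \<Longrightarrow> map_poly (expand l) (map_poly (expand k) P) = map_poly (expand (k * l)) P"
  using rhom.zero[OF rhom_expand] by (intro poly_eqI) (simp add: coeff_map_poly expand_expand)

text \<open>Translating the variable makes the sum of the roots zero, as
  \<open>coprime_factorization\<close> requires.\<close>

lemma tschirnhaus: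
  fixes P :: "complex fps poly"
  assumes P: "lead_coeff P = 1" and N: "degree P = Suc n"
  shows "\<exists>s. lead_coeff (pcompose P [:s, 1:]) = 1 \<and> degree (pcompose P [:s, 1:]) = Suc n \<and> pc (pcompose P [:s, 1:]) n = 0"
proof -
  \<comment> \<open>The expansion of \<open>(y + s)^(n+1)\<close> contributes \<open>(n+1) s\<close>
    to the coefficient of \<open>y^n\<close>; \<open>s\<close> makes it cancel
    \<open>pc P n\<close>.\<close>
  define s where "s = fps_const (- 1 / of_nat (Suc n)) * pc P n"
  define Q where "Q = P - Polynomial.monom 1 (Suc n) - Polynomial.monom (pc P n) n"
  have Q: "lt n Q" unfolding lt_def
  proof (intro allI impI)
    fix j assume "n \<le> j"
    then consider "j = n" | "j = Suc n" | "j > Suc n" by linarith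
    then show "pc Q j = 0" using P N by cases (auto simp: Q_def coeff_eq_0)
  qed
  have Qs: "lt n (pcompose Q [:s, 1:])"
    using Q degree_pcompose_le[of Q "[:s, 1:]"] unfolding lt_iff by (cases "Q = 0") auto
  have "P = Polynomial.monom 1 (Suc n) + Polynomial.monom (pc P n) n + Q" by (simp add: Q_def)
  then have "pcompose P [:s, 1:] = pcompose (Polynomial.monom 1 (Suc n)) [:s, 1:]
      + pcompose (Polynomial.monom (pc P n) n) [:s, 1:] + pcompose Q [:s, 1:]"
    by (metis pcompose_add)
  moreover have "pcompose ([:0, 1:] ^ m) [:s, 1:] = [:s, 1:] ^ m" for m
  proof -
    have "pcompose [:0, 1:] [:s, 1:] = [:s, 1:]" by (simp add: pcompose_pCons)
    then show ?thesis using rhom.power[OF rhom_pcompose[of "[:s, 1:]"], of "[:0, 1:]" m] by simp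
  qed
  ultimately have "pcompose P [:s, 1:] = [:s, 1:] ^ Suc n + Polynomial.smult (pc P n) ([:s, 1:] ^ n) + pcompose Q [:s, 1:]"
    by (simp only: monom_altdef pcompose_smult smult_1_left)
  note eq = this
  have "pc (pcompose P [:s, 1:]) n = of_nat (Suc n) * s + pc P n"
    using Qs unfolding eq by (simp add: coeff_linear_poly_power lt_def binomial_Suc_n del: power_Suc of_nat_Suc)
  also have "of_nat (Suc n) * s = - pc P n"
  proof -
    have "of_nat (Suc n) * s = fps_const (of_nat (Suc n) * (- 1 / of_nat (Suc n))) * pc P n"
      unfolding s_def fps_of_nat[symmetric] by (simp only: fps_const_mult mult.assoc[symmetric])
    also have "of_nat (Suc n) * (- 1 / of_nat (Suc n)) = (- 1 :: complex)" by (simp del: of_nat_Suc)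
    finally show ?thesis by (simp add: fps_const_neg[symmetric] del: fps_const_neg)
  qed
  finally have "pc (pcompose P [:s, 1:]) n = 0" by simp
  moreover have top: "pc (pcompose P [:s, 1:]) j = (if j = Suc n then 1 else 0)" if "j \<ge> Suc n" for j
  proof -
    have "degree ([:s, 1:] ^ m) = m" for m by (rule degree_linear_power)
    then have "pc ([:s, 1:] ^ n) j = 0" "j > Suc n \<Longrightarrow> pc ([:s, 1:] ^ Suc n) j = 0"
      using that by (simp_all add: coeff_eq_0 del: power_Suc)
    then show ?thesis using Qs that unfolding eq
      by (auto simp: coeff_linear_poly_power lt_def simp del: power_Suc)
  qed
  moreover from top have "degree (pcompose P [:s, 1:]) = Suc n"
    by (intro antisym degree_le le_degree) auto
  ultimately show ?thesis using top[of "Suc n"] by (intro exI[of _ s]) simp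
qed

text \<open>Newton's polygon. After the translation, rescale the roots by the least slope so that
  the reduction at \<open>x = 0\<close> keeps a lower coefficient. That reduction splits into
  coprime factors, Hensel's lemma lifts the splitting, and both factors have smaller degree.\<close>

theorem puiseux:
  fixes P :: "complex fps poly"
  assumes "lead_coeff P = 1"
  shows "\<exists>k \<phi>s. k > 0 \<and> map_poly (expand k) P = linprod \<phi>s"
  using assms
proof (induction "degree P" arbitrary: P rule: less_induct)
  case less
  have expand1: "expand 1 f = f" for f by (simp add: expand_def)
  show ?case
  proof (cases "degree P")
    case 0
    then have "P = 1" using less.prems by (metis degree_eq_zeroE lead_coeff_pCons(2) one_pCons)
    then show ?thesis by (intro exI[of _ 1] exI[of _ "[]"]) (simp add: linprod_def expand_def)
  next
    case (Suc n)
    obtain s where s: "lead_coeff (pcompose P [:s, 1:]) = 1" "degree (pcompose P [:s, 1:]) = Suc n"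
       "pc (pcompose P [:s, 1:]) n = 0" using tschirnhaus[OF less.prems Suc] by blast
    define Q where "Q = pcompose P [:s, 1:]"
    have "\<exists>k \<phi>s. k > 0 \<and> map_poly (expand k) Q = linprod \<phi>s"
    proof (cases "\<forall>j\<le>n. pc Q j = 0")
      case True
      have "Q = Polynomial.monom 1 (Suc n)"
      proof (rule poly_eqI)
        fix j
        consider "j \<le> n" | "j = Suc n" | "j > Suc n" by linarith
        then show "pc Q j = pc (Polynomial.monom 1 (Suc n)) j"
          using True s(1,2) by cases (auto simp: Q_def[symmetric] coeff_eq_0)
      qed
      also have "\<dots> = linprod (replicate (Suc n) 0)" by (simp add: linprod_def monom_altdef prod_list_replicate del: replicate_Suc)
      finally have "map_poly (expand 1) Q = linprod (replicate (Suc n) 0)"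
        using expand1 by (metis poly_eqI coeff_map_poly)
      then show ?thesis by (intro exI[of _ 1] exI[of _ "replicate (Suc n) 0"]) simp
    next
      case False
      \<comment> \<open>In a monic polynomial the coefficient of \<open>y^(n+1-i)\<close> is
        homogeneous of degree \<open>i\<close> in the roots, so \<open>o' i / i\<close> is the slope
        to be minimized.\<close>
      define o' where "o' i = subdegree (pc Q (Suc n - i))" for i
      define I where "I = {i \<in> {1..Suc n}. pc Q (Suc n - i) \<noteq> 0}"
      obtain j where "j \<le> n" "pc Q j \<noteq> 0" using False by auto
      then have "Suc n - j \<in> I" by (simp add: I_def)
      then have "I \<noteq> {}" by blast
      have "finite I" by (simp add: I_def)
      with \<open>I \<noteq> {}\<close> obtain i0 where i0: "i0 \<in> I" "\<And>i. i \<in> I \<Longrightarrow> real (o' i0) / real i0 \<le> real (o' i) / real i"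
        using ex_min_if_finite[of "(\<lambda>i. real (o' i) / real i) ` I"] by (auto simp: not_less)
      \<comment> \<open>The least slope is \<open>a / i0\<close>; the base change by
        \<open>i0\<close> makes it the integer \<open>a\<close>.\<close>
      define a where "a = o' i0"
      have i0': "0 < i0" "i0 \<le> Suc n" "pc Q (Suc n - i0) \<noteq> 0" using i0(1) by (auto simp: I_def)
      have slope: "a * i \<le> i0 * o' i" if "i \<in> I" for i
      proof -
        have "real a * real i \<le> real i0 * real (o' i)"
          using i0(2)[OF that] that i0' by (auto simp: field_simps a_def I_def)
        then show ?thesis by (simp only: of_nat_mult[symmetric] of_nat_le_iff)
      qed
      interpret e: rhom "expand i0" by (rule rhom_expand[OF i0'(1)])
      define P1 where "P1 = map_poly (expand i0) Q"
      have P1: "pc P1 j = expand i0 (pc Q j)" for j by (simp add: P1_def coeff_map_poly)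
      \<comment> \<open>With \<open>P1\<close> the polynomial after base change,
        \<open>P1(x^a y) = x^(a(n+1)) R(y)\<close>. Minimality of the slope ensures that no
        coefficient is lost in the shifts.\<close>
      define R where "R = (\<Sum>j\<le>Suc n. Polynomial.monom (fps_shift (a * (Suc n - j)) (pc P1 j)) j)"
      have R: "pc R j = (if j \<le> Suc n then fps_shift (a * (Suc n - j)) (pc P1 j) else 0)" for j
        by (auto simp: R_def coeff_sum)
      have P1R: "pc P1 j = (fps_X ^ a) ^ (Suc n - j) * pc R j" if "j \<le> Suc n" for j
      proof -
        have "fps_nth (pc P1 j) m = 0" if m: "m < a * (Suc n - j)" for m
        proof (cases "j = Suc n \<or> pc Q j = 0")
          case False
          then have jI: "Suc n - j \<in> I" using \<open>j \<le> Suc n\<close> by (auto simp: I_def)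
          have "fps_nth (pc Q j) (m div i0) = 0" if "i0 dvd m"
          proof (rule nth_less_subdegree_zero)
            have "i0 * (m div i0) < i0 * o' (Suc n - j)" using slope[OF jI] m that by simp
            then show "m div i0 < subdegree (pc Q j)" using \<open>j \<le> Suc n\<close> by (simp add: o'_def)
          qed
          then show ?thesis by (simp add: P1 expand_nth[OF i0'(1)])
        qed (use m in \<open>auto simp: P1\<close>)
        then show ?thesis using that
          by (intro fps_ext) (simp add: R power_mult[symmetric] fps_X_power_mult_nth)
      qed
      have lR: "pc R (Suc n) = 1" using s(1,2) by (simp add: R P1 Q_def[symmetric])
      have dR: "degree R = Suc n"
      proof (rule antisym)
        show "degree R \<le> Suc n" by (rule degree_le) (simp add: R)
        show "Suc n \<le> degree R" by (rule le_degree) (simp add: lR)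
      qed
      have R0: "pc (slice 0 R) j = (if j = Suc n then 1 else 0)" if "j \<ge> Suc n" for j
        using that lR R[of j] by auto
      have dR0: "degree (slice 0 R) = Suc n"
        by (intro antisym degree_le le_degree) (use R0 in auto)
      have "lead_coeff (slice 0 R) = 1" unfolding dR0 using R0[of "Suc n"] by simp
      moreover have "pc (slice 0 R) n = 0" using s(3) by (simp add: R P1 Q_def[symmetric])
      \<comment> \<open>At \<open>i0\<close> the slope is attained, so this coefficient of
        \<open>R\<close> has a nonzero constant term: the leading coefficient of
        \<open>pc Q (Suc n - i0)\<close>.\<close>
      moreover have "slice 0 R \<noteq> Polynomial.monom 1 (Suc n)"
      proof
        assume "slice 0 R = Polynomial.monom 1 (Suc n)"
        then have "pc (slice 0 R) (Suc n - i0) = 0" using i0' by simp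
        moreover have "pc (slice 0 R) (Suc n - i0) = fps_nth (pc Q (Suc n - i0)) a"
          using i0' by (simp add: R P1 expand_nth)
        ultimately show False using i0'(3) unfolding a_def o'_def by (simp add: nth_subdegree_nonzero)
      qed
      ultimately obtain A0 B0 u v where AB0: "slice 0 R = A0 * B0" "lead_coeff A0 = 1" "lead_coeff B0 = 1"
         "u * A0 + v * B0 = 1" "degree A0 > 0" "degree B0 > 0"
        using coprime_factorization[OF _ dR0] by metis
      have "lead_coeff R = 1" using lR dR by simp
      from hensel[OF this AB0(1-4)] obtain A B where AB: "R = A * B" "lead_coeff A = 1" "lead_coeff B = 1"
        "degree A = degree A0" "degree B = degree B0" by blast
      have "A \<noteq> 0" "B \<noteq> 0" using AB by auto
      then have "degree A + degree B = Suc n" using dR AB(1) by (simp add: degree_mult_eq)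
      then have small: "degree A < degree P" "degree B < degree P" using AB0(5,6) AB(4,5) Suc by linarith+
      obtain k1 xs where k1: "k1 > 0" "map_poly (expand k1) A = linprod xs" using less.hyps[OF small(1) AB(2)] by blast
      obtain k2 ys where k2: "k2 > 0" "map_poly (expand k2) B = linprod ys" using less.hyps[OF small(2) AB(3)] by blast
      \<comment> \<open>A base change over which both factors split.\<close>
      define k where "k = k1 * k2"
      have k: "k > 0" using k1 k2 by (simp add: k_def)
      interpret ek: rhom "expand k" by (rule rhom_expand[OF k])
      interpret mk: rhom "map_poly (expand k)" by (intro rhom_map_poly rhom_expand k)
      have "map_poly (expand k) A = linprod (map (expand k2) xs)"
        unfolding k_def map_poly_expand_expand[OF k1(1) k2(1), symmetric] k1(2)
        by (rule map_poly_linprod[OF rhom_expand[OF k2(1)]])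
      moreover have "map_poly (expand k) B = linprod (map (expand k1) ys)"
        unfolding k_def mult.commute[of k1] map_poly_expand_expand[OF k2(1) k1(1), symmetric] k2(2)
        by (rule map_poly_linprod[OF rhom_expand[OF k1(1)]])
      ultimately obtain zs where zs: "map_poly (expand k) R = linprod zs"
        unfolding AB(1) using linprod_append by (metis mk.mult)
      have len: "length zs = Suc n"
      proof -
        have c: "pc (map_poly (expand k) R) j = expand k (pc R j)" for j by (simp add: coeff_map_poly)
        have "degree (map_poly (expand k) R) = Suc n"
        proof (rule antisym)
          show "degree (map_poly (expand k) R) \<le> Suc n" by (rule degree_le) (simp add: c R)
          show "Suc n \<le> degree (map_poly (expand k) R)" by (rule le_degree) (simp add: c lR)
        qed
        then show ?thesis by (simp add: zs degree_linprod)
      qed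
      \<comment> \<open>Undoing the rescaling multiplies the roots by the image of
        \<open>x^a\<close>.\<close>
      define T where "T = expand k (fps_X ^ a)"
      have T: "T = fps_X ^ (k * a)"
        by (simp add: T_def expand_def fps_X_power_compose k power_mult)
      have "pcompose (map_poly (expand k) P1) [:0, T:] = Polynomial.smult (T ^ Suc n) (map_poly (expand k) R)"
      proof (rule poly_eqI)
        fix j
        show "pc (pcompose (map_poly (expand k) P1) [:0, T:]) j = pc (Polynomial.smult (T ^ Suc n) (map_poly (expand k) R)) j"
        proof (cases "j \<le> Suc n")
          case True
          have "pc (pcompose (map_poly (expand k) P1) [:0, T:]) j = T ^ j * (T ^ (Suc n - j) * expand k (pc R j))"
            by (simp add: coeff_pcompose_scale coeff_map_poly P1R[OF True] T_def del: power_Suc)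
          also have "\<dots> = T ^ (j + (Suc n - j)) * expand k (pc R j)" by (simp only: power_add mult.assoc)
          finally show ?thesis using True by (simp add: coeff_map_poly)
        next
          case False
          then have "pc P1 j = 0" using s(2) by (simp add: P1 Q_def[symmetric] coeff_eq_0)
          then show ?thesis using False by (simp add: coeff_pcompose_scale coeff_map_poly R)
        qed
      qed
      also have "\<dots> = pcompose (linprod (map ((*) T) zs)) [:0, T:]"
        by (simp only: linprod_scale zs len)
      finally have "T ^ j * pc (map_poly (expand k) P1) j = T ^ j * pc (linprod (map ((*) T) zs)) j" for j
        by (metis coeff_pcompose_scale)
      then have "map_poly (expand k) P1 = linprod (map ((*) T) zs)"
        by (intro poly_eqI) (simp add: T)
      then show ?thesis using k i0'(1) unfolding P1_def map_poly_expand_expand[OF i0'(1) k]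
        by (intro exI[of _ "i0 * k"]) auto
    qed
    then obtain k \<phi>s where k: "k > 0" "map_poly (expand k) Q = linprod \<phi>s" by blast
    interpret ek: rhom "expand k" by (rule rhom_expand[OF k(1)])
    have "P = pcompose Q [:- s, 1:]"
      unfolding Q_def pcompose_assoc[symmetric] by (simp add: pcompose_pCons)
    then have "map_poly (expand k) P = pcompose (linprod \<phi>s) [:- expand k s, 1:]"
      using k by (simp add: map_poly_pcompose[OF rhom_expand] map_poly_pCons)
    then show ?thesis using k(1) by (auto simp: linprod_shift)
  qed
qed

section \<open>Branches of a plane curve germ\<close>

text \<open>A nonconstant formal arc through the origin, given by the pullback of functions to its
  parameter.\<close>

definition branch :: "(fps2 \<Rightarrow> complex fps) \<Rightarrow> bool" where
  "branch E \<longleftrightarrow> rhom E \<and> (\<forall>c. E (const2 c) = fps_const c) \<and> fps_nth (E var_x) 0 = 0 \<and> fps_nth (E var_y) 0 = 0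
     \<and> (E var_x \<noteq> 0 \<or> E var_y \<noteq> 0)"

lemma fps2_unit:
  assumes "fps_nth (fps_nth a 0) 0 \<noteq> 0"
  shows "(a :: fps2) dvd 1"
proof -
  have "fps_nth a 0 * inverse (fps_nth a 0) = 1"
    using assms by (simp add: inverse_mult_eq_1')
  then have "a * fps_right_inverse a (inverse (fps_nth a 0)) = 1" by (rule fps_right_inverse)
  then show ?thesis by (metis dvd_triv_left)
qed

text \<open>The smooth factors are split off one by one; the remaining unit generates the whole ring
  and contributes zero.\<close>

lemma codim_germ_product:
  assumes U: "U dvd 1" and "\<And>p E. (p, E) \<in> set ps \<Longrightarrow> smooth_germ p E \<and> p \<noteq> 0 \<and> E a \<noteq> 0"
  shows "codim UNIV (ideal2 (U * prod_list (map fst ps)) a) (\<Sum>(p, E)\<leftarrow>ps. subdegree (E a))"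
  using assms(2)
proof (induction ps)
  case Nil
  obtain V where V: "U * V = 1" using U by (metis dvdE)
  have "f \<in> ideal2 U a" for f
  proof -
    have "f = U * (V * f) + a * 0" using V by (simp add: mult.assoc[symmetric])
    then show ?thesis unfolding ideal2_iff by (intro exI)
  qed
  then have "ideal2 U a = UNIV" by auto
  then show ?case using codim_refl[of UNIV] by simp
next
  case (Cons pE ps)
  obtain p E where pE: "pE = (p, E)" by fastforce
  have "codim UNIV (ideal2 (p * (U * prod_list (map fst ps))) a) (subdegree (E a) + (\<Sum>(p, E)\<leftarrow>ps. subdegree (E a)))"
    using Cons pE by (intro codim_mult_smooth_germ) auto
  then show ?case by (simp add: pE mult_ac)
qed

text \<open>All factors other than the unit are smooth germs through the origin, so that
  \<open>codim_germ_product\<close> applies.\<close>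

definition good :: "fps2 \<Rightarrow> bool" where
  "good h \<longleftrightarrow> (\<exists>e U \<phi>s. h = var_x ^ e * U * prod_list (map (\<lambda>\<phi>. fps_X - fps_const \<phi>) \<phi>s) \<and> U dvd 1
     \<and> (\<forall>\<phi>\<in>set \<phi>s. fps_nth \<phi> 0 = 0))"

lemma good_mult:
  assumes "good g" "good h"
  shows "good (g * h)"
proof -
  obtain e U \<phi>s where 1: "g = var_x ^ e * U * prod_list (map (\<lambda>\<phi>. fps_X - fps_const \<phi>) \<phi>s)" "U dvd 1" "\<forall>\<phi>\<in>set \<phi>s. fps_nth \<phi> 0 = 0"
    using assms(1) by (auto simp: good_def)
  obtain e' U' \<phi>s' where 2: "h = var_x ^ e' * U' * prod_list (map (\<lambda>\<phi>. fps_X - fps_const \<phi>) \<phi>s')" "U' dvd 1" "\<forall>\<phi>\<in>set \<phi>s'. fps_nth \<phi> 0 = 0"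
    using assms(2) by (auto simp: good_def)
  have "g * h = var_x ^ (e + e') * (U * U') * prod_list (map (\<lambda>\<phi>. fps_X - fps_const \<phi>) (\<phi>s @ \<phi>s'))"
    by (simp add: 1(1) 2(1) power_add mult_ac)
  moreover have "U * U' dvd 1" using mult_dvd_mono[OF 1(2) 2(2)] by simp
  ultimately show ?thesis using 1(3) 2(3) unfolding good_def
    by (intro exI[of _ "e + e'"] exI[of _ "U * U'"] exI[of _ "\<phi>s @ \<phi>s'"]) auto
qed

lemma good_unit: "U dvd 1 \<Longrightarrow> good U"
  unfolding good_def by (rule exI[of _ 0], rule exI[of _ U], rule exI[of _ "[]"]) simp

lemma good_x_power: "good (var_x ^ e)"
  unfolding good_def by (rule exI[of _ e], rule exI[of _ 1], rule exI[of _ "[]"]) simp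

lemma fps_const_var_x: "fps_const (fps_X ^ e * c) = var_x ^ e * fps_const c"
  by (simp add: var_x_def fps_const_mult[symmetric] fps_const_power del: fps_const_mult)

lemma const_decomp:
  assumes "c \<noteq> 0"
  shows "\<exists>e U. fps_const c = var_x ^ e * U \<and> U dvd 1"
proof -
  have c: "c = fps_X ^ subdegree c * unit_factor c" using subdegree_decompose[of c] by (simp add: mult.commute fps_unit_factor_def)
  then have "fps_const c = var_x ^ subdegree c * fps_const (unit_factor c)"
    using fps_const_var_x[of "subdegree c" "unit_factor c"] by (simp only: c[symmetric])
  moreover have "fps_const (unit_factor c) dvd 1"
    using assms by (intro fps2_unit) (simp add: fps_unit_factor_def)
  ultimately show ?thesis by blast
qed

text \<open>Divide by the common power of \<open>x\<close>. If the remaining \<open>\<psi>'\<close>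
  has a nonzero constant term, the factor misses the origin and is a unit; otherwise
  \<open>c'\<close> is a unit and the factor is a graph up to it.\<close>

lemma good_linear:
  assumes c: "c \<noteq> 0"
  shows "good (fps_const c * fps_X - fps_const \<psi>)"
proof -
  define e where "e = (if \<psi> = 0 then subdegree c else min (subdegree c) (subdegree \<psi>))"
  define c' \<psi>' where "c' = fps_shift e c" and "\<psi>' = fps_shift e \<psi>"
  have sh: "f = fps_X ^ e * fps_shift e f" if "f = 0 \<or> e \<le> subdegree f" for f :: "complex fps"
    using that fps_shift_times_fps_X_power[of e f] by (auto simp: mult.commute)
  have "c = fps_X ^ e * c'" unfolding c'_def by (rule sh) (simp add: e_def)
  moreover have "\<psi> = fps_X ^ e * \<psi>'" unfolding \<psi>'_def by (rule sh) (simp add: e_def)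
  ultimately have eq: "fps_const c * fps_X - fps_const \<psi> = var_x ^ e * (fps_const c' * fps_X - fps_const \<psi>')"
    using fps_const_var_x[of e c'] fps_const_var_x[of e \<psi>'] by (simp add: algebra_simps)
  have "good (fps_const c' * fps_X - fps_const \<psi>')"
  proof (cases "fps_nth \<psi>' 0 = 0")
    case False
    then show ?thesis by (intro good_unit fps2_unit) simp
  next
    case True
    have c'0: "fps_nth c' 0 \<noteq> 0"
    proof (cases "e = subdegree c")
      case True
      then show ?thesis using c by (simp add: c'_def)
    next
      case False
      then have "\<psi> \<noteq> 0" "e = subdegree \<psi>" by (auto simp: e_def min_def split: if_splits)
      then have "fps_nth \<psi>' 0 \<noteq> 0" by (simp add: \<psi>'_def)
      then show ?thesis using True by simp
    qed
    have eq2: "fps_const c' * fps_X - fps_const \<psi>' = fps_const c' * (fps_X - fps_const (\<psi>' * inverse c'))"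
      using c'0 by (simp add: right_diff_distrib mult.left_commute[of c'] inverse_mult_eq_1' inverse_mult_eq_1)
    have "good (fps_const c')" using c'0 by (intro good_unit fps2_unit) simp
    moreover have "good (fps_X - fps_const (\<psi>' * inverse c'))"
      unfolding good_def
      by (rule exI[of _ 0], rule exI[of _ 1], rule exI[of _ "[\<psi>' * inverse c']"]) (simp add: True)
    ultimately show ?thesis unfolding eq2 by (intro good_mult)
  qed
  then show ?thesis unfolding eq by (intro good_mult good_x_power)
qed

text \<open>Restriction to \<open>x = 0\<close> kills \<open>x\<close> but neither the unit nor a
  graph, so the exponent \<open>e\<close> of the factorization is at least \<open>a\<close>.\<close>

lemma good_cancel_x:
  assumes "good h" "h = var_x ^ a * g"
  shows "good g"
proof -
  interpret rhom ev_x0 using smooth_germ_x by (simp add: smooth_germ_def)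
  obtain e U \<phi>s where h: "h = var_x ^ e * U * prod_list (map (\<lambda>\<phi>. fps_X - fps_const \<phi>) \<phi>s)" "U dvd 1" "\<forall>\<phi>\<in>set \<phi>s. fps_nth \<phi> 0 = 0"
    using assms(1) by (auto simp: good_def)
  define w where "w = U * prod_list (map (\<lambda>\<phi>. fps_X - fps_const \<phi>) \<phi>s)"
  have ev: "ev_x0 var_x = 0" "var_x \<noteq> 0" by (auto simp: ev_x0_def var_x_def fps_eq_iff)
  have lin: "ev_x0 (fps_X - fps_const \<phi>) = fps_X" if "fps_nth \<phi> 0 = 0" for \<phi>
    using that by (auto simp: ev_x0_def fps_eq_iff)
  have "ev_x0 (prod_list (map (\<lambda>\<phi>. fps_X - fps_const \<phi>) \<phi>s)) \<noteq> 0"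
    using h(3) by (induction \<phi>s) (auto simp: lin simp del: diff)
  moreover have "ev_x0 U \<noteq> 0" using dvd[OF h(2)] by auto
  ultimately have w: "ev_x0 w \<noteq> 0" by (simp add: w_def)
  have eq: "var_x ^ a * g = var_x ^ e * w" using h(1) assms(2) by (simp add: w_def mult.assoc)
  have "a \<le> e"
  proof (rule ccontr)
    assume "\<not> a \<le> e"
    then have "var_x ^ a = var_x ^ e * var_x ^ (a - e)" by (simp flip: power_add)
    then have "var_x ^ e * (var_x ^ (a - e) * g) = var_x ^ e * w" using eq by (simp add: mult.assoc)
    then have "var_x ^ (a - e) * g = w" using ev(2) by simp
    then have "ev_x0 w = ev_x0 (var_x ^ (a - e) * g)" by simp
    also have "\<dots> = ev_x0 var_x ^ (a - e) * ev_x0 g" by (simp only: mult power)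
    also have "\<dots> = 0" using \<open>\<not> a \<le> e\<close> by (simp add: ev(1))
    finally have "ev_x0 w = 0" .
    then show False using w by simp
  qed
  then have "var_x ^ e = var_x ^ a * var_x ^ (e - a)" by (simp flip: power_add)
  then have "var_x ^ a * g = var_x ^ a * (var_x ^ (e - a) * w)" using eq by (simp add: mult.assoc)
  then have "g = var_x ^ (e - a) * w" using ev(2) by simp
  then show ?thesis using h(2,3) unfolding good_def w_def mult.assoc[symmetric] by blast
qed

lemma expand2_fps_of_poly: "k > 0 \<Longrightarrow> expand2 k (fps_of_poly p) = fps_of_poly (map_poly (expand k) p)"
  using rhom.zero[OF rhom_expand] by (intro fps_ext[of "expand2 k _"]) (simp add: expand2_def coeff_map_poly)

text \<open>A polynomial that is not monic is first made monic by scaling its roots with the leading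
  coefficient. After Puiseux the scaling is undone, which leaves linear factors
  \<open>d y - \<psi>\<close> and constants to cancel.\<close>

lemma good_expand:
  fixes p :: "complex fps poly"
  assumes "p \<noteq> 0"
  shows "\<exists>k>0. good (expand2 k (fps_of_poly p))"
proof -
  define n c where "n = degree p" and "c = lead_coeff p"
  have c: "c \<noteq> 0" using assms by (simp add: c_def)
  \<comment> \<open>The monic polynomial whose roots are those of \<open>p\<close> multiplied by
    \<open>c\<close>.\<close>
  define P where "P = (\<Sum>j\<le>n. Polynomial.monom (if j = n then 1 else c ^ (n - 1 - j) * pc p j) j)"
  have P: "pc P j = (if j < n then c ^ (n - 1 - j) * pc p j else if j = n then 1 else 0)" for j
    by (auto simp: P_def coeff_sum)
  have "degree P = n"
  proof (rule antisym)
    show "degree P \<le> n" by (rule degree_le) (simp add: P)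
    show "n \<le> degree P" by (rule le_degree) (simp add: P)
  qed
  then have "lead_coeff P = 1" by (simp add: P)
  then obtain k \<psi>s where k: "k > 0" "map_poly (expand k) P = linprod \<psi>s" using puiseux by blast
  interpret e: rhom "expand k" by (rule rhom_expand[OF k(1)])
  interpret m: rhom "map_poly (expand k)" by (intro rhom_map_poly rhom_expand k)
  define d where "d = expand k c"
  have d: "d \<noteq> 0"
  proof
    assume "d = 0"
    then have "fps_nth d (k * subdegree c) = 0" by simp
    then show False using c k(1) by (simp add: d_def expand_nth)
  qed
  \<comment> \<open>The extra factor \<open>c\<close> on both sides avoids the exponent
    \<open>n - 1\<close>, which would be wrong for \<open>n = 0\<close>.\<close>
  have "Polynomial.smult (c ^ n) p = Polynomial.smult c (pcompose P [:0, c:])"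
  proof (rule poly_eqI)
    fix j
    consider "j < n" | "j = n" | "j > n" by linarith
    then show "pc (Polynomial.smult (c ^ n) p) j = pc (Polynomial.smult c (pcompose P [:0, c:])) j"
    proof cases
      case 1
      have "n = 1 + j + (n - 1 - j)" using 1 by simp
      then have "c ^ n = c * c ^ j * c ^ (n - 1 - j)" by (metis power_add power_one_right)
      then show ?thesis using 1 by (simp add: coeff_pcompose_scale P mult_ac)
    next
      case 2
      then show ?thesis by (simp add: coeff_pcompose_scale P c_def n_def)
    next
      case 3
      then show ?thesis by (simp add: coeff_pcompose_scale P coeff_eq_0 n_def)
    qed
  qed
  then have "[:c ^ n:] * p = [:c:] * pcompose P [:0, c:]" by simp
  then have "map_poly (expand k) ([:c ^ n:] * p) = map_poly (expand k) ([:c:] * pcompose P [:0, c:])" by simp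
  then have "[:d ^ n:] * map_poly (expand k) p = [:d:] * pcompose (linprod \<psi>s) [:0, d:]"
    unfolding m.mult map_poly_pcompose[OF rhom_expand[OF k(1)]] k(2) by (simp add: map_poly_pCons d_def)
  then have "fps_of_poly [:d ^ n:] * fps_of_poly (map_poly (expand k) p)
      = fps_of_poly [:d:] * fps_of_poly (pcompose (linprod \<psi>s) [:0, d:])"
    by (simp only: fps_of_poly_mult[symmetric])
  then have eq: "fps_const (d ^ n) * expand2 k (fps_of_poly p) = fps_const d * fps_of_poly (pcompose (linprod \<psi>s) [:0, d:])"
    by (simp only: fps_of_poly_const expand2_fps_of_poly[OF k(1)])
  have "good (fps_of_poly (pcompose (linprod \<psi>s) [:0, d:]))"
  proof (induction \<psi>s)
    case Nil
    then show ?case by (simp add: linprod_def pcompose_1 good_unit)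
  next
    case (Cons \<psi> \<psi>s)
    have e: "pcompose [:- \<psi>, 1:] [:0, d:] = [:- \<psi>, d:]" by (simp add: pcompose_pCons)
    have f: "fps_of_poly [:- \<psi>, d:] = fps_const d * fps_X - fps_const \<psi>"
      by (simp add: fps_of_poly_pCons mult.commute)
    show ?case unfolding linprod_Cons pcompose_mult fps_of_poly_mult e f
      by (intro good_mult good_linear d Cons)
  qed
  moreover have "good (fps_const d)"
  proof -
    obtain a U where "fps_const d = var_x ^ a * U" "U dvd 1" using const_decomp[OF d] by blast
    then show ?thesis by (simp add: good_mult good_x_power good_unit)
  qed
  ultimately have gd: "good (fps_const (d ^ n) * expand2 k (fps_of_poly p))"
    unfolding eq by (intro good_mult)
  obtain a U where U: "fps_const (d ^ n) = var_x ^ a * U" "U dvd 1" using const_decomp[of "d ^ n"] d by auto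
  obtain V where V: "U * V = 1" using U(2) by (metis dvdE)
  have "V dvd 1" using V by (metis dvd_triv_right)
  have "good (V * (fps_const (d ^ n) * expand2 k (fps_of_poly p)))"
    by (rule good_mult[OF good_unit[OF \<open>V dvd 1\<close>] gd])
  moreover have "V * (fps_const (d ^ n) * expand2 k (fps_of_poly p)) = var_x ^ a * expand2 k (fps_of_poly p)"
  proof -
    have "V * (fps_const (d ^ n) * expand2 k (fps_of_poly p)) = var_x ^ a * (U * V) * expand2 k (fps_of_poly p)"
      unfolding U(1) by (simp add: mult_ac)
    then show ?thesis by (simp add: V)
  qed
  ultimately have "good (expand2 k (fps_of_poly p))" using good_cancel_x by blast
  then show ?thesis using k(1) by blast
qed

text \<open>Intersection numbers as sums of orders. Branches are listed with multiplicity, one for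
  each smooth factor after the base change, and the factor \<open>k\<close> on the left accounts for
  the base change itself.\<close>

lemma branches:
  fixes p :: "complex fps poly"
  assumes "p \<noteq> 0"
  defines "g \<equiv> fps_of_poly p"
  shows "\<exists>k Es. k > 0 \<and> (\<forall>E\<in>set Es. branch E \<and> E g = 0) \<and>
    (\<forall>a. (\<forall>E\<in>set Es. E a \<noteq> 0) \<longrightarrow> (\<exists>n. codim UNIV (ideal2 g a) n \<and> k * n = (\<Sum>E\<leftarrow>Es. subdegree (E a))))"
proof -
  obtain k where k: "k > 0" and gd: "good (expand2 k g)" using good_expand[OF assms(1)] unfolding g_def by blast
  obtain e U \<phi>s where h: "expand2 k g = var_x ^ e * U * prod_list (map (\<lambda>\<phi>. fps_X - fps_const \<phi>) \<phi>s)" "U dvd 1"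
    "\<And>\<phi>. \<phi> \<in> set \<phi>s \<Longrightarrow> fps_nth \<phi> 0 = 0"
    using gd by (auto simp: good_def)
  define ps where "ps = replicate e (var_x, ev_x0) @ map (\<lambda>\<phi>. (fps_X - fps_const \<phi>, evs \<phi>)) \<phi>s"
  have g: "expand2 k g = U * prod_list (map fst ps)"
    by (simp add: h(1) ps_def prod_list_replicate o_def mult_ac)
  have ps: "smooth_germ p E \<and> p \<noteq> 0 \<and> fps_nth (E (var_x ^ k)) 0 = 0 \<and> fps_nth (E var_y) 0 = 0 \<and> (E (var_x ^ k) \<noteq> 0 \<or> E var_y \<noteq> 0)"
    if "(p, E) \<in> set ps" for p E
  proof -
    consider "p = var_x" "E = ev_x0" | \<phi> where "\<phi> \<in> set \<phi>s" "p = fps_X - fps_const \<phi>" "E = evs \<phi>"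
      using \<open>(p, E) \<in> set ps\<close> by (auto simp: ps_def)
    then show ?thesis
    proof cases
      case 1
      interpret rhom ev_x0 using smooth_germ_x by (simp add: smooth_germ_def)
      have "ev_x0 var_x = 0" "ev_x0 var_y = fps_X" "var_x \<noteq> 0"
        by (auto simp: ev_x0_def var_x_def var_y_def fps_eq_iff)
      then show ?thesis using k smooth_germ_x unfolding 1 by simp
    next
      case 2
      have \<phi>: "fps_nth \<phi> 0 = 0" using h(3) 2 by blast
      interpret rhom "evs \<phi>" using smooth_germ_graph[OF \<phi>] by (simp add: smooth_germ_def)
      have "evs \<phi> var_x = fps_X" using evs_const[OF \<phi>] by (simp add: var_x_def)
      moreover have "evs \<phi> var_y = \<phi>" using evs_X_mult[OF \<phi>, of 1] by (simp add: var_y_def)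
      moreover have "fps_X - fps_const \<phi> \<noteq> 0"
      proof
        assume "fps_X - fps_const \<phi> = 0"
        then have "fps_nth (fps_X - fps_const \<phi>) 1 = 0" by simp
        then show False by simp
      qed
      ultimately show ?thesis using k smooth_germ_graph[OF \<phi>] \<phi> unfolding 2 by simp
    qed
  qed
  \<comment> \<open>Composition with the base change turns the parametrization of a factor of
    \<open>expand2 k g\<close> into a branch of \<open>g\<close>.\<close>
  define Es where "Es = map (\<lambda>(p, E) a. E (expand2 k a)) ps"
  interpret e2: rhom "expand2 k" by (rule rhom_expand2[OF k])
  show ?thesis
  proof (rule exI[of _ k], rule exI[of _ Es], intro conjI k ballI allI impI)
    fix E assume "E \<in> set Es"
    then obtain p E' where pE: "(p, E') \<in> set ps" "E = (\<lambda>a. E' (expand2 k a))" by (auto simp: Es_def)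
    have "rhom E'" "\<forall>c. E' (const2 c) = fps_const c" using ps[OF pE(1)] by (auto simp: smooth_germ_def)
    moreover have "rhom E" unfolding pE(2) by (rule rhom_comp[OF calculation(1) rhom_expand2[OF k]])
    ultimately show "branch E" using ps[OF pE(1)] unfolding branch_def
      by (simp add: pE(2) expand2_simps[OF k])
    have "p \<in> set (map fst ps)" using pE(1) by force
    moreover have "x dvd prod_list xs" if "x \<in> set xs" for x and xs :: "fps2 list"
      using that
    proof (induction xs)
      case (Cons b xs)
      then show ?case by (cases "x = b") (simp_all add: dvd_mult)
    qed simp
    ultimately have "p dvd prod_list (map fst ps)" by blast
    then have "p dvd expand2 k g" unfolding g by (rule dvd_mult)
    then show "E g = 0" using ps[OF pE(1)] by (simp add: pE(2) smooth_germ_def)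
  next
    fix a assume a: "\<forall>E\<in>set Es. E a \<noteq> 0"
    have "codim UNIV (ideal2 (expand2 k g) (expand2 k a)) (\<Sum>(p, E)\<leftarrow>ps. subdegree (E (expand2 k a)))"
      unfolding g
    proof (intro codim_germ_product h(2))
      fix p E assume pE: "(p, E) \<in> set ps"
      then have "(\<lambda>a. E (expand2 k a)) \<in> set Es"
        unfolding Es_def set_map by (rule rev_image_eqI) simp
      from bspec[OF a this] have "E (expand2 k a) \<noteq> 0" .
      then show "smooth_germ p E \<and> p \<noteq> 0 \<and> E (expand2 k a) \<noteq> 0" using ps[OF pE] by blast
    qed
    then obtain n where "codim UNIV (ideal2 g a) n" "(\<Sum>(p, E)\<leftarrow>ps. subdegree (E (expand2 k a))) = k * n"
      using codim_expand[OF k] by blast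
    then show "\<exists>n. codim UNIV (ideal2 g a) n \<and> k * n = (\<Sum>E\<leftarrow>Es. subdegree (E a))"
      by (intro exI[of _ n]) (simp add: Es_def o_def case_prod_unfold)
  qed
qed

section \<open>Polynomial germs and their derivatives\<close>

text \<open>A branch is a purely algebraic homomorphism, with no continuity in its definition. On
  polynomial germs its constant terms and derivatives are computed by induction, and these germs are
  also convergent.\<close>

inductive_set Pol :: "fps2 set" where
  const: "const2 c \<in> Pol"
| x: "var_x \<in> Pol"
| y: "var_y \<in> Pol"
| add: "f \<in> Pol \<Longrightarrow> g \<in> Pol \<Longrightarrow> f + g \<in> Pol"
| mult: "f \<in> Pol \<Longrightarrow> g \<in> Pol \<Longrightarrow> f * g \<in> Pol"

lemma Pol_diff: "f \<in> Pol \<Longrightarrow> g \<in> Pol \<Longrightarrow> f - g \<in> Pol"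
  using Pol.add[OF _ Pol.mult[OF Pol.const[of "-1"]], of f g] by simp

lemma Pol_0_1: "0 \<in> Pol" "1 \<in> Pol"
  using Pol.const[of 0] Pol.const[of 1] by simp_all

lemma hderiv_deriv: "hderiv id deriv_x" "hderiv id deriv_y"
proof -
  show "hderiv id deriv_x" unfolding hderiv_def
  proof (intro conjI allI)
    show "deriv_x (a + b) = deriv_x a + deriv_x b" for a b by (simp add: deriv_x_def fps_eq_iff)
    show "deriv_x (a * b) = id a * deriv_x b + id b * deriv_x a" for a b
    proof (rule fps_ext)
      fix j
      have "fps_nth (deriv_x (a * b)) j = (\<Sum>i=0..j. fps_nth a i * fps_deriv (fps_nth b (j - i)))
          + (\<Sum>i=0..j. fps_deriv (fps_nth a i) * fps_nth b (j - i))"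
        by (simp add: deriv_x_def fps_mult_nth fps_deriv_sum sum.distrib)
      also have "\<dots> = fps_nth (a * deriv_x b + deriv_x a * b) j"
        by (simp add: deriv_x_def fps_mult_nth)
      finally show "fps_nth (deriv_x (a * b)) j = fps_nth (id a * deriv_x b + id b * deriv_x a) j"
        by (simp add: mult.commute)
    qed
  qed
  show "hderiv id deriv_y" by (simp add: hderiv_def deriv_y_def mult.commute)
qed

lemma deriv_add: "deriv_x (a + b) = deriv_x a + deriv_x b" "deriv_y (a + b) = deriv_y a + deriv_y b"
  and deriv_mult: "deriv_x (a * b) = a * deriv_x b + b * deriv_x a" "deriv_y (a * b) = a * deriv_y b + b * deriv_y a"
  using hderiv_deriv by (auto simp: hderiv_def)

lemma deriv_simps:
  "deriv_x (const2 c) = 0" "deriv_x var_x = 1" "deriv_x var_y = 0"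
  "deriv_y (const2 c) = 0" "deriv_y var_x = 0" "deriv_y var_y = 1"
  by (auto simp: deriv_x_def deriv_y_def const2_def var_x_def var_y_def fps_eq_iff fps_X_def)

lemma Pol_deriv: "f \<in> Pol \<Longrightarrow> deriv_x f \<in> Pol" "f \<in> Pol \<Longrightarrow> deriv_y f \<in> Pol"
  by (induction rule: Pol.induct) (auto simp: deriv_simps deriv_add deriv_mult Pol_0_1 intro: Pol.intros)

lemma Pol_fps_of_poly: "f \<in> Pol \<Longrightarrow> \<exists>p. f = fps_of_poly p"
proof (induction rule: Pol.induct)
  case (const c)
  show ?case by (rule exI[of _ "[:fps_const c:]"]) (simp add: const2_def fps_of_poly_const)
next
  case x
  show ?case by (rule exI[of _ "[:fps_X:]"]) (simp add: var_x_def fps_of_poly_const)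
next
  case y
  show ?case by (rule exI[of _ "[:0, 1:]"]) (simp add: var_y_def)
next
  case (add f g)
  then show ?case by (metis fps_of_poly_add)
next
  case (mult f g)
  then show ?case by (metis fps_of_poly_mult)
qed

lemma ev_in_Pol:
  assumes "rhom h" "\<And>c. h c \<in> Pol" "z \<in> Pol"
  shows "ev h z p \<in> Pol"
proof -
  interpret rhom h by fact
  show ?thesis by (induction p) (auto intro: Pol.intros assms Pol_0_1)
qed

lemma eval3_Pol:
  assumes "\<And>i. vec_nth L i \<in> Pol"
  shows "eval3 const2 F L \<in> Pol"
  unfolding eval3_ev by (intro ev_in_Pol rhom_evI rhom_const2 assms Pol.const)

definition cst :: "fps2 \<Rightarrow> complex" where
  "cst a = fps_nth (fps_nth a 0) 0"

lemma cst_simps [simp]: "cst (a + b) = cst a + cst b" "cst (a * b) = cst a * cst b" "cst (a - b) = cst a - cst b"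
   "cst 0 = 0" "cst 1 = 1" "cst (const2 c) = c" "cst var_x = 0" "cst var_y = 0"
  by (simp_all add: cst_def const2_def var_x_def var_y_def)

lemma cst_unit: "cst a \<noteq> 0 \<Longrightarrow> \<exists>b. a * b = 1"
  using fps2_unit[of a] unfolding cst_def by (metis dvdE)

lemma branch_cst:
  assumes "branch E" "a \<in> Pol"
  shows "fps_nth (E a) 0 = cst a"
proof -
  interpret rhom E using assms by (simp add: branch_def)
  show ?thesis using assms(2) by (induction rule: Pol.induct) (use assms(1) in \<open>auto simp: branch_def\<close>)
qed

lemma branch_chain:
  assumes "branch E" "a \<in> Pol"
  shows "fps_deriv (E a) = E (deriv_x a) * fps_deriv (E var_x) + E (deriv_y a) * fps_deriv (E var_y)"
proof -
  interpret rhom E using assms by (simp add: branch_def)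
  show ?thesis using assms(2)
    by (induction rule: Pol.induct)
      (use assms(1) in \<open>auto simp: branch_def deriv_simps deriv_add deriv_mult algebra_simps\<close>)
qed

section \<open>The local formula\<close>

lemma subdegree_fps_deriv:
  fixes c :: "complex fps"
  assumes "c \<noteq> 0" "fps_nth c 0 = 0"
  shows "subdegree c > 0" "fps_deriv c \<noteq> 0" "subdegree (fps_deriv c) = subdegree c - 1"
    "fps_nth (fps_deriv c) (subdegree c - 1) = of_nat (subdegree c) * fps_nth c (subdegree c)"
proof -
  show s: "subdegree c > 0" using assms by (metis gr0I nth_subdegree_nonzero)
  then obtain n where n: "subdegree c = Suc n" by (cases "subdegree c") auto
  show lead: "fps_nth (fps_deriv c) (subdegree c - 1) = of_nat (subdegree c) * fps_nth c (subdegree c)"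
    by (simp add: n)
  have nz: "fps_nth (fps_deriv c) (subdegree c - 1) \<noteq> 0"
    unfolding lead using assms(1) s by simp
  then show "fps_deriv c \<noteq> 0" by (metis fps_zero_nth)
  show "subdegree (fps_deriv c) = subdegree c - 1"
    by (rule subdegreeI[OF nz]) (simp add: n nth_less_subdegree_zero)
qed

text \<open>The leading coefficients of \<open>u c\<close> and \<open>a b\<close> cannot cancel: their quotient is
  the positive rational number \<open>ord a / ord c\<close>.\<close>

lemma subdegree_log_sum:
  fixes u a b c :: "complex fps"
  assumes u: "fps_nth u 0 \<noteq> 0" and a: "a \<noteq> 0" "fps_nth a 0 = 0" and b: "b \<noteq> 0" and c: "fps_nth c 0 = 0"
    and eq: "u * fps_deriv c = b * fps_deriv a"
  shows "u * c + b * a \<noteq> 0" "subdegree (u * c + b * a) = subdegree b + subdegree a"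
proof -
  define l s r where "l = subdegree a" and "s = subdegree c" and "r = subdegree b"
  note da = subdegree_fps_deriv[OF a, folded l_def]
  have u0: "u \<noteq> 0" "subdegree u = 0" using u by auto
  have "b * fps_deriv a \<noteq> 0" using b da(2) by simp
  then have "c \<noteq> 0" using eq by auto
  note dc = subdegree_fps_deriv[OF this c, folded s_def]
  have "subdegree (u * fps_deriv c) = s - 1" using u0 dc by (subst subdegree_mult) auto
  moreover have "subdegree (b * fps_deriv a) = r + (l - 1)" using b da by (subst subdegree_mult) (auto simp: r_def)
  ultimately have s: "s = r + l" using eq da(1) dc(1) by simp
  have 1: "fps_nth (u * fps_deriv c) (s - 1) = fps_nth u 0 * (of_nat s * fps_nth c s)"
    using nth_subdegree_mult[of u "fps_deriv c"] dc(3,4) u0(2) by simp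
  have 2: "fps_nth (b * fps_deriv a) (r + (l - 1)) = fps_nth b r * (of_nat l * fps_nth a l)"
    using nth_subdegree_mult[of b "fps_deriv a"] da(3,4) by (simp add: r_def)
  have "r + (l - 1) = s - 1" using s da(1) by simp
  then have key: "fps_nth u 0 * (of_nat s * fps_nth c s) = fps_nth b r * (of_nat l * fps_nth a l)"
    using 1 2 eq by simp
  have ba: "fps_nth (b * a) s = fps_nth b r * fps_nth a l"
    using nth_subdegree_mult[of b a] s by (simp add: r_def l_def)
  have uc: "fps_nth (u * c) s = fps_nth u 0 * fps_nth c s"
    using nth_subdegree_mult[of u c] u0 by (simp add: s_def)
  have nz: "fps_nth b r * fps_nth a l \<noteq> 0" using a b by (simp add: r_def l_def)
  \<comment> \<open>By \<open>key\<close>, \<open>s\<close> times the leading coefficient of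
    \<open>u c\<close> is \<open>l\<close> times that of \<open>b a\<close>, so the sum is a
    positive integer multiple of the latter.\<close>
  have "of_nat s * fps_nth (u * c + b * a) s = of_nat (s + l) * (fps_nth b r * fps_nth a l)"
  proof -
    have "of_nat s * fps_nth (u * c + b * a) s
        = of_nat s * (fps_nth u 0 * fps_nth c s) + of_nat s * (fps_nth b r * fps_nth a l)"
      by (simp only: fps_add_nth uc ba distrib_left)
    also have "of_nat s * (fps_nth u 0 * fps_nth c s) = of_nat l * (fps_nth b r * fps_nth a l)"
      using key by (simp add: ac_simps)
    finally show ?thesis by (simp add: distrib_right)
  qed
  moreover have "of_nat (s + l) \<noteq> (0 :: complex)" using da(1) unfolding of_nat_eq_0_iff by simp
  ultimately have top: "fps_nth (u * c + b * a) s \<noteq> 0" using nz by (metis mult_eq_0_iff)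
  then show "u * c + b * a \<noteq> 0" by (metis fps_zero_nth)
  have low: "fps_nth (u * c + b * a) i = 0" if "i < s" for i
  proof -
    have "subdegree (u * c) = s" using u0 \<open>c \<noteq> 0\<close> by (simp add: s_def)
    moreover have "subdegree (b * a) = s" using a b s by (simp add: r_def l_def)
    ultimately have "fps_nth (u * c) i = 0" "fps_nth (b * a) i = 0"
      using that by (auto simp only: intro!: nth_less_subdegree_zero)
    then show ?thesis by simp
  qed
  show "subdegree (u * c + b * a) = subdegree b + subdegree a"
    using subdegreeI[OF top low] s by (simp add: r_def l_def)
qed

text \<open>The powers of \<open>z\<close> up to \<open>n\<close> are dependent modulo the ideal.
  The lowest term of a relation factors out as a power of \<open>z\<close> times a unit.\<close>

lemma power_in_ideal:
  assumes n: "codim UNIV (ideal2 a b) n" and z: "cst z = 0"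
  shows "\<exists>N. z ^ N \<in> ideal2 a b"
proof -
  obtain L where L: "clin UNIV L" "\<And>f. (\<forall>i. L f i = 0) \<longleftrightarrow> f \<in> ideal2 a b" "range L = coords n"
    using n by (auto simp: codim_def)
  obtain c where c: "\<exists>i\<in>{..n}. c i \<noteq> 0" "\<And>k. (\<Sum>i\<in>{..n}. c i * L (z ^ i) k) = 0"
    using more_vectors_dependent[of "{..n}" n "\<lambda>i. L (z ^ i)"] L(3) by fastforce
  define v where "v = (\<Sum>i\<le>n. const2 (c i) * z ^ i)"
  have "L v k = 0" for k unfolding v_def using clin_comb[OF L(1), of "{..n}" "\<lambda>i. z ^ i" c k] c(2) by simp
  then have v: "v \<in> ideal2 a b" using L(2) by blast
  define N where "N = (LEAST i. c i \<noteq> 0)"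
  have N: "c N \<noteq> 0" "\<And>i. i < N \<Longrightarrow> c i = 0" using c(1) LeastI_ex[of "\<lambda>i. c i \<noteq> 0"] not_less_Least[of _ "\<lambda>i. c i \<noteq> 0"]
    unfolding N_def by blast+
  have "N \<le> n" using c(1) unfolding N_def by (auto intro: Least_le order_trans)
  define w where "w = const2 (c N) + z * (\<Sum>i\<in>{N<..n}. const2 (c i) * z ^ (i - N - 1))"
  have "v = (\<Sum>i\<in>{N..n}. const2 (c i) * z ^ i)"
    unfolding v_def by (rule sum.mono_neutral_right) (use N(2) in auto)
  also have "{N..n} = insert N {N<..n}" using \<open>N \<le> n\<close> by auto
  also have "(\<Sum>i\<in>insert N {N<..n}. const2 (c i) * z ^ i) = const2 (c N) * z ^ N + (\<Sum>i\<in>{N<..n}. const2 (c i) * z ^ i)"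
    by simp
  also have "(\<Sum>i\<in>{N<..n}. const2 (c i) * z ^ i) = z ^ N * (z * (\<Sum>i\<in>{N<..n}. const2 (c i) * z ^ (i - N - 1)))"
    unfolding sum_distrib_left
  proof (intro sum.cong refl)
    fix i assume "i \<in> {N<..n}"
    then have "i = N + (1 + (i - N - 1))" by auto
    then have "z ^ i = z ^ N * (z ^ 1 * z ^ (i - N - 1))" by (metis power_add)
    then show "const2 (c i) * z ^ i = z ^ N * (z * (const2 (c i) * z ^ (i - N - 1)))" by (simp add: mult_ac)
  qed
  finally have vw: "v = z ^ N * w" by (simp add: w_def algebra_simps)
  have "cst w \<noteq> 0" using N(1) z by (simp add: w_def)
  then obtain w' where "w * w' = 1" using cst_unit by blast
  then have "v * w' = z ^ N" by (simp add: vw mult.assoc)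
  then show ?thesis using ideal2_mult'[OF v, of w'] by auto
qed

text \<open>\<open>nsb\<close> says that no branch lies in the singular locus of \<open>f\<close>.
  It makes \<open>f_y\<close> nonzero along every branch of \<open>g\<close>, and so yields the
  finiteness of both codimensions together with their difference.\<close>

lemma local_formula:
  assumes f: "f \<in> Pol" and q: "q \<in> Pol" and E0: "branch E0" "smooth_germ q E0"
    and qy0: "cst (deriv_y q) \<noteq> 0" and X1: "fps_nth (E0 var_x) 1 \<noteq> 0"
    and f0: "cst f = 0" and Ef0: "E0 f \<noteq> 0"
    and nsb: "\<And>E. branch E \<Longrightarrow> E f = 0 \<Longrightarrow> E (deriv_x f) = 0 \<Longrightarrow> E (deriv_y f) = 0 \<Longrightarrow> False"
  shows "\<exists>\<mu>. codim UNIV (ideal2 (deriv_x f) (deriv_y f)) \<mu> \<and>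
    codim UNIV (ideal2 (deriv_x (f * q)) (deriv_y (f * q))) (\<mu> + (2 * subdegree (E0 f) - 1))"
proof -
  define fx fy qx qy where "fx = deriv_x f" and "fy = deriv_y f" and "qx = deriv_x q" and "qy = deriv_y q"
  note defs = fx_def fy_def qx_def qy_def
  define g k where "g = qy * fx - qx * fy" and "k = qy * f + q * fy"
  define m where "m = subdegree (E0 f)"
  obtain w where w: "qy * w = 1" using cst_unit qy0 qy_def by blast
  have Pols: "fx \<in> Pol" "fy \<in> Pol" "qx \<in> Pol" "qy \<in> Pol" using f q Pol_deriv by (auto simp: defs)
  then have gPol: "g \<in> Pol" unfolding g_def by (intro Pol_diff Pol.mult)
  have q0: "cst q = 0"
  proof -
    have "E0 q = 0" using E0(2) by (simp add: smooth_germ_def)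
    then show ?thesis using branch_cst[OF E0(1) q] by simp
  qed
  have J: "ideal2 fx fy = ideal2 g fy"
  proof (intro equalityI ideal2_subset ideal2_gen)
    show "g \<in> ideal2 fx fy" unfolding g_def by (intro csub_diff[OF csub_ideal2] ideal2_mult ideal2_gen)
    have "fx = (qy * w) * fx" by (simp add: w)
    also have "\<dots> = w * g + w * qx * fy" by (simp add: g_def algebra_simps)
    finally show "fx \<in> ideal2 g fy" using ideal2_add ideal2_mult ideal2_gen by metis
  qed
  have Jk: "ideal2 (deriv_x (f * q)) (deriv_y (f * q)) = ideal2 (q * g) k"
  proof -
    have k: "deriv_y (f * q) = k" by (simp add: deriv_mult k_def defs mult.commute)
    \<comment> \<open>Since \<open>q_y\<close> is a unit, this identity exchanges the first partial
      derivative for \<open>q g\<close> modulo \<open>k\<close>.\<close>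
    have dx: "qy * deriv_x (f * q) = q * g + qx * k" by (simp add: deriv_mult g_def k_def defs algebra_simps)
    have "q * g = qy * deriv_x (f * q) - qx * k" by (simp add: dx)
    then have 1: "q * g \<in> ideal2 (deriv_x (f * q)) k" using csub_diff[OF csub_ideal2] ideal2_mult ideal2_gen by metis
    have "deriv_x (f * q) = (qy * w) * deriv_x (f * q)" by (simp add: w)
    also have "\<dots> = w * (qy * deriv_x (f * q))" by (simp add: mult_ac)
    finally have "deriv_x (f * q) = w * (q * g + qx * k)" by (simp add: dx)
    then have "deriv_x (f * q) \<in> ideal2 (q * g) k" using ideal2_add ideal2_mult ideal2_gen by metis
    with 1 show ?thesis unfolding k by (intro equalityI ideal2_subset ideal2_gen)
  qed
  interpret E0: rhom E0 using E0(1) by (simp add: branch_def)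
  have E0q: "E0 q = 0" using E0(2) by (simp add: smooth_germ_def)
  have m: "m > 0" "fps_deriv (E0 f) \<noteq> 0" "subdegree (fps_deriv (E0 f)) = m - 1"
    using subdegree_fps_deriv[OF Ef0] branch_cst[OF E0(1) f] f0 by (auto simp: m_def)
  have E0qy: "fps_nth (E0 qy) 0 \<noteq> 0" using branch_cst[OF E0(1) Pols(4)] qy0 by (simp add: qy_def)
  \<comment> \<open>Along \<open>q = 0\<close> the velocity is proportional to
    \<open>(q_y, -q_x)\<close>, so \<open>g\<close> becomes the derivative of \<open>f\<close> in
    the parameter up to the units \<open>E0 qy\<close> and \<open>x'\<close>.\<close>
  have "E0 g * fps_deriv (E0 var_x) = E0 qy * fps_deriv (E0 f)"
  proof -
    have "E0 qx * fps_deriv (E0 var_x) + E0 qy * fps_deriv (E0 var_y) = 0"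
      using branch_chain[OF E0(1) q] E0q by (simp add: defs)
    then have "E0 qy * fps_deriv (E0 var_y) = - (E0 qx * fps_deriv (E0 var_x))" by (simp add: eq_neg_iff_add_eq_0 add.commute)
    then have *: "E0 fy * (E0 qy * fps_deriv (E0 var_y)) = - (E0 fy * (E0 qx * fps_deriv (E0 var_x)))" by simp
    show ?thesis unfolding branch_chain[OF E0(1) f, folded defs] using *
      by (simp add: g_def algebra_simps)
  qed
  moreover have X1': "fps_nth (fps_deriv (E0 var_x)) 0 \<noteq> 0" using X1 by simp
  moreover have "E0 qy \<noteq> 0" "fps_deriv (E0 var_x) \<noteq> 0" using E0qy X1' by (metis fps_zero_nth)+
  moreover have "subdegree (E0 qy) = 0" "subdegree (fps_deriv (E0 var_x)) = 0"
    using E0qy X1' by (intro subdegree_eq_0; simp)+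
  ultimately have E0g: "E0 g \<noteq> 0" "subdegree (E0 g) = m - 1"
    using m(2,3) by (metis mult_eq_0_iff, metis mult_eq_0_iff subdegree_mult add_0 add_0_right)
  have gq: "codim UNIV (ideal2 q g) (m - 1)" using codim_smooth_germ[OF E0(2) E0g(1)] E0g(2) by simp
  obtain p where p: "g = fps_of_poly p" using Pol_fps_of_poly[OF gPol] by blast
  have "p \<noteq> 0" using E0g(1) p by auto
  define Q where "Q \<kappa> Es \<longleftrightarrow> \<kappa> > 0 \<and> (\<forall>E\<in>set Es. branch E \<and> E g = 0) \<and>
    (\<forall>a. (\<forall>E\<in>set Es. E a \<noteq> 0) \<longrightarrow> (\<exists>n. codim UNIV (ideal2 g a) n \<and> \<kappa> * n = (\<Sum>E\<leftarrow>Es. subdegree (E a))))"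
    for \<kappa> Es
  have "\<exists>\<kappa> Es. Q \<kappa> Es" unfolding Q_def p by (rule branches[OF \<open>p \<noteq> 0\<close>])
  then obtain \<kappa> Es where Q: "Q \<kappa> Es" by blast
  note Q' = Q[unfolded Q_def]
  note \<kappa> = Q'[THEN conjunct1] and Es = Q'[THEN conjunct2, THEN conjunct1]
    and fin = Q'[THEN conjunct2, THEN conjunct2]
  have main: "E q \<noteq> 0 \<and> E fy \<noteq> 0 \<and> E k \<noteq> 0 \<and> subdegree (E k) = subdegree (E q) + subdegree (E fy)"
    if EEs: "E \<in> set Es" for E
  proof -
    have br: "branch E" and Eg: "E g = 0" using bspec[OF Es EEs] by auto
    interpret E: rhom E using br by (simp add: branch_def)
    \<comment> \<open>\<open>q\<close> and \<open>g\<close> meet with finite multiplicity, so powers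
      of \<open>x\<close> and \<open>y\<close> lie in their ideal. A branch on both curves would
      send \<open>x\<close> and \<open>y\<close> to zero.\<close>
    have Eq: "E q \<noteq> 0"
    proof
      assume Eq: "E q = 0"
      have "E z = 0" if z: "cst z = 0" for z
      proof -
        obtain N where "z ^ N \<in> ideal2 q g" using power_in_ideal[OF gq z] by blast
        then obtain s t where "z ^ N = q * s + g * t" by (auto simp: ideal2_def)
        then have "E (z ^ N) = 0" by (simp only: E.add E.mult Eq Eg) simp
        then show ?thesis by simp
      qed
      then show False using br by (auto simp: branch_def)
    qed
    have qyE: "fps_nth (E qy) 0 \<noteq> 0" using branch_cst[OF br Pols(4)] qy0 by (simp add: qy_def)
    then have qyE': "E qy \<noteq> 0" by auto
    have gE: "E qy * E fx = E qx * E fy" using Eg by (simp add: g_def)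
    have eq: "E qy * fps_deriv (E f) = E fy * fps_deriv (E q)"
    proof -
      have "E qy * fps_deriv (E f) = (E qy * E fx) * fps_deriv (E var_x) + E qy * E fy * fps_deriv (E var_y)"
        unfolding branch_chain[OF br f, folded defs] by (simp add: algebra_simps)
      also have "\<dots> = E fy * fps_deriv (E q)"
        unfolding gE branch_chain[OF br q, folded defs] by (simp add: algebra_simps)
      finally show ?thesis .
    qed
    have fE0: "fps_nth (E f) 0 = 0" using branch_cst[OF br f] f0 by simp
    \<comment> \<open>If \<open>f_y\<close> vanished, \<open>f\<close> would be constant along the
      branch, hence zero, and \<open>f_x\<close> would vanish too, contrary to
      \<open>nsb\<close>.\<close>
    have fyE: "E fy \<noteq> 0"
    proof
      assume 0: "E fy = 0"
      then have "fps_deriv (E f) = 0" using eq qyE' by (metis mult_eq_0_iff mult_zero_left)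
      then have "E f = 0" using fE0 by (metis fps_const_0_eq_0 fps_deriv_eq_0_iff)
      moreover have "E fx = 0" using gE 0 qyE' by simp
      ultimately show False using nsb[OF br] 0 by (simp add: defs)
    qed
    have "fps_nth (E q) 0 = 0" using branch_cst[OF br q] q0 by simp
    from subdegree_log_sum[OF qyE Eq this fyE fE0 eq] have "E qy * E f + E fy * E q \<noteq> 0"
      "subdegree (E qy * E f + E fy * E q) = subdegree (E fy) + subdegree (E q)" .
    then show ?thesis using Eq fyE by (simp add: k_def mult.commute add.commute)
  qed
  have nz: "\<forall>E\<in>set Es. E q \<noteq> 0" "\<forall>E\<in>set Es. E fy \<noteq> 0" "\<forall>E\<in>set Es. E k \<noteq> 0"
    using main by (intro ballI; simp)+
  obtain n1 where n1: "codim UNIV (ideal2 g q) n1" "\<kappa> * n1 = (\<Sum>E\<leftarrow>Es. subdegree (E q))" using fin[THEN spec, THEN mp, OF nz(1)] by blast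
  obtain n2 where n2: "codim UNIV (ideal2 g fy) n2" "\<kappa> * n2 = (\<Sum>E\<leftarrow>Es. subdegree (E fy))" using fin[THEN spec, THEN mp, OF nz(2)] by blast
  obtain n3 where n3: "codim UNIV (ideal2 g k) n3" "\<kappa> * n3 = (\<Sum>E\<leftarrow>Es. subdegree (E k))" using fin[THEN spec, THEN mp, OF nz(3)] by blast
  have "(\<Sum>E\<leftarrow>Es. subdegree (E k)) = (\<Sum>E\<leftarrow>Es. subdegree (E q) + subdegree (E fy))"
    using main by (intro arg_cong[where f = sum_list] map_cong) auto
  then have "\<kappa> * n3 = \<kappa> * (n1 + n2)" using n1(2) n2(2) n3(2) by (simp add: sum_list_addf distrib_left)
  then have n3': "n3 = n1 + n2" using \<kappa> by simp
  have n1': "n1 = m - 1" using codim_unique[OF csub_UNIV n1(1)] gq ideal2_commute by metis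
  have E0k: "E0 k = E0 qy * E0 f" using E0q by (simp add: k_def)
  then have "E0 k \<noteq> 0" "subdegree (E0 k) = m"
    using \<open>E0 qy \<noteq> 0\<close> Ef0 \<open>subdegree (E0 qy) = 0\<close> by (auto simp: m_def)
  moreover have "q \<noteq> 0"
  proof
    assume "q = 0"
    then have "qy = 0" using deriv_simps(4)[of 0] by (simp add: qy_def)
    then show False using w by simp
  qed
  ultimately have "codim UNIV (ideal2 (q * g) k) (m + n3)"
    using codim_mult_smooth_germ[OF E0(2) _ n3(1)] by metis
  \<comment> \<open>\<open>n3 = n2 + (m - 1)\<close>; positivity of \<open>m\<close> makes the
    truncated differences exact.\<close>
  moreover have "m + n3 = n2 + (2 * m - 1)" using m(1) n3' n1' by simp
  ultimately show ?thesis using n2(1) J Jk unfolding defs m_def by auto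
qed

section \<open>Convergent power series\<close>

abbreviation cf2 :: "fps2 \<Rightarrow> nat \<Rightarrow> nat \<Rightarrow> complex" where
  "cf2 f i j \<equiv> fps_nth (fps_nth f j) i"

lemma cf2_eqI: "(\<And>i j. cf2 f i j = cf2 g i j) \<Longrightarrow> f = g"
  by (intro fps_ext)

lemma cf2_mult: "cf2 (f * g) i j = (\<Sum>b\<le>j. \<Sum>a\<le>i. cf2 f a b * cf2 g (i - a) (j - b))"
  by (simp add: fps_mult_nth fps_sum_nth atLeast0AtMost)

definition geo :: "fps2 \<Rightarrow> bool" where
  "geo f \<longleftrightarrow> (\<exists>K R. K \<ge> 0 \<and> R > 0 \<and> (\<forall>i j. norm (cf2 f i j) \<le> K * R ^ (i + j)))"

text \<open>A summable family is bounded, which is a Cauchy estimate with \<open>R = 1/r\<close>.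
  Conversely the radius \<open>1/(2R)\<close> gives the geometric double series of ratio one half as
  a majorant.\<close>

lemma convergent2_geo: "convergent2 f \<longleftrightarrow> geo f"
proof
  assume "convergent2 f"
  then obtain r where r: "r > 0" and s: "(\<lambda>(i, j). norm (cf2 f i j) * r ^ (i + j)) summable_on UNIV"
    by (auto simp: convergent2_def)
  define K where "K = infsum (\<lambda>(i, j). norm (cf2 f i j) * r ^ (i + j)) UNIV"
  have le: "norm (cf2 f i j) * r ^ (i + j) \<le> K" for i j
    using finite_sum_le_infsum[OF s, of "{(i, j)}"] r by (auto simp: K_def)
  have "K \<ge> 0" using order_trans[OF norm_ge_zero, of "cf2 f 0 0" K] le[of 0 0] by simp
  moreover have "norm (cf2 f i j) \<le> K * (1 / r) ^ (i + j)" for i j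
    using le[of j i] r by (simp add: field_simps power_divide)
  ultimately show "geo f" using r unfolding geo_def by (intro exI[of _ K] exI[of _ "1 / r"]) auto
next
  assume "geo f"
  then obtain K R where K: "K \<ge> 0" "R > 0" "\<And>i j. norm (cf2 f i j) \<le> K * R ^ (i + j)" by (auto simp: geo_def)
  define r where "r = 1 / (2 * R)"
  have r: "r > 0" using K by (simp add: r_def)
  have le: "norm (cf2 f i j) * r ^ (i + j) \<le> K * ((1 / 2) ^ i * (1 / 2) ^ j)" for i j
  proof -
    have "norm (cf2 f i j) * r ^ (i + j) \<le> K * R ^ (i + j) * r ^ (i + j)"
      using K(3) r by (intro mult_right_mono) auto
    also have "\<dots> = K * (R * r) ^ (i + j)" by (simp add: power_mult_distrib)
    also have "R * r = 1 / 2" using K by (simp add: r_def)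
    finally show ?thesis by (simp add: power_add)
  qed
  have "(\<lambda>(i, j). norm (cf2 f i j) * r ^ (i + j)) summable_on UNIV"
  proof (rule nonneg_bdd_above_summable_on)
    show "bdd_above (sum (\<lambda>(i, j). norm (cf2 f i j) * r ^ (i + j)) ` {F. F \<subseteq> UNIV \<and> finite F})"
    proof (rule bdd_aboveI)
      fix S assume "S \<in> sum (\<lambda>(i, j). norm (cf2 f i j) * r ^ (i + j)) ` {F. F \<subseteq> UNIV \<and> finite F}"
      then obtain F where F: "finite F" "S = (\<Sum>(i, j)\<in>F. norm (cf2 f i j) * r ^ (i + j))" by auto
      define n where "n = Max (insert 0 (fst ` F \<union> snd ` F))"
      have "F \<subseteq> {..n} \<times> {..n}" using F(1) by (force simp: n_def intro!: Max_ge)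
      then have "S \<le> (\<Sum>(i, j)\<in>{..n} \<times> {..n}. norm (cf2 f i j) * r ^ (i + j))"
        unfolding F(2) using r by (intro sum_mono2) auto
      also have "\<dots> \<le> (\<Sum>(i, j)\<in>{..n} \<times> {..n}. K * ((1 / 2) ^ i * (1 / 2) ^ j))"
        using le by (intro sum_mono) auto
      also have "\<dots> = K * ((\<Sum>i\<le>n. (1 / 2) ^ i) * (\<Sum>j\<le>n. (1 / 2) ^ j))"
        unfolding sum_product sum.cartesian_product unfolding sum_distrib_left by (rule sum.cong) auto
      also have "\<dots> \<le> K * (2 * 2)"
      proof -
        have "(\<Sum>i\<le>n. (1 / 2 :: real) ^ i) \<le> 2" by (simp add: sum_gp0)
        then show ?thesis using K(1) by (intro mult_left_mono mult_mono sum_nonneg) auto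
      qed
      finally show "S \<le> K * (2 * 2)" .
    qed
  qed (use r in auto)
  then show "convergent2 f" using r by (auto simp: convergent2_def)
qed

definition conv :: "fps2 set" where "conv = {f. geo f}"

lemma carrier_conv: "carrier conv_ring = conv"
  by (simp add: conv_ring_def conv_def convergent2_geo)

lemma convI: "K \<ge> 0 \<Longrightarrow> R > 0 \<Longrightarrow> (\<And>i j. norm (cf2 f i j) \<le> K * R ^ (i + j)) \<Longrightarrow> f \<in> conv"
  unfolding conv_def geo_def by blast

lemma convE:
  assumes "f \<in> conv"
  obtains K R where "K \<ge> 0" "R > 0" "\<And>i j. norm (cf2 f i j) \<le> K * R ^ (i + j)"
  using assms unfolding conv_def geo_def by blast

lemma conv_add: "f \<in> conv \<Longrightarrow> g \<in> conv \<Longrightarrow> f + g \<in> conv"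
proof -
  assume "f \<in> conv" "g \<in> conv"
  then obtain K R K' R' where K: "K \<ge> 0" "R > 0" "\<And>i j. norm (cf2 f i j) \<le> K * R ^ (i + j)"
    "K' \<ge> 0" "R' > 0" "\<And>i j. norm (cf2 g i j) \<le> K' * R' ^ (i + j)" by (meson convE)
  show "f + g \<in> conv"
  proof (rule convI[of "K + K'" "max R R'"])
    fix i j
    have "norm (cf2 (f + g) i j) \<le> K * R ^ (i + j) + K' * R' ^ (i + j)"
      using K(3)[of j i] K(6)[of j i] norm_triangle_ineq[of "cf2 f i j" "cf2 g i j"] by simp
    also have "\<dots> \<le> K * max R R' ^ (i + j) + K' * max R R' ^ (i + j)"
      using K by (intro add_mono mult_left_mono power_mono) auto
    finally show "norm (cf2 (f + g) i j) \<le> (K + K') * max R R' ^ (i + j)" by (simp add: algebra_simps)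
  qed (use K in auto)
qed

lemma conv_mult: "f \<in> conv \<Longrightarrow> g \<in> conv \<Longrightarrow> f * g \<in> conv"
proof -
  assume "f \<in> conv" "g \<in> conv"
  then obtain K R K' R' where K: "K \<ge> 0" "R > 0" "\<And>i j. norm (cf2 f i j) \<le> K * R ^ (i + j)"
    "K' \<ge> 0" "R' > 0" "\<And>i j. norm (cf2 g i j) \<le> K' * R' ^ (i + j)" by (meson convE)
  define S where "S = max R R'"
  have S: "S > 0" using K by (auto simp: S_def)
  have f: "norm (cf2 f i j) \<le> K * S ^ (i + j)" for i j
    using K by (intro order_trans[OF K(3)] mult_left_mono power_mono) (auto simp: S_def)
  have g: "norm (cf2 g i j) \<le> K' * S ^ (i + j)" for i j
    using K by (intro order_trans[OF K(6)] mult_left_mono power_mono) (auto simp: S_def)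
  show "f * g \<in> conv"
  \<comment> \<open>Coefficient \<open>(i, j)\<close> has \<open>(i+1)(j+1)\<close> terms; as
    \<open>n + 1 \<le> 2^n\<close>, doubling the ratio absorbs that number.\<close>
  proof (rule convI[of "K * K'" "2 * S"])
    fix i j
    have "norm (cf2 (f * g) i j) \<le> (\<Sum>b\<le>j. \<Sum>a\<le>i. norm (cf2 f a b) * norm (cf2 g (i - a) (j - b)))"
      unfolding cf2_mult by (intro sum_norm_le) (auto simp: norm_mult intro!: sum_norm_le)
    also have "\<dots> \<le> (\<Sum>b\<le>j. \<Sum>a\<le>i. K * K' * S ^ (i + j))"
    proof (intro sum_mono)
      fix b a assume ab: "b \<in> {..j}" "a \<in> {..i}"
      have "norm (cf2 f a b) * norm (cf2 g (i - a) (j - b)) \<le> (K * S ^ (a + b)) * (K' * S ^ (i - a + (j - b)))"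
        using K S by (intro mult_mono f g) auto
      also have "\<dots> = K * K' * S ^ ((a + b) + (i - a + (j - b)))" by (simp only: power_add mult_ac)
      also have "(a + b) + (i - a + (j - b)) = i + j" using ab by auto
      finally show "norm (cf2 f a b) * norm (cf2 g (i - a) (j - b)) \<le> K * K' * S ^ (i + j)" .
    qed
    also have "\<dots> = (real (Suc j) * real (Suc i)) * (K * K' * S ^ (i + j))" by simp
    also have "\<dots> \<le> (2 ^ j * 2 ^ i) * (K * K' * S ^ (i + j))"
    proof -
      have "real (Suc n) \<le> 2 ^ n" for n
      proof (induction n)
        case (Suc n)
        have "real (Suc (Suc n)) \<le> 2 * real (Suc n)" by simp
        also have "\<dots> \<le> 2 * 2 ^ n" using Suc by (intro mult_left_mono) auto
        finally show ?case by simp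
      qed simp
      then show ?thesis using K S by (intro mult_right_mono mult_mono) auto
    qed
    also have "\<dots> = K * K' * (2 * S) ^ (i + j)" by (simp add: power_mult_distrib power_add mult_ac)
    finally show "norm (cf2 (f * g) i j) \<le> K * K' * (2 * S) ^ (i + j)" .
  qed (use K S in auto)
qed

lemma conv_finite:
  assumes "\<And>i j. i + j \<ge> N \<Longrightarrow> cf2 f i j = 0"
  shows "f \<in> conv"
proof (rule convI[of "\<Sum>i<N. \<Sum>j<N. norm (cf2 f i j)" 1])
  fix i j
  show "norm (cf2 f i j) \<le> (\<Sum>i<N. \<Sum>j<N. norm (cf2 f i j)) * 1 ^ (i + j)"
  proof (cases "i + j < N")
    case True
    have "norm (cf2 f i j) \<le> (\<Sum>j<N. norm (cf2 f i j))"
      using True by (intro member_le_sum) auto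
    also have "\<dots> \<le> (\<Sum>i<N. \<Sum>j<N. norm (cf2 f i j))"
      using True by (intro member_le_sum[of i "{..<N}" "\<lambda>i. \<Sum>j<N. norm (cf2 f i j)"] sum_nonneg) auto
    finally show ?thesis by simp
  next
    case False
    have "0 \<le> (\<Sum>i<N. \<Sum>j<N. norm (cf2 f i j))" by (intro sum_nonneg norm_ge_zero)
    then show ?thesis using False assms[of i j] by simp
  qed
qed (auto intro!: sum_nonneg)

lemma Pol_conv: "f \<in> Pol \<Longrightarrow> f \<in> conv"
proof (induction rule: Pol.induct)
  case (const c)
  show ?case by (rule conv_finite[of 1]) (auto simp: const2_def)
next
  case x
  show ?case by (rule conv_finite[of 2]) (auto simp: var_x_def fps_X_def)
next
  case y
  show ?case by (rule conv_finite[of 2]) (auto simp: var_y_def fps_X_def)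
qed (auto intro: conv_add conv_mult)

lemma csub_conv [simp]: "csub conv"
  unfolding csub_def using conv_add conv_mult Pol_conv Pol.const Pol_0_1 by blast

lemma conv_diff: "f \<in> conv \<Longrightarrow> g \<in> conv \<Longrightarrow> f - g \<in> conv"
  by (rule csub_diff[OF csub_conv])

text \<open>Majorants for the recursion \<open>g = 1 + h g\<close>: because \<open>h\<close> has no
  constant term, a coefficient of \<open>g\<close> depends only on coefficients of lower total
  degree, and the bound \<open>S^(i+j)\<close> reproduces itself.\<close>

lemma conv_inverse_aux:
  assumes h: "h \<in> conv" and h0: "cst h = 0" and g: "(1 - h) * g = 1"
  shows "g \<in> conv"
proof -
  obtain K R where K: "K \<ge> 0" "R > 0" "\<And>i j. norm (cf2 h i j) \<le> K * R ^ (i + j)" using convE[OF h] by blast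
  \<comment> \<open>Chosen so that \<open>K * (4 * \<rho>) \<le> 1\<close> closes the induction,
    while \<open>\<rho> \<le> 1/4\<close> validates the estimate \<open>tail\<close>.\<close>
  define \<rho> where "\<rho> = min (1 / 4) (1 / (4 * K + 4))"
  have \<rho>: "0 < \<rho>" "\<rho> \<le> 1 / 4" "K * (4 * \<rho>) \<le> 1"
  proof -
    show "0 < \<rho>" "\<rho> \<le> 1 / 4" using K by (auto simp: \<rho>_def)
    have "K * (4 * \<rho>) \<le> K * (4 * (1 / (4 * K + 4)))" using K by (intro mult_left_mono) (auto simp: \<rho>_def)
    also have "\<dots> \<le> 1" using K by (simp add: field_simps)
    finally show "K * (4 * \<rho>) \<le> 1" .
  qed
  define S where "S = R / \<rho>"
  have S: "S > 0" "R = \<rho> * S" using K \<rho> by (auto simp: S_def)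
  have rec: "g = 1 + h * g" using g by (simp add: algebra_simps)
  have gp: "(\<Sum>i\<le>n. \<rho> ^ i) \<le> 1 / (1 - \<rho>)" for n
    using \<rho> by (simp add: sum_gp0 field_simps)
  \<comment> \<open>The double geometric sum without its first term is at most
    \<open>1/(1 - \<rho>)^2 - 1\<close>, which is at most \<open>4 * \<rho>\<close> for
    \<open>\<rho> \<le> 1/4\<close>.\<close>
  have tail: "(\<Sum>b\<le>j. \<Sum>a\<le>i. if a = 0 \<and> b = 0 then 0 else \<rho> ^ (a + b)) \<le> 4 * \<rho>" for i j
  proof -
    have "(\<Sum>b\<le>j. \<Sum>a\<le>i. if a = 0 \<and> b = 0 then 0 else \<rho> ^ (a + b))
      = (\<Sum>b\<le>j. \<Sum>a\<le>i. \<rho> ^ (a + b) - (if b = 0 then if a = 0 then 1 else 0 else 0))"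
      by (intro sum.cong) auto
    also have "\<dots> = (\<Sum>b\<le>j. \<Sum>a\<le>i. \<rho> ^ a * \<rho> ^ b) - 1"
    proof -
      have "(\<Sum>b\<le>j. \<Sum>a\<le>i. if b = 0 then if a = 0 then 1 else 0 else 0) = (\<Sum>b\<le>j. if b = 0 then 1 else (0 :: real))"
        by (intro sum.cong) auto
      then show ?thesis by (simp add: sum_subtractf power_add)
    qed
    also have "(\<Sum>b\<le>j. \<Sum>a\<le>i. \<rho> ^ a * \<rho> ^ b) = (\<Sum>a\<le>i. \<rho> ^ a) * (\<Sum>b\<le>j. \<rho> ^ b)"
      by (subst sum.swap) (simp add: sum_product)
    also have "\<dots> \<le> (1 / (1 - \<rho>)) * (1 / (1 - \<rho>))"
      using gp \<rho> by (intro mult_mono sum_nonneg) auto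
    also have "(1 / (1 - \<rho>)) * (1 / (1 - \<rho>)) - 1 \<le> 4 * \<rho>"
    proof -
      have "1 \<le> (1 + 4 * \<rho>) * ((1 - \<rho>) * (1 - \<rho>))"
      proof -
        have "(1 + 4 * \<rho>) * ((1 - \<rho>) * (1 - \<rho>)) - 1 = \<rho> * (2 - 7 * \<rho> + 4 * \<rho>\<^sup>2)"
          by (simp add: algebra_simps power2_eq_square)
        also have "\<dots> \<ge> 0" using \<rho> by (intro mult_nonneg_nonneg) (auto intro: add_nonneg_nonneg)
        finally show ?thesis by simp
      qed
      moreover have D: "0 < (1 - \<rho>) * (1 - \<rho>)" using \<rho> by (intro mult_pos_pos) auto
      ultimately have "1 / ((1 - \<rho>) * (1 - \<rho>)) \<le> 1 + 4 * \<rho>" by (simp only: pos_divide_le_eq[OF D])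
      then show ?thesis by simp
    qed
    finally show ?thesis by simp
  qed
  have bound: "norm (cf2 g i j) \<le> S ^ (i + j)" for i j
  proof (induction "i + j" arbitrary: i j rule: less_induct)
    case less
    show ?case
    proof (cases "i = 0 \<and> j = 0")
      case True
      have "cf2 g 0 0 = 1" using arg_cong[OF g, of cst] h0 by (simp add: cst_def[of g])
      then show ?thesis using True by simp
    next
      case False
      have "cf2 g i j = cf2 (h * g) i j" using arg_cong[OF rec, of "\<lambda>g. cf2 g i j"] False
        by (auto simp: fps_one_def split: if_splits)
      also have "norm \<dots> \<le> (\<Sum>b\<le>j. \<Sum>a\<le>i. norm (cf2 h a b * cf2 g (i - a) (j - b)))"
        unfolding cf2_mult by (intro sum_norm_le) (auto intro!: sum_norm_le)
      also have "\<dots> \<le> (\<Sum>b\<le>j. \<Sum>a\<le>i. K * S ^ (i + j) * (if a = 0 \<and> b = 0 then 0 else \<rho> ^ (a + b)))"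
      proof (intro sum_mono)
        fix b a assume ab: "b \<in> {..j}" "a \<in> {..i}"
        show "norm (cf2 h a b * cf2 g (i - a) (j - b)) \<le> K * S ^ (i + j) * (if a = 0 \<and> b = 0 then 0 else \<rho> ^ (a + b))"
        proof (cases "a = 0 \<and> b = 0")
          case True
          then show ?thesis using h0 by (simp add: cst_def)
        next
          case False
          have "norm (cf2 h a b * cf2 g (i - a) (j - b)) \<le> (K * R ^ (a + b)) * S ^ (i - a + (j - b))"
            unfolding norm_mult using K S ab False by (intro mult_mono less) auto
          also have "\<dots> = K * \<rho> ^ (a + b) * S ^ ((a + b) + (i - a + (j - b)))"
            by (simp only: S(2) power_mult_distrib power_add mult_ac)
          also have "(a + b) + (i - a + (j - b)) = i + j" using ab by auto
          finally show ?thesis unfolding if_not_P[OF False] by (simp only: mult_ac)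
        qed
      qed
      also have "\<dots> = K * S ^ (i + j) * (\<Sum>b\<le>j. \<Sum>a\<le>i. if a = 0 \<and> b = 0 then 0 else \<rho> ^ (a + b))"
        by (simp only: sum_distrib_left)
      also have "\<dots> \<le> K * S ^ (i + j) * (4 * \<rho>)" using K S tail by (intro mult_left_mono) auto
      also have "\<dots> = (K * (4 * \<rho>)) * S ^ (i + j)" by simp
      also have "\<dots> \<le> 1 * S ^ (i + j)" using \<rho> S by (intro mult_right_mono) auto
      finally show ?thesis by simp
    qed
  qed
  show ?thesis by (rule convI[of 1 S]) (use bound S in auto)
qed

lemma conv_inverse:
  assumes h: "h \<in> conv" and h0: "cst h = 0"
  shows "\<exists>g\<in>conv. (1 - h) * g = 1"
proof -
  obtain g where "(1 - h) * g = 1" using cst_unit[of "1 - h"] h0 by auto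
  then show ?thesis using conv_inverse_aux[OF h h0] by blast
qed

section \<open>Division by the monomials of a fixed degree, and truncation\<close>

lemma cf2_mon: "cf2 (var_x ^ i * var_y ^ j * f) p q = (if i \<le> p \<and> j \<le> q then cf2 f (p - i) (q - j) else 0)"
proof -
  have "fps_nth (var_x ^ i * (var_y ^ j * f)) q = fps_X ^ i * (if q < j then 0 else fps_nth f (q - j))"
    by (simp add: var_x_power_mult_nth) (simp add: var_y_def fps_X_power_mult_nth)
  then show ?thesis by (auto simp: mult.assoc fps_X_power_mult_nth)
qed

text \<open>A monomial \<open>x^p y^q\<close> with \<open>p + q \<ge> M\<close> may be divisible by
  several \<open>x^i y^(M-i)\<close>. Assigning it to \<open>i = min p M\<close> gives explicit
  quotients that inherit the coefficient bounds.\<close>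

definition mon_quot :: "nat \<Rightarrow> fps2 \<Rightarrow> nat \<Rightarrow> fps2" where
  "mon_quot M w i = (if i = M then Abs_fps (\<lambda>b. Abs_fps (\<lambda>a. cf2 w (a + M) b))
     else Abs_fps (\<lambda>b. fps_const (cf2 w i (b + (M - i)))))"

lemma cf2_mon_quot:
  "cf2 (mon_quot M w i) a b = (if i = M then cf2 w (a + M) b else if a = 0 then cf2 w i (b + (M - i)) else 0)"
  by (simp add: mon_quot_def)

lemma mon_quot_sum:
  assumes "\<And>p q. p + q < M \<Longrightarrow> cf2 w p q = 0"
  shows "w = (\<Sum>i\<le>M. var_x ^ i * var_y ^ (M - i) * mon_quot M w i)"
proof (rule cf2_eqI)
  fix p q
  have "cf2 (\<Sum>i\<le>M. var_x ^ i * var_y ^ (M - i) * mon_quot M w i) p q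
    = (\<Sum>i\<le>M. if i \<le> p \<and> M - i \<le> q then cf2 (mon_quot M w i) (p - i) (q - (M - i)) else 0)"
    by (simp only: fps_sum_nth cf2_mon)
  also have "\<dots> = (\<Sum>i\<le>M. if i = min p M then cf2 w p q else 0)"
  proof (rule sum.cong)
    fix i assume i: "i \<in> {..M}"
    show "(if i \<le> p \<and> M - i \<le> q then cf2 (mon_quot M w i) (p - i) (q - (M - i)) else 0)
       = (if i = min p M then cf2 w p q else 0)"
    proof (cases "i = M")
      case True
      then show ?thesis by (auto simp: cf2_mon_quot min_def)
    next
      case False
      then show ?thesis using i assms[of p q] by (auto simp: cf2_mon_quot min_def)
    qed
  qed simp
  also have "\<dots> = cf2 w p q" by simp
  finally show "cf2 w p q = cf2 (\<Sum>i\<le>M. var_x ^ i * var_y ^ (M - i) * mon_quot M w i) p q" by simp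
qed

lemma mon_quot_conv:
  assumes "w \<in> conv" "i \<le> M"
  shows "mon_quot M w i \<in> conv"
proof -
  obtain K R where K: "K \<ge> 0" "R > 0" "\<And>i j. norm (cf2 w i j) \<le> K * R ^ (i + j)" using convE[OF assms(1)] by blast
  show ?thesis
  proof (rule convI[of "K * R ^ M" R])
    fix a b
    have "norm (cf2 w (a + M) b) \<le> K * R ^ M * R ^ (a + b)"
      using K(3)[of b "a + M"] by (simp add: power_add mult_ac)
    moreover have "norm (cf2 w i (b + (M - i))) \<le> K * R ^ M * R ^ b"
    proof -
      have "i + (b + (M - i)) = M + b" using assms(2) by simp
      then show ?thesis using K(3)[of "b + (M - i)" i] by (simp add: power_add mult_ac)
    qed
    ultimately show "norm (cf2 (mon_quot M w i) a b) \<le> K * R ^ M * R ^ (a + b)"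
      using K by (auto simp: cf2_mon_quot)
  qed (use K in auto)
qed

definition trunc2 :: "nat \<Rightarrow> fps2 \<Rightarrow> fps2" where
  "trunc2 M u = Abs_fps (\<lambda>j. Abs_fps (\<lambda>i. if i + j < M then cf2 u i j else 0))"

lemma trunc2_conv: "trunc2 M u \<in> conv"
  by (rule conv_finite[of M]) (auto simp: trunc2_def)

lemma cf2_trunc2: "cf2 (u - trunc2 M u) p q = (if p + q < M then 0 else cf2 u p q)"
  by (simp add: trunc2_def)

lemma cf2_mult_trunc2: "p + q < M \<Longrightarrow> cf2 (a * (u - trunc2 M u)) p q = 0"
  unfolding cf2_mult cf2_trunc2 by (intro sum.neutral ballI) auto

section \<open>Comparison of formal and convergent ideals\<close>

definition idealc :: "fps2 \<Rightarrow> fps2 \<Rightarrow> fps2 set" where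
  "idealc a b = {a * u + b * v | u v. u \<in> conv \<and> v \<in> conv}"

lemma idealc_add: "f \<in> idealc a b \<Longrightarrow> g \<in> idealc a b \<Longrightarrow> f + g \<in> idealc a b"
proof -
  assume "f \<in> idealc a b" "g \<in> idealc a b"
  then obtain u v u' v' where "f = a * u + b * v" "g = a * u' + b * v'" "u \<in> conv" "v \<in> conv" "u' \<in> conv" "v' \<in> conv"
    by (auto simp: idealc_def)
  then have "f + g = a * (u + u') + b * (v + v')" "u + u' \<in> conv" "v + v' \<in> conv"
    by (auto simp: algebra_simps conv_add)
  then show ?thesis unfolding idealc_def by blast
qed

lemma idealc_mult: "f \<in> idealc a b \<Longrightarrow> g \<in> conv \<Longrightarrow> g * f \<in> idealc a b"
proof -
  assume "f \<in> idealc a b" "g \<in> conv"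
  then obtain u v where "f = a * u + b * v" "u \<in> conv" "v \<in> conv" by (auto simp: idealc_def)
  then have "g * f = a * (g * u) + b * (g * v)" "g * u \<in> conv" "g * v \<in> conv"
    using \<open>g \<in> conv\<close> by (auto simp: algebra_simps conv_mult)
  then show ?thesis unfolding idealc_def by blast
qed

lemma idealc_gen: "a \<in> idealc a b" "b \<in> idealc a b" "0 \<in> idealc a b"
proof -
  have "0 \<in> conv" "1 \<in> conv" using Pol_0_1 Pol_conv by auto
  moreover have "a = a * 1 + b * 0" "b = a * 0 + b * 1" "0 = a * 0 + b * 0" by simp_all
  ultimately show "a \<in> idealc a b" "b \<in> idealc a b" "0 \<in> idealc a b" unfolding idealc_def by blast+
qed

lemma csub_idealc [simp]: "csub (idealc a b)"
  using idealc_add idealc_mult idealc_gen Pol_conv[OF Pol.const] by (auto simp: csub_def)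

lemma idealc_comb: "u \<in> conv \<Longrightarrow> v \<in> conv \<Longrightarrow> a * u + b * v \<in> idealc a b"
  unfolding idealc_def by blast

lemma idealc_subset: "a \<in> conv \<Longrightarrow> b \<in> conv \<Longrightarrow> idealc a b \<subseteq> conv"
  by (auto simp: idealc_def conv_add conv_mult)

text \<open>Elements are eliminated one at a time: \<open>1 - h n\<close> is invertible, so the
  relation for \<open>\<mu> n\<close> expresses it through the others, and substitution keeps all
  coefficients in the maximal ideal.\<close>

lemma nakayama:
  assumes "finite S" and "\<And>i. i \<in> S \<Longrightarrow> \<exists>h. (\<forall>j\<in>S. h j \<in> conv \<and> cst (h j) = 0) \<and> \<mu> i - (\<Sum>j\<in>S. h j * \<mu> j) \<in> idealc a b"
  shows "\<forall>i\<in>S. \<mu> i \<in> idealc a b"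
  using assms
proof (induction S rule: finite_induct)
  case (insert n S)
  obtain h where h: "\<And>j. j \<in> insert n S \<Longrightarrow> h j \<in> conv \<and> cst (h j) = 0"
    and hI: "\<mu> n - (\<Sum>j\<in>insert n S. h j * \<mu> j) \<in> idealc a b" using insert.prems[of n] by auto
  obtain w where w: "w \<in> conv" "(1 - h n) * w = 1" using conv_inverse[of "h n"] h by auto
  \<comment> \<open>The coefficients of \<open>\<mu> n\<close> after dividing its relation by
    \<open>1 - h n\<close>.\<close>
  define k where "k j = w * h j" for j
  have k: "k j \<in> conv" "cst (k j) = 0" if "j \<in> S" for j using h that w by (auto simp: k_def conv_mult)
  have "w * (\<mu> n - (\<Sum>j\<in>insert n S. h j * \<mu> j)) = (1 - h n) * w * \<mu> n - (\<Sum>j\<in>S. k j * \<mu> j)"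
    using insert.hyps by (simp add: k_def algebra_simps sum_distrib_left)
  then have n: "\<mu> n - (\<Sum>j\<in>S. k j * \<mu> j) \<in> idealc a b" using idealc_mult[OF hI w(1)] w(2) by simp
  have S: "\<forall>i\<in>S. \<mu> i \<in> idealc a b"
  proof (rule insert.IH)
    fix i assume i: "i \<in> S"
    obtain h' where h': "\<And>j. j \<in> insert n S \<Longrightarrow> h' j \<in> conv \<and> cst (h' j) = 0"
      and hI': "\<mu> i - (\<Sum>j\<in>insert n S. h' j * \<mu> j) \<in> idealc a b" using insert.prems[of i] i by auto
    have eq: "(\<mu> i - (\<Sum>j\<in>insert n S. h' j * \<mu> j)) + h' n * (\<mu> n - (\<Sum>j\<in>S. k j * \<mu> j))
      = \<mu> i - (\<Sum>j\<in>S. (h' j + h' n * k j) * \<mu> j)"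
      using insert.hyps by (simp add: algebra_simps sum_distrib_left sum.distrib)
    have "\<mu> i - (\<Sum>j\<in>S. (h' j + h' n * k j) * \<mu> j) \<in> idealc a b"
      unfolding eq[symmetric] using h'[of n] by (intro idealc_add[OF hI' idealc_mult[OF n]]) simp
    moreover have "\<forall>j\<in>S. h' j + h' n * k j \<in> conv \<and> cst (h' j + h' n * k j) = 0"
      using h' k by (auto simp: conv_add conv_mult)
    ultimately show "\<exists>h. (\<forall>j\<in>S. h j \<in> conv \<and> cst (h j) = 0) \<and> \<mu> i - (\<Sum>j\<in>S. h j * \<mu> j) \<in> idealc a b"
      by (intro exI[of _ "\<lambda>j. h' j + h' n * k j"]) simp
  qed
  have "(\<Sum>j\<in>S. k j * \<mu> j) \<in> idealc a b"
    using S k by (intro csub_sum[OF csub_idealc] idealc_mult) auto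
  then have "\<mu> n \<in> idealc a b" using idealc_add[OF n, of "\<Sum>j\<in>S. k j * \<mu> j"] by simp
  then show ?case using S by simp
qed simp

lemma monomials_in_ideal:
  assumes n: "codim UNIV (ideal2 a b) n"
  shows "\<exists>M. \<forall>i\<le>M. var_x ^ i * var_y ^ (M - i) \<in> ideal2 a b"
proof -
  obtain A where A: "var_x ^ A \<in> ideal2 a b" using power_in_ideal[OF n, of var_x] by auto
  obtain B where B: "var_y ^ B \<in> ideal2 a b" using power_in_ideal[OF n, of var_y] by auto
  have "var_x ^ i * var_y ^ (A + B - i) \<in> ideal2 a b" if "i \<le> A + B" for i
  proof (cases "A \<le> i")
    case True
    then have "var_x ^ i = var_x ^ A * var_x ^ (i - A)" by (simp flip: power_add)
    then show ?thesis by (simp add: ideal2_mult' A)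
  next
    case False
    then have "A + B - i = B + (A - i)" by simp
    then have "var_y ^ (A + B - i) = var_y ^ B * var_y ^ (A - i)" by (simp only: power_add)
    then show ?thesis by (simp add: ideal2_mult' ideal2_mult B)
  qed
  then show ?thesis by blast
qed

text \<open>The formal ideal contains all monomials of some degree \<open>M\<close>; by Nakayama's
  lemma so does the convergent one. Modulo these monomials a series equals its truncation, so the
  formal coordinates also serve convergent series.\<close>

theorem codim_conv:
  assumes a: "a \<in> conv" and b: "b \<in> conv" and n: "codim UNIV (ideal2 a b) n"
  shows "codim conv (idealc a b) n"
proof -
  obtain M where M: "\<And>i. i \<le> M \<Longrightarrow> var_x ^ i * var_y ^ (M - i) \<in> ideal2 a b"
    using monomials_in_ideal[OF n] by blast
  have xyP: "var_x ^ i * var_y ^ j \<in> conv" for i j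
  proof -
    have "var_x ^ i \<in> Pol" "var_y ^ j \<in> Pol" by (induction i, auto intro: Pol.intros Pol_0_1, induction j, auto intro: Pol.intros Pol_0_1)
    then show ?thesis by (intro Pol_conv Pol.mult)
  qed
  have "\<forall>i\<in>{..M}. var_x ^ i * var_y ^ (M - i) \<in> idealc a b"
  proof (rule nakayama)
    fix i assume "i \<in> {..M}"
    then have "var_x ^ i * var_y ^ (M - i) \<in> ideal2 a b" using M by simp
    then obtain u v where uv: "var_x ^ i * var_y ^ (M - i) = a * u + b * v" unfolding ideal2_def by blast
    \<comment> \<open>Truncating the formal cofactors beyond degree \<open>M\<close>, not below it,
      leaves a remainder of order above \<open>M\<close>. Its quotients by monomials of degree
      \<open>M\<close> then have zero constant term, as Nakayama's lemma demands.\<close>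
    define w where "w = a * (u - trunc2 (Suc M) u) + b * (v - trunc2 (Suc M) v)"
    have w: "w = var_x ^ i * var_y ^ (M - i) - (a * trunc2 (Suc M) u + b * trunc2 (Suc M) v)"
      by (simp add: w_def uv algebra_simps)
    have wc: "w \<in> conv" unfolding w by (intro conv_diff xyP conv_add conv_mult a b trunc2_conv)
    have w0: "cf2 w p q = 0" if "p + q < Suc M" for p q using that by (simp add: w_def cf2_mult_trunc2)
    have "(\<Sum>j\<le>M. var_x ^ j * var_y ^ (M - j) * mon_quot M w j) = w"
      using w0 by (intro mon_quot_sum[symmetric]) simp
    then have "(\<Sum>j\<le>M. mon_quot M w j * (var_x ^ j * var_y ^ (M - j))) = w" by (simp only: mult.commute)
    then have "var_x ^ i * var_y ^ (M - i) - (\<Sum>j\<le>M. mon_quot M w j * (var_x ^ j * var_y ^ (M - j)))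
      = a * trunc2 (Suc M) u + b * trunc2 (Suc M) v" using w by simp
    moreover have "\<dots> \<in> idealc a b" by (intro idealc_comb trunc2_conv)
    moreover have "\<forall>j\<in>{..M}. mon_quot M w j \<in> conv \<and> cst (mon_quot M w j) = 0"
      using wc w0 by (auto simp: mon_quot_conv cst_def cf2_mon_quot)
    ultimately show "\<exists>h. (\<forall>j\<in>{..M}. h j \<in> conv \<and> cst (h j) = 0) \<and>
        var_x ^ i * var_y ^ (M - i) - (\<Sum>j\<le>M. h j * (var_x ^ j * var_y ^ (M - j))) \<in> idealc a b"
      by (intro exI[of _ "mon_quot M w"]) simp
  qed simp
  then have Mc: "var_x ^ i * var_y ^ (M - i) \<in> idealc a b" if "i \<le> M" for i using that by simp
  have sub: "idealc a b \<subseteq> ideal2 a b" by (auto simp: idealc_def ideal2_def)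
  have contract: "f \<in> idealc a b" if f: "f \<in> conv" "f \<in> ideal2 a b" for f
  proof -
    obtain u v where uv: "f = a * u + b * v" using f(2) by (auto simp: ideal2_def)
    define w where "w = a * (u - trunc2 M u) + b * (v - trunc2 M v)"
    have w: "w = f - (a * trunc2 M u + b * trunc2 M v)" by (simp add: w_def uv algebra_simps)
    have wc: "w \<in> conv" unfolding w by (intro conv_diff f conv_add conv_mult a b trunc2_conv)
    have "w = (\<Sum>j\<le>M. var_x ^ j * var_y ^ (M - j) * mon_quot M w j)"
      by (intro mon_quot_sum) (simp add: w_def cf2_mult_trunc2)
    also have "\<dots> \<in> idealc a b"
      using Mc mon_quot_conv[OF wc] by (intro csub_sum[OF csub_idealc]) (simp add: mult.commute[of _ "mon_quot _ _ _"] idealc_mult)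
    finally have "w \<in> idealc a b" .
    moreover have "a * trunc2 M u + b * trunc2 M v \<in> idealc a b" by (intro idealc_comb trunc2_conv)
    ultimately have "w + (a * trunc2 M u + b * trunc2 M v) \<in> idealc a b" by (rule idealc_add)
    then show ?thesis by (simp add: w)
  qed
  obtain L where L: "clin UNIV L" "\<And>f. (\<forall>i. L f i = 0) \<longleftrightarrow> f \<in> ideal2 a b" "range L = coords n"
    using n by (auto simp: codim_def)
  show ?thesis unfolding codim_def
  proof (intro exI[of _ L] conjI ballI)
    show "clin conv L" using L(1) by (auto simp: clin_def)
    show "(\<forall>i. L f i = 0) \<longleftrightarrow> f \<in> idealc a b" if "f \<in> conv" for f using contract[OF that] sub L(2) by auto
    \<comment> \<open>The coordinates see only the truncation, which is convergent; hence
      restriction to convergent series keeps their image.\<close>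
    have Lt: "L (trunc2 M u) = L u" for u
    proof -
      have "u - trunc2 M u = (\<Sum>j\<le>M. var_x ^ j * var_y ^ (M - j) * mon_quot M (u - trunc2 M u) j)"
        by (rule mon_quot_sum) (simp only: cf2_trunc2 if_True)
      also have "\<dots> \<in> ideal2 a b" by (rule csub_sum[OF csub_ideal2], rule ideal2_mult'[OF M]) simp
      finally have "L (u - trunc2 M u) i = 0" for i using L(2) by blast
      then show ?thesis using clin_diff[OF L(1), of u "trunc2 M u"] by auto
    qed
    show "L ` conv = coords n"
    proof (intro equalityI subsetI)
      fix c assume "c \<in> coords n"
      then obtain u where "c = L u" using L(3) by (metis rangeE)
      then show "c \<in> L ` conv" using Lt trunc2_conv by (metis image_eqI)
    qed (use L(3) in auto)
  qed
qed

section \<open>The Milnor number as a codimension\<close>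

lemma conv_ring_simps [simp]:
  "f \<oplus>\<^bsub>conv_ring\<^esub> g = f + g" "f \<otimes>\<^bsub>conv_ring\<^esub> g = f * g" "\<zero>\<^bsub>conv_ring\<^esub> = 0" "\<one>\<^bsub>conv_ring\<^esub> = 1"
  by (simp_all add: conv_ring_def)

lemma conv_0_1: "0 \<in> conv" "1 \<in> conv" "const2 c \<in> conv"
  using Pol_conv Pol_0_1 Pol.const by auto

lemma cring_conv_ring: "cring conv_ring"
proof (rule cringI)
  show "abelian_group conv_ring"
  proof (rule abelian_groupI)
    fix f assume "f \<in> carrier conv_ring"
    then show "\<exists>y\<in>carrier conv_ring. y \<oplus>\<^bsub>conv_ring\<^esub> f = \<zero>\<^bsub>conv_ring\<^esub>"
      using csub_uminus[OF csub_conv] by (intro bexI[of _ "- f"]) (auto simp: carrier_conv)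
  qed (auto simp: carrier_conv conv_add conv_0_1 algebra_simps)
  show "Group.comm_monoid conv_ring"
    by (rule comm_monoidI) (auto simp: carrier_conv conv_mult conv_0_1 algebra_simps)
qed (auto simp: algebra_simps)

lemma conv_ring_uminus:
  assumes "f \<in> conv"
  shows "\<ominus>\<^bsub>conv_ring\<^esub> f = - f"
proof -
  interpret cring conv_ring by (rule cring_conv_ring)
  show ?thesis
    by (rule minus_equality) (use assms csub_uminus[OF csub_conv assms] in \<open>auto simp: carrier_conv\<close>)
qed

lemma ideal_idealc:
  assumes "a \<in> conv" "b \<in> conv"
  shows "ideal (idealc a b) conv_ring"
proof -
  interpret cring conv_ring by (rule cring_conv_ring)
  show ?thesis
  proof (rule idealI[OF ring_axioms])
    show "subgroup (idealc a b) (add_monoid conv_ring)"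
    proof (rule add.subgroupI)
      show "idealc a b \<subseteq> carrier conv_ring" using idealc_subset[OF assms] by (simp add: carrier_conv)
      show "idealc a b \<noteq> {}" using idealc_gen by blast
      fix f assume f: "f \<in> idealc a b"
      then have fc: "f \<in> conv" using idealc_subset[OF assms] by blast
      show "\<ominus>\<^bsub>conv_ring\<^esub> f \<in> idealc a b"
        using csub_uminus[OF csub_idealc f] by (simp add: conv_ring_uminus[OF fc])
    qed (auto simp: idealc_add)
    fix f g assume "f \<in> idealc a b" "g \<in> carrier conv_ring"
    then have "g * f \<in> idealc a b" by (simp add: carrier_conv idealc_mult)
    then show "g \<otimes>\<^bsub>conv_ring\<^esub> f \<in> idealc a b" "f \<otimes>\<^bsub>conv_ring\<^esub> g \<in> idealc a b"
      by (simp_all add: mult.commute)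
  qed
qed

lemma jacobian_ideal_idealc:
  assumes "deriv_x f \<in> conv" "deriv_y f \<in> conv"
  shows "jacobian_ideal f = idealc (deriv_x f) (deriv_y f)"
proof -
  interpret cring conv_ring by (rule cring_conv_ring)
  show ?thesis unfolding jacobian_ideal_def
  proof (intro equalityI genideal_minimal ideal_idealc assms)
    show "{deriv_x f, deriv_y f} \<subseteq> idealc (deriv_x f) (deriv_y f)" using idealc_gen by auto
    show "idealc (deriv_x f) (deriv_y f) \<subseteq> Idl\<^bsub>conv_ring\<^esub> {deriv_x f, deriv_y f}"
    proof
      fix g assume "g \<in> idealc (deriv_x f) (deriv_y f)"
      then obtain u v where g: "g = deriv_x f * u + deriv_y f * v" "u \<in> conv" "v \<in> conv" by (auto simp: idealc_def)
      have S: "{deriv_x f, deriv_y f} \<subseteq> carrier conv_ring" using assms by (simp add: carrier_conv)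
      interpret I: ideal "Idl\<^bsub>conv_ring\<^esub> {deriv_x f, deriv_y f}" conv_ring by (rule genideal_ideal[OF S])
      have "deriv_x f \<in> Idl\<^bsub>conv_ring\<^esub> {deriv_x f, deriv_y f}" "deriv_y f \<in> Idl\<^bsub>conv_ring\<^esub> {deriv_x f, deriv_y f}"
        using genideal_self[OF S] by auto
      from I.I_r_closed[OF this(1), of u] I.I_r_closed[OF this(2), of v]
      show "g \<in> Idl\<^bsub>conv_ring\<^esub> {deriv_x f, deriv_y f}"
        using g I.a_closed by (simp add: carrier_conv)
    qed
  qed
qed

text \<open>Translates coordinates into the inductive notion of dimension: a flag in the quotient
  grows by one line at each step.\<close>

lemma dim_conv_quotient:
  assumes I: "ideal I conv_ring" and n: "codim conv I n"
  shows "ring.dim (conv_ring Quot I) ((\<lambda>c. I +>\<^bsub>conv_ring\<^esub> const2 c) ` UNIV) (carrier (conv_ring Quot I)) = n"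
proof -
  interpret R: cring conv_ring by (rule cring_conv_ring)
  interpret I: ideal I conv_ring by (rule I)
  interpret h: ring_hom_ring conv_ring "conv_ring Quot I" "(+>\<^bsub>conv_ring\<^esub>) I" by (rule I.rcos_ring_hom_ring)
  let ?Q = "conv_ring Quot I" let ?h = "(+>\<^bsub>conv_ring\<^esub>) I"
  define K where "K = ?h ` range const2"
  have K: "(\<lambda>c. I +>\<^bsub>conv_ring\<^esub> const2 c) ` UNIV = K" by (auto simp: K_def)
  obtain L where L: "clin conv L" "\<And>f. f \<in> conv \<Longrightarrow> (\<forall>i. L f i = 0) \<longleftrightarrow> f \<in> I" "L ` conv = coords n"
    using n by (auto simp: codim_def)
  have Ln: "L v k = 0" if "v \<in> conv" "k \<ge> n" for v k
    using that L(3) by (auto simp: coords_def image_def set_eq_iff)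
  obtain e where e: "\<And>i. i < n \<Longrightarrow> e i \<in> conv" "\<And>i. i < n \<Longrightarrow> L (e i) = (\<lambda>k. if k = i then 1 else 0)"
    using codim_basis[OF L(3)] by blast
  have carr: "carrier ?Q = ?h ` conv" by (auto simp: FactRing_def A_RCOSETS_def' carrier_conv)
  have eq_iff: "?h f = ?h g \<longleftrightarrow> (\<forall>i. L f i = L g i)" if "f \<in> conv" "g \<in> conv" for f g
  proof -
    have m: "f \<ominus>\<^bsub>conv_ring\<^esub> g = f - g"
      by (simp add: a_minus_def conv_ring_uminus[OF that(2)])
    have "?h f = ?h g \<longleftrightarrow> f \<ominus>\<^bsub>conv_ring\<^esub> g \<in> I"
      using R.quotient_eq_iff_same_a_r_cos[OF I] that by (simp add: carrier_conv)
    also have "\<dots> \<longleftrightarrow> (\<forall>i. L (f - g) i = 0)" unfolding m using L(2)[of "f - g"] conv_diff[OF that] by simp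
    finally show ?thesis using clin_diff[OF L(1) csub_conv that] by simp
  qed
  have hadd: "?h f \<oplus>\<^bsub>?Q\<^esub> ?h g = ?h (f + g)" if "f \<in> conv" "g \<in> conv" for f g
    using h.hom_add[of f g] that by (simp add: carrier_conv)
  have hmult: "?h f \<otimes>\<^bsub>?Q\<^esub> ?h g = ?h (f * g)" if "f \<in> conv" "g \<in> conv" for f g
    using h.hom_mult[of f g] that by (simp add: carrier_conv)
  \<comment> \<open>The flag: classes whose coordinates vanish from \<open>j\<close> on.
    \<open>E 0\<close> is zero, \<open>E n\<close> is everything, and the class of
    \<open>e j\<close> spans the step.\<close>
  define E where "E j = ?h ` {f \<in> conv. \<forall>i\<ge>j. L f i = 0}" for j
  have En: "E n = carrier ?Q" unfolding E_def carr using Ln by auto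
  have E0: "E 0 = {\<zero>\<^bsub>?Q\<^esub>}"
  proof -
    have "{f \<in> conv. \<forall>i\<ge>0. L f i = 0} = I" using L(2) I.a_subset by (auto simp: carrier_conv)
    moreover have "?h f = ?h 0" if "f \<in> I" for f
      using that I.a_subset eq_iff[of f 0] L(2)[of f] clin_0[OF L(1) conv_0_1(1)] conv_0_1(1)
      by (auto simp: carrier_conv)
    moreover have "?h 0 = \<zero>\<^bsub>?Q\<^esub>" using h.hom_zero by simp
    moreover have "0 \<in> I" using I.zero_closed by simp
    ultimately show ?thesis unfolding E_def by auto
  qed
  have dimj: "h.S.dimension j K (E j)" if "j \<le> n" for j
    using that
  proof (induction j)
    case 0
    show ?case unfolding E0 by (rule h.S.dimension.zero_dim)
  next
    case (Suc j)
    have ej: "e j \<in> conv" "L (e j) = (\<lambda>k. if k = j then 1 else 0)" using e Suc.prems by auto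
    have "E (Suc j) = h.S.line_extension K (?h (e j)) (E j)"
    proof (intro equalityI subsetI)
      fix u assume "u \<in> E (Suc j)"
      then obtain f where f: "u = ?h f" "f \<in> conv" "\<forall>i\<ge>Suc j. L f i = 0" by (auto simp: E_def)
      define g where "g = f - const2 (L f j) * e j"
      have ce: "const2 (L f j) * e j \<in> conv" by (intro conv_mult conv_0_1 ej)
      have g: "g \<in> conv" unfolding g_def by (intro conv_diff f ce)
      have "L g i = 0" if "i \<ge> j" for i
        using f(3) that clin_diff[OF L(1) csub_conv f(2) ce] clin_scale[OF L(1) ej(1)]
        by (cases "i = j") (auto simp: g_def ej(2))
      then have "?h g \<in> E j" using g by (auto simp: E_def)
      moreover have "u = ?h (const2 (L f j)) \<otimes>\<^bsub>?Q\<^esub> ?h (e j) \<oplus>\<^bsub>?Q\<^esub> ?h g"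
        using hmult[OF conv_0_1(3) ej(1)] hadd[OF ce g] f(1) by (simp add: g_def)
      ultimately show "u \<in> h.S.line_extension K (?h (e j)) (E j)"
        unfolding h.S.line_extension_mem_iff K_def by blast
    next
      fix u assume "u \<in> h.S.line_extension K (?h (e j)) (E j)"
      then obtain c v where cv: "v \<in> E j" "u = ?h (const2 c) \<otimes>\<^bsub>?Q\<^esub> ?h (e j) \<oplus>\<^bsub>?Q\<^esub> v"
        unfolding h.S.line_extension_mem_iff K_def by blast
      obtain g where g: "v = ?h g" "g \<in> conv" "\<forall>i\<ge>j. L g i = 0" using cv(1) by (auto simp: E_def)
      have ce: "const2 c * e j \<in> conv" by (intro conv_mult conv_0_1 ej)
      have "u = ?h (const2 c * e j + g)"
        using cv(2) g hmult[OF conv_0_1(3) ej(1)] hadd[OF ce g(2)] by simp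
      moreover have "L (const2 c * e j + g) i = 0" if "i \<ge> Suc j" for i
        using that g(3) clin_add[OF L(1) ce g(2)] clin_scale[OF L(1) ej(1)] by (auto simp: ej(2))
      ultimately show "u \<in> E (Suc j)" using conv_add[OF ce g(2)] unfolding E_def by blast
    qed
    moreover have "?h (e j) \<notin> E j"
    proof
      assume "?h (e j) \<in> E j"
      then obtain f where f: "?h (e j) = ?h f" "f \<in> conv" "\<forall>i\<ge>j. L f i = 0" by (auto simp: E_def)
      then have "L (e j) j = L f j" using eq_iff[OF ej(1) f(2)] by blast
      then show False using f(3) ej(2) by simp
    qed
    moreover have "?h (e j) \<in> carrier ?Q" using ej(1) by (auto simp: carr)
    ultimately show ?case using h.S.dimension.Suc_dim[of "?h (e j)" "E j" j K] Suc by simp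
  qed
  have dimn: "h.S.dimension n K (carrier ?Q)" using dimj[of n] En by simp
  show ?thesis unfolding K
  proof (cases "n = 0")
    \<comment> \<open>The quotient is the zero ring and the image of the constants is no field, so
      uniqueness of dimension is shown by hand: a further line would need a vector outside a
      subspace that already contains zero.\<close>
    case True
    have triv: "carrier ?Q = {\<zero>\<^bsub>?Q\<^esub>}" using En E0 True by simp
    have zero: "\<zero>\<^bsub>?Q\<^esub> \<in> F" if "h.S.dimension m K' F" "\<zero>\<^bsub>?Q\<^esub> \<in> K'" for m F K'
      using that
    proof (induction rule: h.S.dimension.induct)
      case (Suc_dim v F m K')
      then have "\<zero>\<^bsub>?Q\<^esub> = \<zero>\<^bsub>?Q\<^esub> \<otimes>\<^bsub>?Q\<^esub> v \<oplus>\<^bsub>?Q\<^esub> \<zero>\<^bsub>?Q\<^esub>" by simp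
      then show ?case unfolding h.S.line_extension_mem_iff using Suc_dim by blast
    qed auto
    have zK: "\<zero>\<^bsub>?Q\<^esub> \<in> K" using h.hom_zero unfolding K_def by (metis const2_simps(1) conv_ring_simps(3) image_eqI rangeI)
    have "m = 0" if m: "h.S.dimension m K (carrier ?Q)" for m
    proof (rule ccontr)
      assume "m \<noteq> 0"
      with m obtain v F k where v: "v \<in> carrier ?Q" "v \<notin> F" "h.S.dimension k K F"
        by (cases rule: h.S.dimension.cases) auto
      have "v = \<zero>\<^bsub>?Q\<^esub>" using v(1) unfolding triv by simp
      then show False using zero[OF v(3) zK] v(2) by simp
    qed
    then show "h.S.dim K (carrier ?Q) = n" unfolding h.S.dim_def using dimn True by (intro the_equality) auto
  next
    case False
    have one: "\<one>\<^bsub>?Q\<^esub> \<noteq> \<zero>\<^bsub>?Q\<^esub>"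
    proof
      assume 1: "\<one>\<^bsub>?Q\<^esub> = \<zero>\<^bsub>?Q\<^esub>"
      have e0: "e 0 \<in> conv" using e(1) False by simp
      have "?h (e 0) = ?h 1 \<otimes>\<^bsub>?Q\<^esub> ?h (e 0)" using hmult[OF conv_0_1(2) e0] by simp
      also have "?h 1 = \<zero>\<^bsub>?Q\<^esub>" using h.hom_one 1 by simp
      also have "\<zero>\<^bsub>?Q\<^esub> \<otimes>\<^bsub>?Q\<^esub> ?h (e 0) = \<zero>\<^bsub>?Q\<^esub>" using e0 by (intro h.S.l_null) (simp add: carr)
      also have "\<zero>\<^bsub>?Q\<^esub> = ?h 0" using h.hom_zero by simp
      finally have "?h (e 0) = ?h 0" .
      then have "L (e 0) 0 = L 0 0" using eq_iff[OF e0 conv_0_1(1)] by simp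
      then show False using e(2)[of 0] False clin_0[OF L(1) conv_0_1(1)] by simp
    qed
    have "subfield (range const2) conv_ring"
    proof (rule R.subfieldI)
      show "subcring (range const2) conv_ring"
      proof (intro R.subcringI' R.subringI)
        show "range const2 \<subseteq> carrier conv_ring" using conv_0_1 by (auto simp: carrier_conv)
        show "\<one>\<^bsub>conv_ring\<^esub> \<in> range const2" using const2_simps(2) by (metis conv_ring_simps(4) rangeI)
        show "\<ominus>\<^bsub>conv_ring\<^esub> f \<in> range const2" if "f \<in> range const2" for f
          using that by (auto simp: conv_ring_uminus[OF conv_0_1(3)] simp flip: const2_simps(5))
        show "f \<otimes>\<^bsub>conv_ring\<^esub> g \<in> range const2" if "f \<in> range const2" "g \<in> range const2" for f g
          using that by (auto simp flip: const2_simps(4))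
        show "f \<oplus>\<^bsub>conv_ring\<^esub> g \<in> range const2" if "f \<in> range const2" "g \<in> range const2" for f g
          using that by (auto simp flip: const2_simps(3))
      qed
      have inv: "c \<noteq> 0 \<Longrightarrow> const2 c * const2 (1 / c) = 1" for c by (simp flip: const2_simps(4))
      show "Units (conv_ring\<lparr>carrier := range const2\<rparr>) = range const2 - {\<zero>\<^bsub>conv_ring\<^esub>}"
      proof (intro equalityI subsetI)
        fix f assume "f \<in> range const2 - {\<zero>\<^bsub>conv_ring\<^esub>}"
        then obtain c where c: "f = const2 c" and "f \<noteq> 0" by auto
        then have "c \<noteq> 0" by auto
        with c show "f \<in> Units (conv_ring\<lparr>carrier := range const2\<rparr>)"
          using inv[of c] by (auto simp: Units_def mult.commute intro!: exI[of _ "1 / c"])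
      qed (auto simp: Units_def)
    qed
    then have "subfield K ?Q" unfolding K_def by (rule h.img_is_subfield(2)[OF _ one])
    then have "(h.S.dim over K) (carrier ?Q) = n" using dimn by (rule h.S.dimI)
    then show "h.S.dim K (carrier ?Q) = n" by (simp add: over_def)
  qed
qed

theorem milnor_germ_codim:
  assumes "f \<in> Pol" and n: "codim UNIV (ideal2 (deriv_x f) (deriv_y f)) n"
  shows "milnor_germ f = n"
proof -
  have c: "deriv_x f \<in> conv" "deriv_y f \<in> conv" using assms(1) Pol_deriv Pol_conv by auto
  show ?thesis unfolding milnor_germ_def milnor_algebra_def jacobian_ideal_idealc[OF c]
    by (rule dim_conv_quotient[OF ideal_idealc[OF c] codim_conv[OF c n]])
qed

section \<open>Reduced curves have isolated singularities\<close>

definition pd :: "3 \<Rightarrow> poly3 \<Rightarrow> poly3" where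
  "pd i = (if i = 1 then partial_X else if i = 2 then partial_Y else partial_Z)"

definition vars :: "poly3 ^ 3" where
  "vars = vector [X3, Y3, Z3]"

lemma eval3_vars: "rhom e \<Longrightarrow> eval3 e (vars $ i) a = a $ i"
  using exhaust_3[of i] by (auto simp: vars_def eval3_simps vector_3)

lemma pd_mult: "pd i (F * G) = F * pd i G + G * pd i F"
  by (simp add: pd_def partials_mult)

lemma hderiv_pd: "hderiv id (pd i)"
  by (simp add: pd_def hderiv_partial)

lemma pd_C3: "pd i (C3 c) = 0"
  by (simp add: pd_def partial_simps)

lemma pd_vars: "pd i (vars $ j) = (if i = j then 1 else 0)"
  using exhaust_3[of i] exhaust_3[of j] by (auto simp: pd_def vars_def partial_simps vector_3)

lemma homogeneous_pd: "homogeneous d F \<Longrightarrow> homogeneous (d - 1) (pd i F)"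
  using homogeneous_partial[of d F] by (simp add: pd_def)

lemma eval3_chain_sum:
  assumes "rhom e" "hderiv id D" "\<And>c. D (e c) = 0"
  shows "D (eval3 e F a) = (\<Sum>i\<in>UNIV. eval3 e (pd i F) a * D (a $ i))"
  using eval3_chain[OF assms] by (simp add: sum_3 pd_def)

lemma eval3_euler:
  assumes e: "rhom e" and F: "homogeneous d F"
  shows "(\<Sum>i\<in>UNIV. a $ i * eval3 e (pd i F) a) = of_nat d * eval3 e F a"
proof -
  interpret rhom "\<lambda>F. eval3 e F a" by (rule rhom_eval3[OF e])
  have "eval3 e (X3 * partial_X F + Y3 * partial_Y F + Z3 * partial_Z F) a = eval3 e (of_nat d * F) a"
    by (simp only: euler[OF F])
  then show ?thesis by (simp add: sum_3 pd_def eval3_simps[OF e])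
qed

lemma rhom_C3: "rhom C3"
  by unfold_locales (auto simp: C3_def one_pCons)

lemma rhom_fps_const: "rhom (fps_const :: complex \<Rightarrow> complex fps)"
  by unfold_locales auto

text \<open>Over the complex numbers the equation splits into linear factors, and one of them must
  vanish in the domain of power series.\<close>

lemma algebraic_constant:
  fixes \<rho> :: "complex fps"
  assumes "P \<noteq> 0" "ev fps_const \<rho> P = 0"
  shows "\<rho> = fps_const (fps_nth \<rho> 0)"
  using assms
proof (induction "degree P" arbitrary: P)
  case 0
  then obtain c where "P = [:c:]" by (metis degree_eq_zeroE)
  then show ?case using 0 rhom.ev_pCons[OF rhom_fps_const] rhom.ev_0[OF rhom_fps_const] by auto
next
  case (Suc n)
  interpret e: rhom "ev fps_const \<rho>" by (rule rhom_evI[OF rhom_fps_const])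
  have "\<not> constant (poly P)" using Suc.hyps(2) by (simp add: constant_degree)
  then obtain r where "poly P r = 0" using fundamental_theorem_of_algebra by blast
  then obtain P' where P': "P = [:- r, 1:] * P'" by (metis poly_eq_0_iff_dvd dvdE)
  have lin: "ev fps_const \<rho> [:- r, 1:] = \<rho> - fps_const r"
    by (simp add: rhom.ev_pCons[OF rhom_fps_const] rhom.ev_0[OF rhom_fps_const])
  have "ev fps_const \<rho> [:- r, 1:] * ev fps_const \<rho> P' = 0" using Suc.prems(2) unfolding P' e.mult .
  then have "\<rho> = fps_const r \<or> ev fps_const \<rho> P' = 0" unfolding lin by auto
  moreover have "P' \<noteq> 0" using Suc.prems(1) P' by auto
  moreover have "degree P = Suc (degree P')" unfolding P' using \<open>P' \<noteq> 0\<close> by (subst degree_mult_eq) auto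
  then have "n = degree P'" using Suc.hyps(2) by simp
  ultimately show ?case using Suc.hyps(1)[of P'] by auto
qed

text \<open>Eliminating \<open>Z\<close> from \<open>F\<close> and its \<open>Z\<close>-derivative
  leaves a nonzero \<open>D(X, Y)\<close> that vanishes on the cone over the arc. At a suitable
  first coordinate \<open>s\<close> it is a nonzero equation with constant coefficients for the
  second coordinate.\<close>

lemma singular_arc_constant_2:
  fixes \<Gamma> :: "complex fps ^ 3"
  assumes F: "squarefree F" and \<Gamma>1: "\<Gamma> $ 1 = 1"
    and "\<And>s. eval3 fps_const F (fps_const s *s \<Gamma>) = 0" "\<And>s. eval3 fps_const (partial_Z F) (fps_const s *s \<Gamma>) = 0"
  shows "\<Gamma> $ 2 = fps_const (fps_nth (\<Gamma> $ 2) 0)"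
proof -
  obtain \<alpha> \<beta> D where D: "D \<noteq> 0" "\<alpha> * F + \<beta> * pderiv F = [:D:]"
    using elimination_squarefree[OF F squarefree_poly3_nonzero[OF F]] by blast
  have "Polynomial.lead_coeff D \<noteq> 0" using D(1) by simp
  then obtain j where j: "pc D j \<noteq> 0" by blast
  \<comment> \<open>The factor \<open>[:0, 1:]\<close> forces \<open>s \<noteq> 0\<close>. The cone
    supplies the freedom to choose \<open>s\<close>, since \<open>D\<close> might vanish identically
    on the chart \<open>X = 1\<close>.\<close>
  have "\<exists>s. poly ([:0, 1:] * pc D j) s \<noteq> 0"
    using j poly_all_0_iff_0[of "[:0, 1:] * pc D j"] by (metis mult_eq_0_iff pCons_eq_0_iff one_neq_zero)
  then obtain s where s: "s \<noteq> 0" "poly (pc D j) s \<noteq> 0" by auto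
  define z where "z = fps_const s * \<Gamma> $ 2"
  note fc_pCons = rhom.ev_pCons[OF rhom_fps_const] and fc_0 = rhom.ev_0[OF rhom_fps_const]
  interpret h: rhom "\<lambda>F. eval3 fps_const F (fps_const s *s \<Gamma>)" by (rule rhom_eval3[OF rhom_fps_const])
  interpret e1: rhom "ev fps_const (fps_const s)" by (rule rhom_evI[OF rhom_fps_const])
  interpret e2: rhom "ev (ev fps_const (fps_const s)) z" by (intro rhom_evI rhom_fps_const)
  interpret ps: rhom "\<lambda>q. poly q s" by unfold_locales auto
  have "eval3 fps_const [:D:] (fps_const s *s \<Gamma>) = 0"
    unfolding D(2)[symmetric] h.add h.mult using assms(3,4)[of s] by (simp add: partial_Z_def)
  then have "ev (ev fps_const (fps_const s)) z D = 0"
    by (simp add: eval3_ev \<Gamma>1 z_def[symmetric] e2.ev_pCons e2.ev_0)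
  moreover have "ev (ev fps_const (fps_const s)) z D = ev fps_const z (map_poly (\<lambda>q. poly q s) D)"
  proof -
    have 1: "ev fps_const (fps_const s) q = fps_const (poly q s)" for q
      by (induction q) (simp_all add: fc_pCons fc_0)
    show ?thesis
    proof (induction D)
      case (pCons a D)
      then show ?case by (simp add: e1.ev_pCons fc_pCons fc_0 map_poly_pCons 1[of a])
    qed (simp add: e1.ev_0 fc_0)
  qed
  ultimately have "ev fps_const z (map_poly (\<lambda>q. poly q s) D) = 0" by simp
  moreover have "map_poly (\<lambda>q. poly q s) D \<noteq> 0"
  proof
    assume "map_poly (\<lambda>q. poly q s) D = 0"
    then have "pc (map_poly (\<lambda>q. poly q s) D) j = 0" by simp
    then show False using s(2) by (simp add: coeff_map_poly)
  qed
  ultimately have "z = fps_const (fps_nth z 0)" by (intro algebraic_constant)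
  then have "fps_const (1 / s) * z = fps_const (1 / s) * fps_const (fps_nth z 0)" by simp
  moreover have "fps_const (1 / s) * z = \<Gamma> $ 2" using s(1) by (simp add: z_def mult.assoc[symmetric])
  moreover have "fps_nth z 0 = s * fps_nth (\<Gamma> $ 2) 0" by (simp add: z_def)
  ultimately show ?thesis using s(1) by simp
qed

definition permute_vars :: "(3 \<Rightarrow> 3) \<Rightarrow> poly3 \<Rightarrow> poly3" where
  "permute_vars \<pi> F = eval3 C3 F (\<chi> i. vars $ \<pi> i)"

lemma rhom_permute_vars: "rhom (permute_vars \<pi>)"
  unfolding permute_vars_def[abs_def] by (rule rhom_eval3[OF rhom_C3])

lemma eval3_permute_vars:
  assumes "rhom e"
  shows "eval3 e (permute_vars \<pi> F) a = eval3 e F (\<chi> i. a $ \<pi> i)"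
proof -
  have "eval3 e (permute_vars \<pi> F) a = eval3 (\<lambda>c. eval3 e (C3 c) a) F (\<chi> i. eval3 e (vars $ \<pi> i) a)"
    unfolding permute_vars_def using rhom_eval3_push[OF rhom_eval3[OF assms] rhom_C3] by simp
  then show ?thesis by (simp add: eval3_vars[OF assms] eval3_simps(1)[OF assms])
qed

lemma permute_vars_id: "permute_vars (\<lambda>i. i) F = F"
proof (rule rhom_poly3_eqI[of "permute_vars (\<lambda>i. i)" "\<lambda>F. F"])
qed (auto simp: rhom_permute_vars permute_vars_def eval3_simps[OF rhom_C3] vars_def vector_3)

lemma permute_vars_comp: "permute_vars \<pi> (permute_vars \<tau> F) = permute_vars (\<lambda>i. \<pi> (\<tau> i)) F"
  unfolding permute_vars_def[of \<pi>] eval3_permute_vars[OF rhom_C3] by (simp add: permute_vars_def)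

lemma squarefree_permute_vars:
  assumes "bij \<pi>" "squarefree F"
  shows "squarefree (permute_vars \<pi> F)"
  unfolding squarefree_def
proof (intro allI impI)
  fix x assume x: "x\<^sup>2 dvd permute_vars \<pi> F"
  interpret i: rhom "permute_vars (inv_into UNIV \<pi>)" by (rule rhom_permute_vars)
  interpret p: rhom "permute_vars \<pi>" by (rule rhom_permute_vars)
  have inv: "inv_into UNIV \<pi> (\<pi> i) = i" "\<pi> (inv_into UNIV \<pi> i) = i" for i
    using assms(1) by (simp_all add: bij_is_inj bij_is_surj surj_f_inv_f)
  have "(permute_vars (inv_into UNIV \<pi>) x)\<^sup>2 dvd F"
    using i.dvd[OF x] by (simp add: permute_vars_comp inv permute_vars_id)
  then have "permute_vars (inv_into UNIV \<pi>) x dvd 1" using assms(2) by (simp add: squarefree_def)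
  then show "x dvd 1" using p.dvd[of "permute_vars (inv_into UNIV \<pi>) x" 1] by (simp add: permute_vars_comp inv permute_vars_id)
qed

text \<open>A permutation moves index \<open>k\<close> to the first variable and \<open>i\<close> to
  the second, so that the remaining one is eliminated. Hence a singular arc in any chart is
  constant.\<close>

lemma singular_arc_constant:
  fixes \<Gamma> :: "complex fps ^ 3"
  assumes F: "squarefree F" "homogeneous d F" and \<Gamma>k: "\<Gamma> $ k = 1" and ik: "i \<noteq> k"
    and F0: "eval3 fps_const F \<Gamma> = 0" and dF: "\<And>l. eval3 fps_const (pd l F) \<Gamma> = 0"
  shows "\<Gamma> $ i = fps_const (fps_nth (\<Gamma> $ i) 0)"
proof -
  define \<pi> :: "3 \<Rightarrow> 3" where "\<pi> l = (if l = k then 1 else if l = i then 2 else 3)" for l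
  have "inj \<pi>"
  proof (rule injI)
    fix a b assume "\<pi> a = \<pi> b"
    then show "a = b" using ik exhaust_3[of a] exhaust_3[of b] exhaust_3[of k] exhaust_3[of i]
      by (auto simp: \<pi>_def split: if_splits)
  qed
  then have bij: "bij \<pi>" by (simp add: bij_def finite_UNIV_inj_surj)
  then have inv: "inv_into UNIV \<pi> (\<pi> l) = l" "\<pi> (inv_into UNIV \<pi> l) = l" for l
    by (simp_all add: bij_is_inj bij_is_surj surj_f_inv_f)
  define \<Gamma>' where "\<Gamma>' = (\<chi> l. \<Gamma> $ inv_into UNIV \<pi> l)"
  have unperm: "(\<chi> l. (fps_const s *s \<Gamma>') $ \<pi> l) = fps_const s *s \<Gamma>" for s
    by (simp add: vec_eq_iff \<Gamma>'_def inv)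
  have "inv_into UNIV \<pi> 1 = k" "inv_into UNIV \<pi> 2 = i" using inv(1)[of k] inv(1)[of i] ik by (simp_all add: \<pi>_def)
  then have \<Gamma>': "\<Gamma>' $ 1 = 1" "\<Gamma>' $ 2 = \<Gamma> $ i" using \<Gamma>k by (simp_all add: \<Gamma>'_def)
  have s0: "eval3 fps_const F (fps_const s *s \<Gamma>) = 0" "eval3 fps_const (pd l F) (fps_const s *s \<Gamma>) = 0" for s l
    using eval3_scale[OF rhom_fps_const F(2)] eval3_scale[OF rhom_fps_const homogeneous_pd[OF F(2)]] F0 dF by simp_all
  have "partial_Z (permute_vars \<pi> F) = pd 3 (permute_vars \<pi> F)" by (simp add: pd_def)
  also have "\<dots> = (\<Sum>l\<in>UNIV. permute_vars \<pi> (pd l F) * pd 3 (vars $ \<pi> l))"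
    unfolding permute_vars_def using eval3_chain_sum[OF rhom_C3 hderiv_pd pd_C3] by simp
  finally have "eval3 fps_const (partial_Z (permute_vars \<pi> F)) v =
      (\<Sum>l\<in>UNIV. eval3 fps_const (pd l F) (\<chi> i. v $ \<pi> i) * eval3 fps_const (pd 3 (vars $ \<pi> l)) v)" for v
    by (simp add: rhom.sum[OF rhom_eval3[OF rhom_fps_const]] rhom.mult[OF rhom_eval3[OF rhom_fps_const]]
        eval3_permute_vars[OF rhom_fps_const])
  then have "eval3 fps_const (partial_Z (permute_vars \<pi> F)) (fps_const s *s \<Gamma>') = 0" for s
    by (simp add: unperm s0 del: vector_smult_component)
  moreover have "eval3 fps_const (permute_vars \<pi> F) (fps_const s *s \<Gamma>') = 0" for s
    by (simp add: eval3_permute_vars[OF rhom_fps_const] unperm s0 del: vector_smult_component)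
  ultimately show ?thesis
    using singular_arc_constant_2[OF squarefree_permute_vars[OF bij F(1)] \<Gamma>'(1)] \<Gamma>'(2) by simp
qed

section \<open>Parametrizing a smooth conic\<close>

lemma pd_add: "pd i (F + G) = pd i F + pd i G"
  using hderiv_pd[of i] by (simp add: hderiv_def)

lemma pd_X3: "pd i X3 = (if i = 1 then 1 else 0)" "pd i Y3 = (if i = 2 then 1 else 0)" "pd i Z3 = (if i = 3 then 1 else 0)"
  using pd_vars[of i 1] pd_vars[of i 2] pd_vars[of i 3] by (simp_all add: vars_def vector_3)

lemma cf_C3_mult: "cf (C3 a * F) i j k = a * cf F i j k"
  by (simp add: C3_def)

lemma cf_vars:
  "cf X3 i j k = (if i = 1 \<and> j = 0 \<and> k = 0 then 1 else 0)"
  "cf Y3 i j k = (if i = 0 \<and> j = 1 \<and> k = 0 then 1 else 0)"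
  "cf Z3 i j k = (if i = 0 \<and> j = 0 \<and> k = 1 then 1 else 0)"
  by (auto simp: X3_def Y3_def Z3_def coeff_pCons one_pCons split: nat.splits)

lemma quadratic_form:
  assumes "homogeneous 2 Q"
  shows "\<exists>a b c d e g. Q = C3 a * (X3 * X3) + C3 b * (X3 * Y3) + C3 c * (Y3 * Y3)
    + C3 d * (X3 * Z3) + C3 e * (Y3 * Z3) + C3 g * (Z3 * Z3)"
proof -
  have "Q = C3 (cf Q 2 0 0) * (X3 * X3) + C3 (cf Q 1 1 0) * (X3 * Y3) + C3 (cf Q 0 2 0) * (Y3 * Y3)
    + C3 (cf Q 1 0 1) * (X3 * Z3) + C3 (cf Q 0 1 1) * (Y3 * Z3) + C3 (cf Q 0 0 2) * (Z3 * Z3)"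
  proof (intro poly_eqI)
    fix i j k
    have m: "cf (X3 * X3) i j k = (if i = 2 \<and> j = 0 \<and> k = 0 then 1 else 0)"
      "cf (X3 * Y3) i j k = (if i = 1 \<and> j = 1 \<and> k = 0 then 1 else 0)"
      "cf (Y3 * Y3) i j k = (if i = 0 \<and> j = 2 \<and> k = 0 then 1 else 0)"
      "cf (X3 * Z3) i j k = (if i = 1 \<and> j = 0 \<and> k = 1 then 1 else 0)"
      "cf (Y3 * Z3) i j k = (if i = 0 \<and> j = 1 \<and> k = 1 then 1 else 0)"
      "cf (Z3 * Z3) i j k = (if i = 0 \<and> j = 0 \<and> k = 2 then 1 else 0)"
      unfolding cf_var_mult cf_vars by (auto split: nat.splits)
    have "cf Q i j k = 0 \<or> (i = 2 \<and> j = 0 \<and> k = 0) \<or> (i = 1 \<and> j = 1 \<and> k = 0) \<or> (i = 0 \<and> j = 2 \<and> k = 0)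
      \<or> (i = 1 \<and> j = 0 \<and> k = 1) \<or> (i = 0 \<and> j = 1 \<and> k = 1) \<or> (i = 0 \<and> j = 0 \<and> k = 2)"
    proof (cases "cf Q i j k = 0")
      case False
      then have "i + j + k = 2" using assms by (simp add: homogeneous_def)
      then have "(i = 2 \<and> j = 0 \<and> k = 0) \<or> (i = 1 \<and> j = 1 \<and> k = 0) \<or> (i = 0 \<and> j = 2 \<and> k = 0)
        \<or> (i = 1 \<and> j = 0 \<and> k = 1) \<or> (i = 0 \<and> j = 1 \<and> k = 1) \<or> (i = 0 \<and> j = 0 \<and> k = 2)" by presburger
      then show ?thesis by blast
    qed simp
    then show "cf Q i j k = cf (C3 (cf Q 2 0 0) * (X3 * X3) + C3 (cf Q 1 1 0) * (X3 * Y3) + C3 (cf Q 0 2 0) * (Y3 * Y3)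
      + C3 (cf Q 1 0 1) * (X3 * Z3) + C3 (cf Q 0 1 1) * (Y3 * Z3) + C3 (cf Q 0 0 2) * (Z3 * Z3)) i j k"
      unfolding coeff_add cf_C3_mult m by auto
  qed
  then show ?thesis by blast
qed

text \<open>For a quadratic form, the symmetric bilinear form
  \<open>Q(x + y) - Q(x) - Q(y)\<close>.\<close>

definition polar :: "poly3 \<Rightarrow> complex ^ 3 \<Rightarrow> complex ^ 3 \<Rightarrow> complex" where
  "polar Q x y = (\<Sum>i\<in>UNIV. eval3 id (pd i Q) x * y $ i)"

lemma polar_linear:
  "polar Q x (y + z) = polar Q x y + polar Q x z" "polar Q x (s *s y) = s * polar Q x y"
  by (simp_all add: polar_def algebra_simps sum.distrib sum_distrib_left)

lemma quadratic_polar: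
  assumes "homogeneous 2 Q"
  shows "eval3 id Q (x + y) = eval3 id Q x + eval3 id Q y + polar Q x y"
    "eval3 id Q (s *s x) = s\<^sup>2 * eval3 id Q x" "polar Q x y = polar Q y x" "polar Q x x = 2 * eval3 id Q x"
proof -
  obtain a b c d e g where Q: "Q = C3 a * (X3 * X3) + C3 b * (X3 * Y3) + C3 c * (Y3 * Y3)
    + C3 d * (X3 * Z3) + C3 e * (Y3 * Z3) + C3 g * (Z3 * Z3)" using quadratic_form[OF assms] by blast
  interpret h: rhom "\<lambda>F. eval3 id F v" for v :: "complex ^ 3" by (rule eval3_id_hom)
  note simps = eval3_simps[OF rhom_id(1)]
  have q: "eval3 id Q v = a * (v $ 1 * v $ 1) + b * (v $ 1 * v $ 2) + c * (v $ 2 * v $ 2)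
    + d * (v $ 1 * v $ 3) + e * (v $ 2 * v $ 3) + g * (v $ 3 * v $ 3)" for v
    unfolding Q by (simp add: simps)
  have two: "eval3 id 2 v = 2" for v by (metis h.add h.one one_add_one)
  have p: "eval3 id (pd 1 Q) v = 2 * a * v $ 1 + b * v $ 2 + d * v $ 3"
    "eval3 id (pd 2 Q) v = b * v $ 1 + 2 * c * v $ 2 + e * v $ 3"
    "eval3 id (pd 3 Q) v = d * v $ 1 + e * v $ 2 + 2 * g * v $ 3" for v
    unfolding Q by (simp_all add: pd_add pd_mult pd_C3 pd_X3 simps two algebra_simps)
  show "eval3 id Q (x + y) = eval3 id Q x + eval3 id Q y + polar Q x y"
    by (simp add: q polar_def sum_3 p algebra_simps)
  show "eval3 id Q (s *s x) = s\<^sup>2 * eval3 id Q x" by (rule eval3_scale[OF rhom_id(1) assms])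
  show "polar Q x y = polar Q y x" by (simp add: polar_def sum_3 p algebra_simps)
  show "polar Q x x = 2 * eval3 id Q x" by (simp add: q polar_def sum_3 p algebra_simps)
qed

text \<open>Complete the isotropic \<open>u\<close> to a hyperbolic pair \<open>u, w\<close> and add
  a vector orthogonal to both. Smoothness means that the polar form has no isotropic vector in its
  radical, which supplies \<open>w\<close> and makes the third vector non-isotropic.\<close>

lemma conic_basis:
  assumes Q: "homogeneous 2 Q"
    and smooth: "\<And>v. v \<noteq> 0 \<Longrightarrow> eval3 id Q v = 0 \<Longrightarrow> \<exists>i. eval3 id (pd i Q) v \<noteq> 0"
    and u: "u \<noteq> 0" "eval3 id Q u = 0"
  shows "\<exists>v w. (\<forall>\<alpha> \<beta> \<gamma>. eval3 id Q (\<alpha> *s u + \<beta> *s v + \<gamma> *s w) = \<alpha> * \<gamma> - \<beta>\<^sup>2) \<and>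
    (\<forall>x. \<exists>\<alpha> \<beta> \<gamma>. x = \<alpha> *s u + \<beta> *s v + \<gamma> *s w) \<and>
    (\<forall>\<alpha> \<beta> \<gamma>. \<alpha> *s u + \<beta> *s v + \<gamma> *s w = 0 \<longrightarrow> \<alpha> = 0 \<and> \<beta> = 0 \<and> \<gamma> = 0)"
proof -
  define q where "q v = eval3 id Q v" for v
  define B where "B x y = polar Q x y" for x y
  note qB = quadratic_polar[OF Q, folded q_def B_def]
  note lin = polar_linear[of Q, folded B_def]
  have linl: "B (y + z) x = B y x + B z x" "B (s *s y) x = s * B y x" for x y z s
    using lin[of x] qB(3) by metis+
  obtain i where i: "eval3 id (pd i Q) u \<noteq> 0" using smooth u by blast
  define w0 where "w0 = axis i (1 / eval3 id (pd i Q) u)"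
  have "B u w0 = (\<Sum>l\<in>UNIV. if l = i then 1 else 0)"
    unfolding B_def polar_def w0_def axis_def by (intro sum.cong) (use i in auto)
  then have Buw0: "B u w0 = 1" by simp
  \<comment> \<open>As \<open>u\<close> is isotropic and pairs to 1 with \<open>w0\<close>,
    subtracting \<open>q w0\<close> times \<open>u\<close> makes the second vector isotropic
    too.\<close>
  define w where "w = w0 + (- q w0) *s u"
  have Buu: "B u u = 0" using qB(4)[of u] u(2) by (simp add: q_def)
  have Buw: "B u w = 1" unfolding w_def by (simp only: lin Buu Buw0) simp
  have qw: "q w = 0"
  proof -
    have "q w = q w0 + (q w0)\<^sup>2 * q u + B w0 ((- q w0) *s u)" unfolding w_def qB(1) qB(2) by simp
    also have "B w0 ((- q w0) *s u) = - q w0" using Buw0 qB(3)[of w0 u] by (simp only: lin) simp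
    finally show ?thesis using u(2) by (simp add: q_def)
  qed
  have Bww: "B w w = 0" using qB(4)[of w] qw by simp
  define p r where "p l = eval3 id (pd l Q) u" and "r l = eval3 id (pd l Q) w" for l
  \<comment> \<open>The cross product of the polar covectors of \<open>u\<close> and
    \<open>w\<close>, hence orthogonal to both vectors.\<close>
  define v0 :: "complex ^ 3" where "v0 = vector [p 2 * r 3 - p 3 * r 2, p 3 * r 1 - p 1 * r 3, p 1 * r 2 - p 2 * r 1]"
  have Bp: "B u x = p 1 * x $ 1 + p 2 * x $ 2 + p 3 * x $ 3" "B w x = r 1 * x $ 1 + r 2 * x $ 2 + r 3 * x $ 3" for x
    by (simp_all add: B_def polar_def sum_3 p_def r_def)
  have Buv: "B u v0 = 0" "B w v0 = 0" by (simp_all add: Bp v0_def vector_3 algebra_simps)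
  have v0: "v0 \<noteq> 0"
  proof
    assume "v0 = 0"
    then have "v0 $ 1 = 0" "v0 $ 2 = 0" "v0 $ 3 = 0" by simp_all
    then have z: "p 2 * r 3 = p 3 * r 2" "p 3 * r 1 = p 1 * r 3" "p 1 * r 2 = p 2 * r 1"
      by (simp_all add: v0_def vector_3)
    \<comment> \<open>Lagrange's identity: the Gram determinant pairs the cross product of covectors
      with that of vectors. It equals \<open>-1\<close>, so \<open>v0\<close> cannot vanish.\<close>
    have "B u u * B w w - B u w * B w u = (p 2 * r 3 - p 3 * r 2) * (u $ 2 * w $ 3 - u $ 3 * w $ 2)
      + (p 3 * r 1 - p 1 * r 3) * (u $ 3 * w $ 1 - u $ 1 * w $ 3) + (p 1 * r 2 - p 2 * r 1) * (u $ 1 * w $ 2 - u $ 2 * w $ 1)"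
      unfolding Bp by (simp add: algebra_simps)
    then show False using Buu Bww Buw qB(3)[of w u] by (simp add: z)
  qed
  have comb: "B x (\<alpha> *s u + \<beta> *s y + \<gamma> *s w) = \<alpha> * B x u + \<beta> * B x y + \<gamma> * B x w" for x y \<alpha> \<beta> \<gamma>
    by (simp add: lin)
  have indep: "\<alpha> = 0 \<and> \<beta> = 0 \<and> \<gamma> = 0"
    if "\<alpha> *s u + \<beta> *s y + \<gamma> *s w = 0" "y \<noteq> 0" "B u y = 0" "B w y = 0" for y \<alpha> \<beta> \<gamma>
  proof -
    have B0: "B x 0 = 0" for x using lin(2)[of x 0 0] by simp
    have "\<gamma> = 0" using comb[of u \<alpha> \<beta> y \<gamma>] that B0 by (simp add: Buu Buw)
    moreover have "\<alpha> = 0" using comb[of w \<alpha> \<beta> y \<gamma>] that B0 qB(3)[of w u] by (simp add: Bww Buw)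
    ultimately show ?thesis using that(1,2) by simp
  qed
  have span: "\<exists>\<alpha> \<beta> \<gamma>. x = \<alpha> *s u + \<beta> *s y + \<gamma> *s w" if "y \<noteq> 0" "B u y = 0" "B w y = 0" for x y
  proof -
    define A :: "complex ^ 3 ^ 3" where "A = transpose (vector [u, y, w])"
    have A: "A *v z = z $ 1 *s u + z $ 2 *s y + z $ 3 *s w" for z
      by (simp add: A_def matrix_vector_mult_def transpose_def vec_eq_iff sum_3 vector_3 mult.commute)
    have "\<forall>z. A *v z = 0 \<longrightarrow> z = 0"
    proof (intro allI impI)
      fix z assume "A *v z = 0"
      then have "z $ 1 = 0 \<and> z $ 2 = 0 \<and> z $ 3 = 0" using indep[OF _ that] unfolding A by blast
      then show "z = 0" by (simp add: vec_eq_iff forall_3)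
    qed
    then obtain A' where "A' ** A = mat 1" using matrix_left_invertible_ker by blast
    then have "A ** A' = mat 1" using matrix_left_right_inverse by blast
    then have "x = A *v (A' *v x)" by (simp add: matrix_vector_mul_assoc)
    then show ?thesis unfolding A by blast
  qed
  \<comment> \<open>An isotropic \<open>v0\<close> would be orthogonal to a whole basis, so all
    partial derivatives would vanish there: a singular point.\<close>
  have "q v0 \<noteq> 0"
  proof
    assume qv: "q v0 = 0"
    then obtain l where l: "eval3 id (pd l Q) v0 \<noteq> 0" using smooth v0 by (auto simp: q_def)
    obtain \<alpha> \<beta> \<gamma> where "axis l 1 = \<alpha> *s u + \<beta> *s v0 + \<gamma> *s w" using span[OF v0 Buv] by blast
    then have "B v0 (axis l 1) = 0"
      using comb[of v0 \<alpha> \<beta> v0 \<gamma>] Buv qB(3)[of v0 u] qB(3)[of v0 w] qB(4)[of v0] qv by simp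
    moreover have "B v0 (axis l 1) = (\<Sum>m\<in>UNIV. if m = l then eval3 id (pd l Q) v0 else 0)"
      unfolding B_def polar_def axis_def by (intro sum.cong) auto
    ultimately show False using l by simp
  qed
  \<comment> \<open>Normalizes \<open>v\<close> to \<open>q v = -1\<close>, which yields
    \<open>\<alpha> * \<gamma> - \<beta>\<^sup>2\<close>.\<close>
  define t where "t = 1 / csqrt (- q v0)"
  have t: "t \<noteq> 0" "t\<^sup>2 * q v0 = - 1" using \<open>q v0 \<noteq> 0\<close> by (auto simp: t_def power_divide)
  define v where "v = t *s v0"
  have v: "v \<noteq> 0" "B u v = 0" "B w v = 0" "q v = - 1"
    using v0 t Buv by (auto simp: v_def lin qB(2) vec_eq_iff)
  have "q (\<alpha> *s u + \<beta> *s v + \<gamma> *s w) = \<alpha> * \<gamma> - \<beta>\<^sup>2" for \<alpha> \<beta> \<gamma>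
  proof -
    have "q (\<alpha> *s u + \<beta> *s v + \<gamma> *s w) = \<alpha>\<^sup>2 * q u + \<beta>\<^sup>2 * q v + \<alpha> * (\<beta> * B u v) + \<gamma>\<^sup>2 * q w
      + (\<alpha> * (\<gamma> * B u w) + \<beta> * (\<gamma> * B v w))"
      by (simp only: qB(1,2) lin linl) (simp add: algebra_simps)
    then show ?thesis using v Buw u(2) qw qB(3)[of v w] by (simp add: q_def)
  qed
  then show ?thesis using span[OF v(1-3)] indep[OF _ v(1-3)] unfolding q_def
    by (intro exI[of _ v] exI[of _ w] conjI allI impI) auto
qed

section \<open>Irreducibility of a smooth conic\<close>

lemma separating_2: "separating ((\<lambda>(h, z). ev h z) ` ((\<lambda>(h, z). ev h z) ` ({id} \<times> UNIV) \<times> UNIV) :: (complex poly poly \<Rightarrow> complex) set)"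
proof -
  have "separating {id :: complex \<Rightarrow> complex}"
    unfolding separating_def by (auto simp: prime_elem_def dvd_field_iff)
  from separating_ev[OF separating_ev[OF this]] show ?thesis .
qed

lemma poly2_zeroI:
  fixes p :: "complex poly poly"
  assumes "\<And>x y. ev (ev id x) y p = 0"
  shows "p = 0"
proof (rule ccontr)
  assume "p \<noteq> 0"
  then obtain h where "h \<in> (\<lambda>(h, z). ev h z) ` ((\<lambda>(h, z). ev h z) ` ({id} \<times> UNIV) \<times> UNIV)" "h p \<noteq> 0"
    using separating_2 unfolding separating_def by blast
  then show False using assms by auto
qed

text \<open>Pull back along the parametrization \<open>x\<^sup>2 u + x y v + y\<^sup>2 w\<close>.
  Every zero of \<open>Q\<close> is in its image, so by the Nullstellensatz the kernel of the
  pullback consists of multiples of \<open>Q\<close>; the target being a domain, one factor of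
  \<open>Q\<close> must be a multiple of \<open>Q\<close>.\<close>

lemma smooth_conic_irreducible:
  assumes Q: "homogeneous 2 Q" "squarefree Q"
    and smooth: "\<And>v. v \<noteq> 0 \<Longrightarrow> eval3 id Q v = 0 \<Longrightarrow> \<exists>i. eval3 id (pd i Q) v \<noteq> 0"
    and u: "u \<noteq> 0" "eval3 id Q u = 0"
  shows "Factorial_Ring.irreducible Q"
proof -
  obtain v w where q: "\<And>\<alpha> \<beta> \<gamma>. eval3 id Q (\<alpha> *s u + \<beta> *s v + \<gamma> *s w) = \<alpha> * \<gamma> - \<beta>\<^sup>2"
    and sp: "\<And>x. \<exists>\<alpha> \<beta> \<gamma>. x = \<alpha> *s u + \<beta> *s v + \<gamma> *s w"
    using conic_basis[OF Q(1) smooth u] by blast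
  have Q0: "Q \<noteq> 0" using squarefree_poly3_nonzero[OF Q(2)] .
  define \<theta> :: "(complex poly poly) ^ 3" where
    "\<theta> = (\<chi> i. [:[:0, 0, u $ i:], [:0, v $ i:], [:w $ i:]:])"
  define \<Psi> where "\<Psi> F = eval3 (\<lambda>c. [:[:c:]:]) F \<theta>" for F
  have cc: "rhom (\<lambda>c :: complex. [:[:c:]:])" by unfold_locales (auto simp: one_pCons)
  interpret \<Psi>: rhom \<Psi> unfolding \<Psi>_def[abs_def] by (rule rhom_eval3[OF cc])
  have push: "ev (ev id x) y (\<Psi> F) = eval3 id F ((x * x) *s u + (x * y) *s v + (y * y) *s w)" for x y F
  proof -
    interpret i: rhom "id :: complex \<Rightarrow> complex" by (rule rhom_id)
    interpret e1: rhom "ev id x :: complex poly \<Rightarrow> complex" by (rule rhom_evI[OF rhom_id(1)])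
    have e: "rhom (ev (ev id x) y :: complex poly poly \<Rightarrow> complex)" by (intro rhom_evI rhom_id)
    have "ev (ev id x) y (\<Psi> F) = eval3 (\<lambda>c. ev (ev id x) y [:[:c:]:]) F (\<chi> i. ev (ev id x) y (\<theta> $ i))"
      unfolding \<Psi>_def by (rule rhom_eval3_push[OF e cc])
    also have "(\<lambda>c. ev (ev id x) y [:[:c:]:]) = id" by (auto simp: e1.ev_pCons e1.ev_0 i.ev_pCons i.ev_0)
    also have "(\<chi> i. ev (ev id x) y (\<theta> $ i)) = (x * x) *s u + (x * y) *s v + (y * y) *s w"
      by (simp add: vec_eq_iff \<theta>_def e1.ev_pCons e1.ev_0 i.ev_pCons i.ev_0 algebra_simps)
    finally show ?thesis .
  qed
  have "\<Psi> Q = 0" by (rule poly2_zeroI) (simp add: push q power2_eq_square)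
  have dvd: "Q dvd A" if "\<Psi> A = 0" for A
  proof (rule nullstellensatz[OF Q(2) Q0])
    fix x :: "complex ^ 3" assume x: "eval3 id Q x = 0"
    obtain \<alpha> \<beta> \<gamma> where abc: "x = \<alpha> *s u + \<beta> *s v + \<gamma> *s w" using sp by blast
    have eq: "\<alpha> * \<gamma> = \<beta>\<^sup>2" using x unfolding abc q by simp
    \<comment> \<open>A solution of \<open>\<alpha> * \<gamma> = \<beta>\<^sup>2\<close> comes from
      square roots; for \<open>\<alpha> = 0\<close> the parameter \<open>s\<close> is zero.\<close>
    have "\<exists>s t. s * s = \<alpha> \<and> s * t = \<beta> \<and> t * t = \<gamma>"
    proof (cases "\<alpha> = 0")
      case True
      then have "\<beta> = 0" using eq by simp
      moreover have "csqrt \<gamma> * csqrt \<gamma> = \<gamma>" by (metis power2_csqrt power2_eq_square)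
      ultimately show ?thesis using True by (intro exI[of _ 0] exI[of _ "csqrt \<gamma>"]) simp
    next
      case False
      define s where "s = csqrt \<alpha>"
      have s: "s * s = \<alpha>" unfolding s_def by (metis power2_csqrt power2_eq_square)
      then have "s \<noteq> 0" using False by auto
      moreover have "(\<beta> / s) * (\<beta> / s) = \<gamma>"
      proof -
        have "(\<beta> / s) * (\<beta> / s) = (\<alpha> * \<gamma>) / \<alpha>" by (simp add: eq power2_eq_square s)
        then show ?thesis using False by simp
      qed
      ultimately show ?thesis using s by (intro exI[of _ s] exI[of _ "\<beta> / s"]) simp
    qed
    then obtain s t where "s * s = \<alpha>" "s * t = \<beta>" "t * t = \<gamma>" by blast
    then have "eval3 id A x = ev (ev id s) t (\<Psi> A)" by (simp add: push abc)
    then show "eval3 id A x = 0"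
      using that rhom.zero[OF rhom_evI[OF rhom_evI[OF rhom_id(1)]], of s t] by simp
  qed
  show ?thesis
  proof (rule irreducibleI[OF Q0])
    show "\<not> Q dvd 1"
    proof
      assume "Q dvd 1"
      then have "eval3 id Q u dvd eval3 id 1 u" by (rule rhom.dvd[OF eval3_id_hom])
      then show False using u(2) rhom.one[OF eval3_id_hom[of u]] by simp
    qed
    fix A B assume AB: "Q = A * B"
    then have "\<Psi> A = 0 \<or> \<Psi> B = 0" using \<open>\<Psi> Q = 0\<close> \<Psi>.mult[of A B] by simp
    moreover have unit: "Y dvd 1" if QX: "Q dvd X" "Q = X * Y" for X Y
    proof -
      obtain k where "X = Q * k" using QX(1) by (rule dvdE)
      then have "Q = (Q * k) * Y" using QX(2) by simp
      then have "Q * 1 = Q * (k * Y)" by (metis mult.assoc mult_1_right)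
      then have "1 = k * Y" using Q0 by (metis mult_cancel_left)
      then show ?thesis by (metis dvd_triv_right)
    qed
    ultimately show "A dvd 1 \<or> B dvd 1" using unit[OF dvd[of A] AB] unit[of B A] dvd[of B] AB by (auto simp: mult.commute)
  qed
qed

text \<open>On the line through two coordinate points the form is a polynomial in one parameter,
  nonconstant unless the first point already lies on the conic.\<close>

lemma conic_has_point:
  assumes Q: "homogeneous 2 Q"
  shows "\<exists>u. u \<noteq> 0 \<and> eval3 id Q u = 0"
proof -
  define x :: "complex ^ 3" where "x = axis 1 1"
  define y :: "complex ^ 3" where "y = axis 2 1"
  note qB = quadratic_polar[OF Q]
  show ?thesis
  proof (cases "eval3 id Q x = 0")
    case True
    then show ?thesis by (intro exI[of _ x]) (simp add: x_def)
  next
    case False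
    define p where "p = [:eval3 id Q y, polar Q x y, eval3 id Q x:]"
    have "\<not> constant (poly p)" using False by (simp add: p_def constant_degree)
    then obtain s where s: "poly p s = 0" using fundamental_theorem_of_algebra by blast
    have pl: "polar Q (s *s x) y = s * polar Q x y" using qB(3)[of "s *s x" y] qB(3)[of x y] polar_linear(2) by simp
    have "eval3 id Q (s *s x + y) = 0" 
      unfolding qB(1) qB(2) pl using s by (simp add: p_def power2_eq_square algebra_simps)
    moreover have "(s *s x + y) $ 2 = 1" by (simp add: x_def y_def axis_def)
    then have "s *s x + y \<noteq> 0" by (metis zero_index zero_neq_one)
    ultimately show ?thesis by blast
  qed
qed

section \<open>Local intersection with a parametrized smooth germ\<close>

text \<open>As \<open>X\<close> has order one it is invertible under composition, so the arc traces
  the graph of \<open>Y\<close> composed with that inverse, and \<open>E\<close> is the graph's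
  pullback reparametrized by \<open>X\<close>.\<close>

lemma smooth_param:
  fixes X Y :: "complex fps"
  assumes X: "fps_nth X 0 = 0" "fps_nth X 1 \<noteq> 0" and Y: "fps_nth Y 0 = 0"
  shows "\<exists>E \<phi>. branch E \<and> smooth_germ (fps_X - fps_const \<phi>) E \<and> E var_x = X \<and> E var_y = Y \<and> fps_nth \<phi> 0 = 0"
proof -
  define \<phi> where "\<phi> = fps_compose Y (fps_inv X)"
  have inv0: "fps_nth (fps_inv X) 0 = 0" by (simp add: fps_inv_def)
  have \<phi>: "fps_nth \<phi> 0 = 0" using Y by (simp add: \<phi>_def)
  have X0: "X \<noteq> 0" using X(2) by auto
  have cancel: "fps_compose (fps_compose s (fps_inv X)) X = s" for s
    using fps_compose_assoc[OF X(1) inv0, of s] fps_inv[OF X] by simp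
  have g: "smooth_germ (fps_X - fps_const \<phi>) (evs \<phi>)" by (rule smooth_germ_graph[OF \<phi>])
  define E where "E f = fps_compose (evs \<phi> f) X" for f
  interpret e: rhom "evs \<phi>" using g by (simp add: smooth_germ_def)
  have E: "rhom E"
    by unfold_locales (auto simp: E_def fps_compose_add_distrib fps_compose_mult_distrib[OF X(1)])
  have Ec: "E (const2 c) = fps_const c" for c using g by (simp add: E_def smooth_germ_def)
  have "evs \<phi> var_x = fps_X" using evs_const[OF \<phi>] by (simp add: var_x_def)
  then have Ex: "E var_x = X" using X(1) by (simp add: E_def)
  have "evs \<phi> var_y = \<phi>" using evs_X_mult[OF \<phi>, of 1] by (simp add: var_y_def)
  then have Ey: "E var_y = Y" by (simp add: E_def \<phi>_def cancel)
  have "branch E" unfolding branch_def using E Ec Ex Ey X(1) Y X0 by auto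
  moreover have "smooth_germ (fps_X - fps_const \<phi>) E"
    unfolding smooth_germ_def
  proof (intro conjI allI E Ec)
    show "surj E"
    proof (rule surjI)
      fix s
      show "E (fps_const (fps_compose s (fps_inv X))) = s" by (simp add: E_def evs_const[OF \<phi>] cancel)
    qed
    show "E f = 0 \<longleftrightarrow> fps_X - fps_const \<phi> dvd f" for f
      using g X0 fps_compose_eq_0_iff[OF X(1), of "evs \<phi> f"] by (simp add: E_def smooth_germ_def)
  qed
  ultimately show ?thesis using Ex Ey \<phi> by blast
qed

text \<open>\<open>y - \<phi>\<close> divides \<open>q\<close>, and the cofactor is a unit because
  \<open>q_y\<close> does not vanish at the origin.\<close>

lemma smooth_germ_equation:
  assumes E: "smooth_germ (fps_X - fps_const \<phi>) E" and \<phi>: "fps_nth \<phi> 0 = 0" and q: "E q = 0" "cst (deriv_y q) \<noteq> 0"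
  shows "smooth_germ q E"
proof -
  define p where "p = (fps_X - fps_const \<phi> :: fps2)"
  have "p dvd q" using E q(1) by (simp add: smooth_germ_def p_def)
  then obtain u where u: "q = p * u" by (rule dvdE)
  have "deriv_y p = 1" by (simp add: p_def deriv_y_def)
  moreover have "cst p = 0" using \<phi> by (simp add: p_def cst_def)
  ultimately have "cst u \<noteq> 0" using q(2) by (simp add: u deriv_mult)
  then obtain u' where u': "u * u' = 1" using cst_unit by blast
  have "q dvd f \<longleftrightarrow> p dvd f" for f
  proof
    assume "p dvd f"
    then obtain s where "f = p * s" by (rule dvdE)
    then have "f = p * (u * u') * s" by (simp add: u')
    then have "f = q * (u' * s)" by (simp add: u mult_ac)
    then show "q dvd f" by (rule dvdI)
  qed (auto simp: u elim: dvd_mult_left)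
  then show ?thesis using E by (simp add: smooth_germ_def p_def)
qed

text \<open>The exchange of \<open>x\<close> and \<open>y\<close>, for points where the conic has a
  tangent parallel to the \<open>y\<close>-axis and \<open>q_y\<close> vanishes.\<close>

definition swap2 :: "fps2 \<Rightarrow> fps2" where
  "swap2 f = Abs_fps (\<lambda>j. Abs_fps (\<lambda>i. cf2 f j i))"

lemma cf2_swap2 [simp]: "cf2 (swap2 f) i j = cf2 f j i"
  by (simp add: swap2_def)

lemma swap2_swap2 [simp]: "swap2 (swap2 f) = f"
  by (rule cf2_eqI) simp

lemma rhom_swap2: "rhom swap2"
proof unfold_locales
  show "swap2 1 = 1" by (rule cf2_eqI) (simp add: fps_one_def)
  show "swap2 (a + b) = swap2 a + swap2 b" for a b by (rule cf2_eqI) simp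
  show "swap2 (a * b) = swap2 a * swap2 b" for a b
    by (rule cf2_eqI) (simp only: cf2_swap2 cf2_mult, rule sum.swap)
qed

lemma swap2_simps: "swap2 (const2 c) = const2 c" "swap2 var_x = var_y" "swap2 var_y = var_x" "cst (swap2 f) = cst f"
proof -
  show "swap2 (const2 c) = const2 c" by (rule cf2_eqI) (auto simp: const2_def)
  show "swap2 var_x = var_y" by (rule cf2_eqI) (auto simp: var_x_def var_y_def fps_X_def)
  show "swap2 var_y = var_x" by (rule cf2_eqI) (auto simp: var_x_def var_y_def fps_X_def)
  show "cst (swap2 f) = cst f" by (simp add: cst_def)
qed

lemma deriv_swap2: "deriv_x (swap2 f) = swap2 (deriv_y f)" "deriv_y (swap2 f) = swap2 (deriv_x f)"
proof -
  have c: "fps_nth (of_nat n * g) i = of_nat n * fps_nth g i" for n i and g :: "complex fps"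
    by (simp add: fps_of_nat[symmetric] del: fps_of_nat)
  have dx: "cf2 (deriv_x g) i j = of_nat (Suc i) * cf2 g (Suc i) j" for g i j by (simp add: deriv_x_def)
  have dy: "cf2 (deriv_y g) i j = of_nat (Suc j) * cf2 g i (Suc j)" for g i j
    by (simp only: deriv_y_def fps_deriv_nth c) simp
  show "deriv_x (swap2 f) = swap2 (deriv_y f)" by (rule cf2_eqI) (simp only: dx dy cf2_swap2)
  show "deriv_y (swap2 f) = swap2 (deriv_x f)" by (rule cf2_eqI) (simp only: dx dy cf2_swap2)
qed

lemma codim_swap2:
  assumes "codim UNIV (ideal2 (swap2 a) (swap2 b)) n"
  shows "codim UNIV (ideal2 a b) n"
proof -
  interpret rhom swap2 by (rule rhom_swap2)
  obtain L where L: "clin UNIV L" "\<And>f. (\<forall>i. L f i = 0) \<longleftrightarrow> f \<in> ideal2 (swap2 a) (swap2 b)" "range L = coords n"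
    using assms by (auto simp: codim_def)
  show ?thesis unfolding codim_def
  proof (intro exI[of _ "\<lambda>f. L (swap2 f)"] conjI ballI)
    show "clin UNIV (\<lambda>f. L (swap2 f))" using L(1) by (auto simp: clin_def swap2_simps)
    show "(\<forall>i. L (swap2 f) i = 0) \<longleftrightarrow> f \<in> ideal2 a b" for f
    proof -
      have "swap2 f \<in> ideal2 (swap2 a) (swap2 b) \<longleftrightarrow> f \<in> ideal2 a b"
      proof
        assume "swap2 f \<in> ideal2 (swap2 a) (swap2 b)"
        then obtain u v where "swap2 f = swap2 a * u + swap2 b * v" by (auto simp: ideal2_def)
        then have "swap2 (swap2 f) = swap2 (swap2 a * u + swap2 b * v)" by simp
        then have "f = a * swap2 u + b * swap2 v" by (simp only: add mult swap2_swap2)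
        then show "f \<in> ideal2 a b" by (auto simp: ideal2_def)
      next
        assume "f \<in> ideal2 a b"
        then obtain u v where "f = a * u + b * v" by (auto simp: ideal2_def)
        then have "swap2 f = swap2 a * swap2 u + swap2 b * swap2 v" by (simp only: add mult)
        then show "swap2 f \<in> ideal2 (swap2 a) (swap2 b)" by (auto simp: ideal2_def)
      qed
      then show ?thesis using L(2) by simp
    qed
    show "range (\<lambda>f. L (swap2 f)) = coords n"
    proof -
      have "range (\<lambda>f. L (swap2 f)) = L ` range swap2" by auto
      also have "range swap2 = UNIV" by (rule surjI[of swap2 swap2]) simp
      finally show ?thesis using L(3) by simp
    qed
  qed
qed

lemma hderiv_fps_deriv: "hderiv id (fps_deriv :: complex fps \<Rightarrow> complex fps)"
  by (simp add: hderiv_def mult.commute)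

lemma rhom_fps_nth_0: "rhom (\<lambda>f :: complex fps. fps_nth f 0)"
  by unfold_locales auto

lemma rhom_cst: "rhom cst"
  by unfold_locales auto

lemma sum_UNIV_3:
  fixes s :: "3 \<Rightarrow> 'z::comm_monoid_add"
  assumes "UNIV = {k, i, j}" "i \<noteq> k" "j \<noteq> k" "i \<noteq> j"
  shows "(\<Sum>l\<in>UNIV. s l) = s k + s i + s j"
  unfolding assms(1) using assms(2-4) by (simp add: add.assoc)

lemma chart_deriv:
  fixes L :: "fps2 ^ 3"
  assumes idx: "UNIV = {k, i, j}" "i \<noteq> k" "j \<noteq> k" "i \<noteq> j"
    and L: "L $ k = 1" "L $ i = const2 a + var_x" "L $ j = const2 b + var_y"
  shows "deriv_x (eval3 const2 G L) = eval3 const2 (pd i G) L" "deriv_y (eval3 const2 G L) = eval3 const2 (pd j G) L"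
proof -
  show "deriv_x (eval3 const2 G L) = eval3 const2 (pd i G) L"
    using eval3_chain_sum[OF rhom_const2 hderiv_deriv(1) deriv_simps(1), of G L] idx(2-4)
    by (simp add: sum_UNIV_3[OF idx] L deriv_add deriv_simps deriv_simps(1)[of 1, simplified])
  show "deriv_y (eval3 const2 G L) = eval3 const2 (pd j G) L"
    using eval3_chain_sum[OF rhom_const2 hderiv_deriv(2) deriv_simps(4), of G L] idx(2-4)
    by (simp add: sum_UNIV_3[OF idx] L deriv_add deriv_simps deriv_simps(4)[of 1, simplified])
qed

lemma cst_eval3: "cst (eval3 const2 G L) = eval3 id G (\<chi> l. cst (L $ l))"
  using rhom_eval3_push[OF rhom_cst rhom_const2, of G L] by (simp add: id_def)

text \<open>\<open>T\<close> is a homogeneous arc on the conic, and \<open>imm\<close> says that its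
  velocity is not proportional to its position, so that it is immersed in the projective plane.
  Division by \<open>T $ k\<close> brings it into the chart.\<close>

lemma chart_formula_aux:
  fixes L :: "fps2 ^ 3" and T :: "complex fps ^ 3"
  assumes idx: "UNIV = {k, i, j}" "i \<noteq> k" "j \<noteq> k" "i \<noteq> j"
    and L: "L $ k = 1" "L $ i = const2 a + var_x" "L $ j = const2 b + var_y"
    and F: "squarefree F" "homogeneous d F" and Q: "homogeneous d' Q"
    and Tk: "fps_nth (T $ k) 0 \<noteq> 0" and T0: "\<And>l. fps_nth (T $ l) 0 = cst (L $ l) * fps_nth (T $ k) 0"
    and imm: "\<And>e. (\<And>l. fps_nth (T $ l) 1 = e * fps_nth (T $ l) 0) \<Longrightarrow> False"
    and QT: "eval3 fps_const Q T = 0" and FT: "eval3 fps_const F T \<noteq> 0" "fps_nth (eval3 fps_const F T) 0 = 0"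
    and qy: "cst (deriv_y (eval3 const2 Q L)) \<noteq> 0"
  defines "f \<equiv> eval3 const2 F L" and "q \<equiv> eval3 const2 Q L"
  shows "\<exists>\<mu>. codim UNIV (ideal2 (deriv_x f) (deriv_y f)) \<mu> \<and>
    codim UNIV (ideal2 (deriv_x (f * q)) (deriv_y (f * q))) (\<mu> + (2 * subdegree (eval3 fps_const F T) - 1))"
proof -
  have cases: "l = k \<or> l = i \<or> l = j" for l using idx(1) by blast
  have LPol: "L $ l \<in> Pol" for l
    using cases[of l] L Pol_0_1 Pol.intros by auto
  note sum3 = sum_UNIV_3[OF idx]
  have fPol: "f \<in> Pol" and qPol: "q \<in> Pol" unfolding f_def q_def by (intro eval3_Pol LPol)+
  note dx = chart_deriv(1)[OF idx L] and dy = chart_deriv(2)[OF idx L]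
  have cstL: "cst (eval3 const2 G L) = eval3 id G (\<chi> l. cst (L $ l))" for G by (rule cst_eval3)
  \<comment> \<open>A unit of order zero, so rescaling by it changes no order of vanishing.\<close>
  define t where "t = inverse (T $ k)"
  have t: "t * T $ k = 1" "fps_nth t 0 \<noteq> 0" using Tk by (simp_all add: t_def inverse_mult_eq_1)
  then have "t \<noteq> 0" "subdegree t = 0" by (auto intro: subdegree_eq_0)
  define \<Gamma> where "\<Gamma> = t *s T"
  have \<Gamma>k: "\<Gamma> $ k = 1" using t(1) by (simp add: \<Gamma>_def)
  have \<Gamma>0: "fps_nth (\<Gamma> $ l) 0 = cst (L $ l)" for l
  proof -
    have "fps_nth t 0 * fps_nth (T $ k) 0 = 1" using arg_cong[OF t(1), of "\<lambda>f. fps_nth f 0"] by simp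
    then show ?thesis using T0[of l] by (simp add: \<Gamma>_def mult.left_commute)
  qed
  have Q\<Gamma>: "eval3 fps_const Q \<Gamma> = 0" unfolding \<Gamma>_def eval3_scale[OF rhom_fps_const Q] QT by simp
  have F\<Gamma>: "eval3 fps_const F \<Gamma> = t ^ d * eval3 fps_const F T" unfolding \<Gamma>_def eval3_scale[OF rhom_fps_const F(2)] ..
  have sdF: "eval3 fps_const F \<Gamma> \<noteq> 0" "subdegree (eval3 fps_const F \<Gamma>) = subdegree (eval3 fps_const F T)"
    unfolding F\<Gamma> using FT(1) \<open>t \<noteq> 0\<close> \<open>subdegree t = 0\<close> by (simp_all add: subdegree_mult)
  define X Y where "X = \<Gamma> $ i - fps_const a" and "Y = \<Gamma> $ j - fps_const b"
  have XY0: "fps_nth X 0 = 0" "fps_nth Y 0 = 0" using \<Gamma>0[of i] \<Gamma>0[of j] L by (simp_all add: X_def Y_def)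
  \<comment> \<open>If \<open>x\<close> had zero velocity, differentiating \<open>q = 0\<close> with
    \<open>q_y \<noteq> 0\<close> would make the velocity of \<open>y\<close> zero as well; in
    homogeneous terms this contradicts \<open>imm\<close>.\<close>
  have X1: "fps_nth X 1 \<noteq> 0"
  proof
    assume X1: "fps_nth X 1 = 0"
    have nth0: "fps_nth (eval3 fps_const G \<Gamma>) 0 = cst (eval3 const2 G L)" for G
      unfolding cstL using rhom_eval3_push[OF rhom_fps_nth_0 rhom_fps_const, of G \<Gamma>] by (simp add: \<Gamma>0 id_def)
    have "fps_deriv (eval3 fps_const Q \<Gamma>) = (\<Sum>l\<in>UNIV. eval3 fps_const (pd l Q) \<Gamma> * fps_deriv (\<Gamma> $ l))"
      by (rule eval3_chain_sum[OF rhom_fps_const hderiv_fps_deriv]) simp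
    then have "fps_nth (\<Sum>l\<in>UNIV. eval3 fps_const (pd l Q) \<Gamma> * fps_deriv (\<Gamma> $ l)) 0 = 0"
      unfolding Q\<Gamma> by simp
    then have "(\<Sum>l\<in>UNIV. fps_nth (eval3 fps_const (pd l Q) \<Gamma>) 0 * fps_nth (\<Gamma> $ l) 1) = 0"
      by (simp add: fps_sum_nth)
    then have "cst (eval3 const2 (pd j Q) L) * fps_nth (\<Gamma> $ j) 1 = 0"
      using X1 by (simp add: sum3 nth0 \<Gamma>k X_def)
    then have "fps_nth (\<Gamma> $ j) 1 = 0" using qy by (simp add: dy)
    then have \<Gamma>1: "fps_nth (\<Gamma> $ l) 1 = 0" for l using cases[of l] X1 \<Gamma>k by (auto simp: X_def)
    have "fps_nth (T $ l) 1 = fps_nth (T $ k) 1 / fps_nth (T $ k) 0 * fps_nth (T $ l) 0" for l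
    proof -
      have "T $ l = T $ k * \<Gamma> $ l" using t(1) by (simp add: \<Gamma>_def mult_ac)
      then have "fps_nth (T $ l) 1 = fps_nth (T $ k * \<Gamma> $ l) 1" by simp
      also have "\<dots> = fps_nth (T $ k) 1 * cst (L $ l)" using \<Gamma>1[of l] \<Gamma>0[of l] by (simp add: fps_mult_nth)
      finally show ?thesis using T0[of l] Tk by simp
    qed
    then show False by (rule imm)
  qed
  obtain E0 \<phi> where E0: "branch E0" "smooth_germ (fps_X - fps_const \<phi>) E0" "E0 var_x = X" "E0 var_y = Y" "fps_nth \<phi> 0 = 0"
    using smooth_param[OF XY0(1) X1 XY0(2)] by blast
  have push: "E (eval3 const2 G L) = eval3 fps_const G (\<chi> l. E (L $ l))" if "branch E" for E G
    using that rhom_eval3_push[of E const2 G L] rhom_const2 by (simp add: branch_def)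
  interpret E0: rhom E0 using E0(1) by (simp add: branch_def)
  have "(\<chi> l. E0 (L $ l)) = \<Gamma>"
  proof -
    have "E0 (L $ l) = \<Gamma> $ l" for l
      using cases[of l] E0(1) E0(3,4) by (auto simp: L \<Gamma>k X_def Y_def branch_def)
    then show ?thesis by (simp add: vec_eq_iff)
  qed
  then have E0G: "E0 (eval3 const2 G L) = eval3 fps_const G \<Gamma>" for G using push[OF E0(1)] by simp
  have E0q: "E0 q = 0" unfolding q_def E0G by (rule Q\<Gamma>)
  have sg: "smooth_germ q E0" by (rule smooth_germ_equation[OF E0(2,5) E0q]) (use qy in \<open>simp add: q_def\<close>)
  have f0: "cst f = 0"
  proof -
    have "cst f = fps_nth (eval3 fps_const F \<Gamma>) 0" using branch_cst[OF E0(1) fPol] by (simp add: f_def E0G)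
    then show ?thesis unfolding F\<Gamma> using FT(2) by simp
  qed
  \<comment> \<open>A branch in the singular locus gives a singular arc of \<open>F\<close>; Euler's
    relation supplies the partial derivative missing in the chart. Such an arc is constant, unlike a
    branch.\<close>
  have nsb: False if E: "branch E" "E f = 0" "E (deriv_x f) = 0" "E (deriv_y f) = 0" for E
  proof -
    interpret E: rhom E using E(1) by (simp add: branch_def)
    define \<Delta> where "\<Delta> = (\<chi> l. E (L $ l))"
    note push' = push[OF E(1), folded \<Delta>_def]
    have \<Delta>: "\<Delta> $ k = 1" "\<Delta> $ i = fps_const a + E var_x" "\<Delta> $ j = fps_const b + E var_y"
      using E(1) by (simp_all add: \<Delta>_def L branch_def)
    have F0: "eval3 fps_const F \<Delta> = 0" using E(2) push' by (simp add: f_def)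
    have pij: "eval3 fps_const (pd i F) \<Delta> = 0" "eval3 fps_const (pd j F) \<Delta> = 0"
      using E(3,4) push' by (simp_all add: f_def dx dy)
    have "eval3 fps_const (pd k F) \<Delta> = 0"
      using eval3_euler[OF rhom_fps_const F(2), of \<Delta>] F0 pij by (simp add: sum3 \<Delta>(1))
    then have all: "eval3 fps_const (pd l F) \<Delta> = 0" for l using pij cases[of l] by auto
    have "\<Delta> $ i = fps_const (fps_nth (\<Delta> $ i) 0)" "\<Delta> $ j = fps_const (fps_nth (\<Delta> $ j) 0)"
      by (rule singular_arc_constant[OF F \<Delta>(1) _ F0 all]; use idx in simp)+
    then have "E var_x = 0" "E var_y = 0" using E(1) by (auto simp: \<Delta> branch_def)
    then show False using E(1) by (simp add: branch_def)
  qed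
  have "\<exists>\<mu>. codim UNIV (ideal2 (deriv_x f) (deriv_y f)) \<mu> \<and>
    codim UNIV (ideal2 (deriv_x (f * q)) (deriv_y (f * q))) (\<mu> + (2 * subdegree (E0 f) - 1))"
  proof (rule local_formula[OF fPol qPol E0(1) sg _ _ f0 _ nsb])
    show "cst (deriv_y q) \<noteq> 0" using qy by (simp add: q_def)
    show "fps_nth (E0 var_x) 1 \<noteq> 0" using X1 E0(3) by simp
    show "E0 f \<noteq> 0" unfolding f_def E0G by (rule sdF(1))
  qed
  then show ?thesis by (simp add: f_def E0G sdF(2))
qed

text \<open>Brings the three standard charts to one form, with \<open>k\<close> the normalized
  coordinate, so that the local computation is done once.\<close>

lemma local_coords_cases:
  assumes "v \<noteq> 0"
  shows "\<exists>k i j. UNIV = {k, i, j} \<and> i \<noteq> k \<and> j \<noteq> k \<and> i \<noteq> j \<and> v $ k \<noteq> 0 \<and> local_coords v $ k = 1 \<and>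
    local_coords v $ i = const2 (v $ i / v $ k) + var_x \<and> local_coords v $ j = const2 (v $ j / v $ k) + var_y"
proof -
  have U: "(UNIV :: 3 set) = {3, 1, 2}" "(UNIV :: 3 set) = {2, 1, 3}" "(UNIV :: 3 set) = {1, 2, 3}"
    using exhaust_3 by auto
  consider "v $ 3 \<noteq> 0" | "v $ 3 = 0" "v $ 2 \<noteq> 0" | "v $ 3 = 0" "v $ 2 = 0" "v $ 1 \<noteq> 0"
    using assms by (auto simp: vec_eq_iff forall_3)
  then show ?thesis
  proof cases
    case 1
    then show ?thesis using U(1) by (intro exI[of _ 3] exI[of _ 1] exI[of _ 2]) (simp add: local_coords_def vector_3)
  next
    case 2
    then show ?thesis using U(2) by (intro exI[of _ 2] exI[of _ 1] exI[of _ 3]) (simp add: local_coords_def vector_3)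
  next
    case 3
    then show ?thesis using U(3) by (intro exI[of _ 1] exI[of _ 2] exI[of _ 3]) (simp add: local_coords_def vector_3)
  qed
qed

text \<open>If both \<open>q_x\<close> and \<open>q_y\<close> vanished at the point, Euler's
  relation would make it singular. So exchanging \<open>x\<close> and \<open>y\<close>, when
  necessary, reduces to \<open>chart_formula_aux\<close>.\<close>

lemma chart_formula:
  fixes L :: "fps2 ^ 3" and T :: "complex fps ^ 3"
  assumes idx: "UNIV = {k, i, j}" "i \<noteq> k" "j \<noteq> k" "i \<noteq> j"
    and L: "L $ k = 1" "L $ i = const2 a + var_x" "L $ j = const2 b + var_y"
    and F: "squarefree F" "homogeneous d F" and Q: "homogeneous d' Q"
    and Tk: "fps_nth (T $ k) 0 \<noteq> 0" and T0: "\<And>l. fps_nth (T $ l) 0 = cst (L $ l) * fps_nth (T $ k) 0"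
    and imm: "\<And>e. (\<And>l. fps_nth (T $ l) 1 = e * fps_nth (T $ l) 0) \<Longrightarrow> False"
    and QT: "eval3 fps_const Q T = 0" and FT: "eval3 fps_const F T \<noteq> 0" "fps_nth (eval3 fps_const F T) 0 = 0"
    and smooth: "eval3 id (pd l Q) (\<chi> l. cst (L $ l)) \<noteq> 0"
  defines "f \<equiv> eval3 const2 F L" and "q \<equiv> eval3 const2 Q L"
  shows "\<exists>\<mu>. codim UNIV (ideal2 (deriv_x f) (deriv_y f)) \<mu> \<and>
    codim UNIV (ideal2 (deriv_x (f * q)) (deriv_y (f * q))) (\<mu> + (2 * subdegree (eval3 fps_const F T) - 1))"
proof (cases "cst (deriv_y q) = 0")
  case False
  then show ?thesis unfolding f_def q_def
    by (intro chart_formula_aux[OF idx L F Q Tk T0 imm QT FT])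
next
  case True
  define w where "w = (\<chi> l. cst (L $ l))"
  have wk: "w $ k = 1" using L(1) by (simp add: w_def cst_simps)
  have "fps_nth (T $ k) 0 *s w = (\<chi> l. fps_nth (T $ l) 0)"
  proof -
    have "fps_nth (T $ k) 0 * w $ l = fps_nth (T $ l) 0" for l
      unfolding T0[of l] by (simp add: w_def)
    then show ?thesis by (simp add: vec_eq_iff)
  qed
  then have "fps_nth (T $ k) 0 ^ d' * eval3 id Q w = eval3 id Q (\<chi> l. fps_nth (T $ l) 0)"
    using eval3_scale[OF rhom_id(1) Q, of "fps_nth (T $ k) 0" w] by simp
  also have "\<dots> = fps_nth (eval3 fps_const Q T) 0"
    using rhom_eval3_push[OF rhom_fps_nth_0 rhom_fps_const, of Q T] by (simp add: id_def)
  finally have Qw: "eval3 id Q w = 0" using Tk QT by simp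
  have "cst (deriv_x q) \<noteq> 0"
  proof
    assume "cst (deriv_x q) = 0"
    then have ij: "eval3 id (pd i Q) w = 0" "eval3 id (pd j Q) w = 0"
      using True by (simp_all add: q_def chart_deriv[OF idx L] cst_eval3 w_def)
    then have "eval3 id (pd k Q) w = 0"
      using eval3_euler[OF rhom_id(1) Q, of w] Qw wk by (simp add: sum_UNIV_3[OF idx])
    moreover have "l = k \<or> l = i \<or> l = j" using idx(1) by blast
    ultimately have "eval3 id (pd l Q) w = 0" using ij by auto
    then show False using smooth by (simp add: w_def)
  qed
  then have qx: "cst (swap2 (deriv_x q)) \<noteq> 0" by (simp add: swap2_simps)
  interpret s: rhom swap2 by (rule rhom_swap2)
  define L' where "L' = (\<chi> l. swap2 (L $ l))"
  have L': "L' $ k = 1" "L' $ j = const2 b + var_x" "L' $ i = const2 a + var_y"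
    using L by (simp_all add: L'_def swap2_simps)
  have sw: "eval3 const2 G L' = swap2 (eval3 const2 G L)" for G
    using rhom_eval3_push[OF rhom_swap2 rhom_const2, of G L] by (simp add: swap2_simps L'_def)
  have idx': "UNIV = {k, j, i}" "j \<noteq> k" "i \<noteq> k" "j \<noteq> i" using idx by auto
  have "\<exists>\<mu>. codim UNIV (ideal2 (deriv_x (swap2 f)) (deriv_y (swap2 f))) \<mu> \<and>
    codim UNIV (ideal2 (deriv_x (swap2 f * swap2 q)) (deriv_y (swap2 f * swap2 q))) (\<mu> + (2 * subdegree (eval3 fps_const F T) - 1))"
    unfolding f_def q_def sw[symmetric]
  proof (rule chart_formula_aux[OF idx' L' F Q Tk _ imm QT FT])
    show "fps_nth (T $ l) 0 = cst (L' $ l) * fps_nth (T $ k) 0" for l using T0[of l] by (simp add: L'_def swap2_simps)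
    show "cst (deriv_y (eval3 const2 Q L')) \<noteq> 0" using qx by (simp add: sw deriv_swap2 q_def)
  qed
  then show ?thesis unfolding s.mult[symmetric] deriv_swap2
    by (metis codim_swap2 ideal2_commute)
qed

lemma ideal2_scale:
  assumes "c \<noteq> 0"
  shows "ideal2 (const2 c * a) (const2 c * b) = ideal2 a b"
proof -
  interpret rhom const2 by (rule rhom_const2)
  have 1: "const2 c * const2 (1 / c) = 1" using assms by (simp flip: mult)
  have "a * u + b * v = const2 c * a * (const2 (1 / c) * u) + const2 c * b * (const2 (1 / c) * v)" for u v
  proof -
    have "const2 c * a * (const2 (1 / c) * u) + const2 c * b * (const2 (1 / c) * v) = (const2 c * const2 (1 / c)) * (a * u + b * v)"
      by (simp add: algebra_simps)
    then show ?thesis by (simp add: 1)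
  qed
  moreover have "const2 c * a * u + const2 c * b * v = a * (const2 c * u) + b * (const2 c * v)" for u v
    by (simp add: algebra_simps)
  ultimately show ?thesis unfolding set_eq_iff ideal2_iff by metis
qed

text \<open>The scalar \<open>s\<close> allows an arbitrary representative \<open>v\<close> of the
  point, and \<open>c\<close> an arbitrary choice of the equation of the union.\<close>

lemma milnor_formula:
  fixes T :: "complex fps ^ 3"
  assumes v: "v \<noteq> 0" and F: "squarefree F" "homogeneous d F" and Q: "homogeneous d' Q"
    and smooth: "eval3 id (pd l Q) v \<noteq> 0"
    and T0: "s \<noteq> 0" "\<And>l. fps_nth (T $ l) 0 = s * v $ l"
    and imm: "\<And>e. (\<And>l. fps_nth (T $ l) 1 = e * fps_nth (T $ l) 0) \<Longrightarrow> False"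
    and QT: "eval3 fps_const Q T = 0" and FT: "eval3 fps_const F T \<noteq> 0" "fps_nth (eval3 fps_const F T) 0 = 0"
    and c: "c \<noteq> 0"
  shows "milnor_germ (eval3 const2 (C3 c * (F * Q)) (local_coords v)) =
    milnor_germ (eval3 const2 F (local_coords v)) + (2 * subdegree (eval3 fps_const F T) - 1)"
proof -
  define L where "L = local_coords v"
  obtain k i j where idx: "UNIV = {k, i, j}" "i \<noteq> k" "j \<noteq> k" "i \<noteq> j" and vk: "v $ k \<noteq> 0"
    and L: "L $ k = 1" "L $ i = const2 (v $ i / v $ k) + var_x" "L $ j = const2 (v $ j / v $ k) + var_y"
    using local_coords_cases[OF v] unfolding L_def by blast
  have cases: "l = k \<or> l = i \<or> l = j" for l using idx(1) by blast
  have cL: "cst (L $ l) = v $ l / v $ k" for l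
    using cases[of l] vk by (auto simp: L cst_simps)
  have LPol: "L $ l \<in> Pol" for l
    using cases[of l] L Pol_0_1 Pol.intros by auto
  define f q where "f = eval3 const2 F L" and "q = eval3 const2 Q L"
  have fq: "f \<in> Pol" "q \<in> Pol" unfolding f_def q_def by (intro eval3_Pol LPol)+
  have sm: "eval3 id (pd l Q) (\<chi> l. cst (L $ l)) \<noteq> 0"
  proof
    assume 0: "eval3 id (pd l Q) (\<chi> l. cst (L $ l)) = 0"
    have "v = v $ k *s (\<chi> l. cst (L $ l))" using vk by (simp add: vec_eq_iff cL)
    then have "eval3 id (pd l Q) v = v $ k ^ (d' - 1) * eval3 id (pd l Q) (\<chi> l. cst (L $ l))"
      using eval3_scale[OF rhom_id(1) homogeneous_pd[OF Q]] by metis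
    then show False using 0 smooth by simp
  qed
  have "\<exists>\<mu>. codim UNIV (ideal2 (deriv_x f) (deriv_y f)) \<mu> \<and>
    codim UNIV (ideal2 (deriv_x (f * q)) (deriv_y (f * q))) (\<mu> + (2 * subdegree (eval3 fps_const F T) - 1))"
    unfolding f_def q_def
  proof (rule chart_formula[OF idx L F Q _ _ imm QT FT sm])
    show "fps_nth (T $ k) 0 \<noteq> 0" using T0 vk by simp
    show "fps_nth (T $ l) 0 = cst (L $ l) * fps_nth (T $ k) 0" for l using T0(2) vk by (simp add: cL)
  qed
  then obtain \<mu> where \<mu>: "codim UNIV (ideal2 (deriv_x f) (deriv_y f)) \<mu>"
    "codim UNIV (ideal2 (deriv_x (f * q)) (deriv_y (f * q))) (\<mu> + (2 * subdegree (eval3 fps_const F T) - 1))" by blast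
  interpret ev: rhom "\<lambda>G. eval3 const2 G L" by (rule rhom_eval3[OF rhom_const2])
  have e: "eval3 const2 (C3 c * (F * Q)) L = const2 c * (f * q)"
    by (simp add: eval3_simps[OF rhom_const2] f_def q_def)
  have d: "deriv_x (const2 c * g) = const2 c * deriv_x g" "deriv_y (const2 c * g) = const2 c * deriv_y g" for g
    by (simp_all add: deriv_mult deriv_simps)
  have "milnor_germ (const2 c * (f * q)) = \<mu> + (2 * subdegree (eval3 fps_const F T) - 1)"
    by (rule milnor_germ_codim) (use \<mu>(2) fq in \<open>auto simp: d ideal2_scale[OF c] intro: Pol.intros\<close>)
  moreover have "milnor_germ f = \<mu>" by (rule milnor_germ_codim[OF fq(1) \<mu>(1)])
  ultimately show ?thesis unfolding L_def[symmetric] e f_def[symmetric] by simp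
qed

section \<open>Intersections with a parametrized conic\<close>

definition conic_point :: "complex ^ 3 \<Rightarrow> complex ^ 3 \<Rightarrow> complex ^ 3 \<Rightarrow> complex \<Rightarrow> complex ^ 3" where
  "conic_point u v w \<tau> = \<tau>\<^sup>2 *s u + \<tau> *s v + w"

definition conic_pullback :: "complex ^ 3 \<Rightarrow> complex ^ 3 \<Rightarrow> complex ^ 3 \<Rightarrow> poly3 \<Rightarrow> complex poly" where
  "conic_pullback u v w F = eval3 (\<lambda>c. [:c:]) F (\<chi> l. [:w $ l, v $ l, u $ l:])"

lemma rhom_poly: "rhom (\<lambda>p :: complex poly. poly p x)"
  by unfold_locales auto

lemma poly_conic_pullback: "poly (conic_pullback u v w F) \<tau> = eval3 id F (conic_point u v w \<tau>)"
proof -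
  have "(\<chi> l. poly [:w $ l, v $ l, u $ l:] \<tau>) = conic_point u v w \<tau>"
    by (simp add: vec_eq_iff conic_point_def power2_eq_square algebra_simps)
  then show ?thesis
    using rhom_eval3_push[OF rhom_poly[of \<tau>] rhom_pconst, of F "\<chi> l. [:w $ l, v $ l, u $ l:]"]
    by (simp add: conic_pullback_def id_def)
qed

text \<open>Exchanging \<open>u\<close> and \<open>w\<close> replaces \<open>\<tau>\<close> by its
  inverse, hence reverses the coefficients. The leading coefficient in degree \<open>2 * d\<close>
  is thus the value of \<open>F\<close> at \<open>u\<close>.\<close>

lemma degree_conic_pullback:
  assumes F: "homogeneous d F" and u: "eval3 id F u \<noteq> 0"
  shows "conic_pullback u v w F \<noteq> 0" "Polynomial.degree (conic_pullback u v w F) = 2 * d"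
proof -
  define G H where "G = conic_pullback u v w F" and "H = conic_pullback w v u F"
  define N where "N = Polynomial.degree H"
  have "poly H 0 \<noteq> 0" using u by (simp add: H_def poly_conic_pullback conic_point_def)
  then have H0: "Polynomial.coeff H 0 \<noteq> 0" by (simp add: poly_0_coeff_0)
  \<comment> \<open>The additional power of the variable makes both sides vanish at
    \<open>\<tau> = 0\<close>, where the inverse has no meaning.\<close>
  have eq: "[:0, 1:] ^ Suc N * G = [:0, 1:] ^ Suc (2 * d) * reflect_poly H"
  proof (subst poly_eq_poly_eq_iff[symmetric], rule ext)
    fix \<tau> :: complex
    show "poly ([:0, 1:] ^ Suc N * G) \<tau> = poly ([:0, 1:] ^ Suc (2 * d) * reflect_poly H) \<tau>"
    proof (cases "\<tau> = 0")
      case False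
      then have "conic_point u v w \<tau> = \<tau>\<^sup>2 *s conic_point w v u (inverse \<tau>)"
        by (simp add: vec_eq_iff conic_point_def power2_eq_square field_simps)
      then have "poly G \<tau> = \<tau> ^ (2 * d) * poly H (inverse \<tau>)"
        unfolding G_def H_def poly_conic_pullback by (simp add: eval3_scale[OF rhom_id(1) F] power_mult)
      then show ?thesis using False by (simp add: poly_reflect_poly_nz N_def)
    qed simp
  qed
  have R0: "reflect_poly H \<noteq> 0" "Polynomial.degree (reflect_poly H) = N" using H0 by (auto simp: N_def)
  have "G \<noteq> 0" using eq R0(1) by auto
  then have "Suc N + Polynomial.degree G = Suc (2 * d) + N"
    using arg_cong[OF eq, of Polynomial.degree] R0
    by (simp add: degree_mult_eq degree_power_eq del: power_Suc)
  then show "conic_pullback u v w F \<noteq> 0" "Polynomial.degree (conic_pullback u v w F) = 2 * d"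
    using \<open>G \<noteq> 0\<close> by (simp_all add: G_def)
qed

lemma sum_order_roots:
  fixes p :: "complex poly"
  assumes "p \<noteq> 0"
  shows "(\<Sum>x | poly p x = 0. Polynomial.order x p) = Polynomial.degree p"
  using size_proots_complex[of p] assms by (simp add: size_multiset_overloaded_eq)

lemma rhom_fps_shift: "rhom (\<lambda>p :: complex poly. fps_of_poly (pcompose p [:a, 1:]))"
  by unfold_locales (auto simp: pcompose_1 pcompose_add pcompose_mult fps_of_poly_add fps_of_poly_mult)

lemma subdegree_fps_shift:
  fixes g :: "complex poly"
  assumes "g \<noteq> 0"
  shows "fps_of_poly (pcompose g [:a, 1:]) \<noteq> 0" "subdegree (fps_of_poly (pcompose g [:a, 1:])) = Polynomial.order a g"
proof -
  interpret rhom "\<lambda>p :: complex poly. fps_of_poly (pcompose p [:a, 1:])" by (rule rhom_fps_shift)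
  obtain h where h: "g = [:- a, 1:] ^ Polynomial.order a g * h" "\<not> [:- a, 1:] dvd h"
    using order_decomp[OF assms] by blast
  define \<eta> where "\<eta> = fps_of_poly (pcompose h [:a, 1:])"
  have "poly h a \<noteq> 0" using h(2) by (simp add: poly_eq_0_iff_dvd)
  then have "fps_nth \<eta> 0 \<noteq> 0" by (simp add: \<eta>_def poly_0_coeff_0[symmetric] poly_pcompose)
  then have \<eta>: "\<eta> \<noteq> 0" "subdegree \<eta> = 0" by (auto intro: subdegree_eq_0)
  have "fps_of_poly (pcompose [:- a, 1:] [:a, 1:]) = fps_X" by (simp add: pcompose_pCons)
  then have "fps_of_poly (pcompose ([:- a, 1:] ^ n * h) [:a, 1:]) = fps_X ^ n * \<eta>" for n
    by (simp only: mult power \<eta>_def)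
  from this[of "Polynomial.order a g"]
  have eq: "fps_of_poly (pcompose g [:a, 1:]) = fps_X ^ Polynomial.order a g * \<eta>" using h(1) by simp
  show "fps_of_poly (pcompose g [:a, 1:]) \<noteq> 0" "subdegree (fps_of_poly (pcompose g [:a, 1:])) = Polynomial.order a g"
    unfolding eq using \<eta> by (simp_all add: subdegree_mult)
qed

text \<open>\<open>T\<close> is the expansion of the parametrization at \<open>\<tau>\<close>; along
  it the order of \<open>F\<close> becomes the multiplicity of a root of the pullback.\<close>

lemma conic_arc:
  fixes u v w \<tau>
  defines "T \<equiv> \<chi> l. fps_of_poly (pcompose [:w $ l, v $ l, u $ l:] [:\<tau>, 1:])"
  shows "eval3 fps_const F T = fps_of_poly (pcompose (conic_pullback u v w F) [:\<tau>, 1:])"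
    "fps_nth (T $ l) 0 = conic_point u v w \<tau> $ l" "fps_nth (T $ l) 1 = (2 * \<tau> *s u + v) $ l"
proof -
  show "eval3 fps_const F T = fps_of_poly (pcompose (conic_pullback u v w F) [:\<tau>, 1:])"
    using rhom_eval3_push[OF rhom_fps_shift[of \<tau>] rhom_pconst, of F "\<chi> l. [:w $ l, v $ l, u $ l:]"]
    by (simp add: conic_pullback_def T_def pcompose_const fps_of_poly_const)
  show "fps_nth (T $ l) 0 = conic_point u v w \<tau> $ l" "fps_nth (T $ l) 1 = (2 * \<tau> *s u + v) $ l"
    by (simp_all add: T_def conic_point_def pcompose_pCons power2_eq_square algebra_simps)
qed

theorem proposition4p4:
  fixes C C0 :: "(complex ^ 3) set set"
  assumes "reduced_curve C"
    and "smooth_conic C0"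
    and "C0 \<notin> Irr C"
  shows "(\<Sum>P\<in>C \<inter> C0. int (milnor_number (C \<union> C0) P) - int (milnor_number C P) + 1)
           = 4 * int (curve_degree C)"
proof -
  define F Q where "F = curve_eq C" and "Q = curve_eq C0"
  have C0: "reduced_curve C0" "curve_degree C0 = 2" "\<And>P. P \<in> C0 \<Longrightarrow> smooth_point C0 P"
    using assms(2) by (auto simp: smooth_conic_def)
  have F: "reduced_equation F" "zero_locus F = C" using curve_eq_reduced[OF assms(1)] by (auto simp: F_def)
  have Q: "reduced_equation Q" "zero_locus Q = C0" using curve_eq_reduced[OF C0(1)] by (auto simp: Q_def)
  obtain d where d: "d > 0" "homogeneous d F" and sqF: "squarefree F" using F(1) by (auto simp: reduced_equation_def)
  obtain d' where d': "homogeneous d' Q" and sqQ: "squarefree Q" using Q(1) by (auto simp: reduced_equation_def)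
  have degC: "curve_degree C = d"
    using curve_degreeI d(2) squarefree_poly3_nonzero[OF sqF] by (simp add: F_def)
  have "curve_degree C0 = d'"
    using curve_degreeI d' squarefree_poly3_nonzero[OF sqQ] by (simp add: Q_def)
  then have Q2: "homogeneous 2 Q" using d' C0(2) by simp
  have smooth: "\<exists>i. eval3 id (pd i Q) x \<noteq> 0" if x: "x \<noteq> 0" "eval3 id Q x = 0" for x
  proof -
    have "vec.span {x} \<in> C0" using zero_locus_iff[OF Q2 x(1)] x(2) Q(2) by simp
    then have "smooth_point C0 (vec.span {x})" by (rule C0(3))
    moreover have "x \<in> vec.span {x} - {0}" using x(1) by (simp add: vec.span_base)
    ultimately obtain D where D: "D \<in> {partial_X, partial_Y, partial_Z}" "eval3 id (D Q) x \<noteq> 0"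
      unfolding smooth_point_def Q_def by blast
    have "D = pd 1 \<or> D = pd 2 \<or> D = pd 3" using D(1) by (auto simp: pd_def)
    then show ?thesis using D(2) by blast
  qed
  obtain u0 where "u0 \<noteq> 0" "eval3 id Q u0 = 0" using conic_has_point[OF Q2] by blast
  then have irr: "Factorial_Ring.irreducible Q" using smooth_conic_irreducible[OF Q2 sqQ smooth] by blast
  have QF: "\<not> Q dvd F"
  proof
    assume "Q dvd F"
    then have "zero_locus Q \<in> Irr C" using irr unfolding Irr_def F_def by blast
    then show False using assms(3) Q(2) by simp
  qed
  \<comment> \<open>If \<open>F\<close> vanished on the whole conic, the Nullstellensatz would make
    \<open>Q\<close> divide \<open>F\<close>.\<close>
  obtain u where u: "eval3 id Q u = 0" "eval3 id F u \<noteq> 0"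
    using nullstellensatz[OF sqQ squarefree_poly3_nonzero[OF sqQ], of F] QF by blast
  have "u \<noteq> 0" using u(2) eval3_zero[OF d(2,1)] by auto
  obtain v w where Qb: "\<And>\<alpha> \<beta> \<gamma>. eval3 id Q (\<alpha> *s u + \<beta> *s v + \<gamma> *s w) = \<alpha> * \<gamma> - \<beta>\<^sup>2"
    and span: "\<And>x. \<exists>\<alpha> \<beta> \<gamma>. x = \<alpha> *s u + \<beta> *s v + \<gamma> *s w"
    and ind: "\<And>\<alpha> \<beta> \<gamma>. \<alpha> *s u + \<beta> *s v + \<gamma> *s w = 0 \<Longrightarrow> \<alpha> = 0 \<and> \<beta> = 0 \<and> \<gamma> = 0"
    using conic_basis[OF Q2 smooth \<open>u \<noteq> 0\<close> u(1)] by metis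
  define \<Theta> where "\<Theta> = conic_point u v w"
  define G where "G = conic_pullback u v w F"
  have G: "G \<noteq> 0" "Polynomial.degree G = 2 * d" using degree_conic_pullback[OF d(2) u(2)] by (simp_all add: G_def)
  have polyG: "poly G \<tau> = eval3 id F (\<Theta> \<tau>)" for \<tau> by (simp add: G_def \<Theta>_def poly_conic_pullback)
  have Q\<Theta>: "eval3 id Q (\<Theta> \<tau>) = 0" for \<tau>
    using Qb[of "\<tau>\<^sup>2" \<tau> 1] by (simp add: \<Theta>_def conic_point_def)
  \<comment> \<open>The coefficient of \<open>w\<close> is always 1, so proportional values of the
    parametrization are equal.\<close>
  have \<Theta>_scale: "e = 1 \<and> \<tau> = \<sigma>" if "\<Theta> \<tau> = e *s \<Theta> \<sigma>" for \<tau> \<sigma> e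
  proof -
    have "(\<tau>\<^sup>2 - e * \<sigma>\<^sup>2) *s u + (\<tau> - e * \<sigma>) *s v + (1 - e) *s w = \<Theta> \<tau> - e *s \<Theta> \<sigma>"
      by (simp add: \<Theta>_def conic_point_def vec_eq_iff algebra_simps)
    then have "\<tau> - e * \<sigma> = 0 \<and> 1 - e = 0"
      using ind[of "\<tau>\<^sup>2 - e * \<sigma>\<^sup>2" "\<tau> - e * \<sigma>" "1 - e"] that by simp
    then show ?thesis by auto
  qed
  have \<Theta>0: "\<Theta> \<tau> \<noteq> 0" for \<tau> using \<Theta>_scale[of \<tau> 0 0] by auto
  have inj: "inj_on (\<lambda>\<tau>. vec.span {\<Theta> \<tau>}) {\<tau>. poly G \<tau> = 0}"
  proof (rule inj_onI)
    fix \<tau> \<sigma> assume "vec.span {\<Theta> \<tau>} = vec.span {\<Theta> \<sigma>}"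
    then have "\<Theta> \<tau> \<in> vec.span {\<Theta> \<sigma>}" using vec.span_base[of "\<Theta> \<tau>" "{\<Theta> \<tau>}"] by simp
    then show "\<tau> = \<sigma>" using \<Theta>_scale by (auto simp: vec.span_singleton)
  qed
  have inter: "C \<inter> C0 = (\<lambda>\<tau>. vec.span {\<Theta> \<tau>}) ` {\<tau>. poly G \<tau> = 0}"
  proof (intro equalityI subsetI)
    fix P assume "P \<in> (\<lambda>\<tau>. vec.span {\<Theta> \<tau>}) ` {\<tau>. poly G \<tau> = 0}"
    then obtain \<tau> where "P = vec.span {\<Theta> \<tau>}" "poly G \<tau> = 0" by blast
    then show "P \<in> C \<inter> C0"
      using zero_locus_iff[OF d(2) \<Theta>0] zero_locus_iff[OF Q2 \<Theta>0] F(2) Q(2) Q\<Theta> polyG by auto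
  next
    fix P assume P: "P \<in> C \<inter> C0"
    then obtain x where x: "P = vec.span {x}" "x \<noteq> 0" using F(2) by (auto simp: zero_locus_def proj_plane_def)
    then have Fx: "eval3 id F x = 0" "eval3 id Q x = 0"
      using P zero_locus_iff[OF d(2) x(2)] zero_locus_iff[OF Q2 x(2)] F(2) Q(2) by auto
    obtain \<alpha> \<beta> \<gamma> where abc: "x = \<alpha> *s u + \<beta> *s v + \<gamma> *s w" using span by blast
    have conic: "\<alpha> * \<gamma> = \<beta>\<^sup>2" using Fx(2) Qb[of \<alpha> \<beta> \<gamma>] abc by simp
    \<comment> \<open>The point with \<open>\<gamma> = 0\<close> is \<open>u\<close> itself, which
      lies off \<open>C\<close>.\<close>
    have "\<gamma> \<noteq> 0"
    proof
      assume "\<gamma> = 0"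
      then have "x = \<alpha> *s u" using conic abc by simp
      then show False using Fx(1) u(2) x(2) eval3_scale[OF rhom_id(1) d(2), of \<alpha> u] by auto
    qed
    define \<tau> where "\<tau> = \<beta> / \<gamma>"
    have "\<alpha> = \<gamma> * \<tau>\<^sup>2" "\<beta> = \<gamma> * \<tau>" using conic \<open>\<gamma> \<noteq> 0\<close> by (auto simp: \<tau>_def power2_eq_square field_simps)
    then have x\<Theta>: "x = \<gamma> *s \<Theta> \<tau>" by (simp add: abc \<Theta>_def conic_point_def vec_eq_iff algebra_simps)
    then have "poly G \<tau> = 0" using Fx(1) eval3_scale[OF rhom_id(1) d(2), of \<gamma> "\<Theta> \<tau>"] \<open>\<gamma> \<noteq> 0\<close> by (simp add: polyG)
    moreover have "vec.span {x} = vec.span {\<Theta> \<tau>}"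
    proof -
      have "\<Theta> \<tau> = (1 / \<gamma>) *s x" using \<open>\<gamma> \<noteq> 0\<close> by (simp add: x\<Theta>)
      then have "\<Theta> \<tau> \<in> vec.span {x}" by (simp only: vec.span_scale vec.span_base insertI1)
      moreover have "x \<in> vec.span {\<Theta> \<tau>}" unfolding x\<Theta> by (simp only: vec.span_scale vec.span_base insertI1)
      ultimately show ?thesis unfolding vec.span_eq by simp
    qed
    ultimately show "P \<in> (\<lambda>\<tau>. vec.span {\<Theta> \<tau>}) ` {\<tau>. poly G \<tau> = 0}" using x(1) by blast
  qed
  \<comment> \<open>Coprimality keeps the product squarefree, so \<open>F * Q\<close> is a reduced
    equation of the union.\<close>
  have "prime_elem Q" using irr by (simp add: prime_elem_iff_irreducible)
  then have "coprime F Q" using prime_elem_imp_coprime[OF _ QF] by (simp add: coprime_commute)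
  then have "squarefree (F * Q)" using squarefree_mult_coprime sqF sqQ by blast
  moreover have "homogeneous (d + 2) (F * Q)" by (rule homogeneous_mult[OF d(2) Q2])
  ultimately have FQ: "reduced_equation (F * Q)" unfolding reduced_equation_def using d(1) by (metis add_gr_0)
  have loc: "zero_locus (F * Q) = C \<union> C0" using zero_locus_mult[OF d(2) Q2] F(2) Q(2) by simp
  have "reduced_curve (C \<union> C0)" unfolding reduced_curve_def using FQ loc by blast
  then obtain c where c: "c \<noteq> 0" "curve_eq (C \<union> C0) = C3 c * (F * Q)"
    using reduced_equation_unique[OF FQ] curve_eq_reduced loc by metis
  have summand: "int (milnor_number (C \<union> C0) (vec.span {\<Theta> \<tau>})) - int (milnor_number C (vec.span {\<Theta> \<tau>})) + 1
      = 2 * int (Polynomial.order \<tau> G)" if root: "poly G \<tau> = 0" for \<tau>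
  proof -
    \<comment> \<open>The representative that \<open>local_equation\<close> selects; it is known
      only to be some multiple \<open>s\<close> of the parametrized vector.\<close>
    define x where "x = (SOME x. x \<in> vec.span {\<Theta> \<tau>} \<and> x \<noteq> 0)"
    have "x \<in> vec.span {\<Theta> \<tau>} \<and> x \<noteq> 0"
      unfolding x_def by (rule someI[of _ "\<Theta> \<tau>"]) (simp add: vec.span_base \<Theta>0)
    then obtain s where x: "x \<noteq> 0" "x = s *s \<Theta> \<tau>" by (auto simp: vec.span_singleton)
    then have "s \<noteq> 0" by auto
    define T :: "complex fps ^ 3" where "T = (\<chi> l. fps_of_poly (pcompose [:w $ l, v $ l, u $ l:] [:\<tau>, 1:]))"
    note T = conic_arc[where u = u and v = v and w = w and \<tau> = \<tau>, folded T_def \<Theta>_def]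
    have FT: "eval3 fps_const F T = fps_of_poly (pcompose G [:\<tau>, 1:])" using T(1) by (simp add: G_def)
    note sub = subdegree_fps_shift[OF G(1), of \<tau>, folded FT]
    have "poly (conic_pullback u v w Q) = poly 0" using Q\<Theta> by (simp add: fun_eq_iff poly_conic_pullback \<Theta>_def)
    then have "conic_pullback u v w Q = 0" by (simp only: poly_eq_poly_eq_iff)
    then have QT: "eval3 fps_const Q T = 0" using T(1) by simp
    have "eval3 id Q x = 0" using x(2) Q\<Theta> eval3_scale[OF rhom_id(1) Q2, of s "\<Theta> \<tau>"] by simp
    then obtain i where i: "eval3 id (pd i Q) x \<noteq> 0" using smooth x(1) by blast
    have "milnor_germ (eval3 const2 (C3 c * (F * Q)) (local_coords x)) =
      milnor_germ (eval3 const2 F (local_coords x)) + (2 * subdegree (eval3 fps_const F T) - 1)"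
    proof (rule milnor_formula[OF x(1) sqF d(2) Q2 i _ _ _ QT sub(1) _ c(1)])
      show "1 / s \<noteq> 0" using \<open>s \<noteq> 0\<close> by simp
      show "fps_nth (T $ l) 0 = 1 / s * x $ l" for l using T(2)[of l] x(2) \<open>s \<noteq> 0\<close> by simp
      \<comment> \<open>The coefficient of \<open>w\<close> gives \<open>e = 0\<close>, and then
        that of \<open>v\<close> is 1 instead of 0.\<close>
      show False if e: "\<And>l. fps_nth (T $ l) 1 = e * fps_nth (T $ l) 0" for e
      proof -
        have "(2 * \<tau> - e * \<tau>\<^sup>2) *s u + (1 - e * \<tau>) *s v + (- e) *s w = 2 * \<tau> *s u + v - e *s \<Theta> \<tau>"
          by (simp add: \<Theta>_def conic_point_def vec_eq_iff algebra_simps)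
        also have "2 * \<tau> *s u + v = e *s \<Theta> \<tau>" using e T(2,3) by (simp add: vec_eq_iff)
        finally have "(2 * \<tau> - e * \<tau>\<^sup>2) *s u + (1 - e * \<tau>) *s v + (- e) *s w = 0" by simp
        from ind[OF this] show False by auto
      qed
      show "fps_nth (eval3 fps_const F T) 0 = 0"
        unfolding FT using root by (simp add: poly_0_coeff_0[symmetric] poly_pcompose)
    qed
    \<comment> \<open>A root has positive order, so the truncated \<open>2 * m - 1\<close> is a true
      difference and the summand is \<open>2 * m\<close>.\<close>
    moreover have "Polynomial.order \<tau> G > 0" using root G(1) by (simp add: order_root)
    ultimately show ?thesis
      by (simp add: milnor_number_def local_equation_def x_def[symmetric] c(2) F_def[symmetric] sub(2))
  qed
  have "(\<Sum>P\<in>C \<inter> C0. int (milnor_number (C \<union> C0) P) - int (milnor_number C P) + 1)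
      = (\<Sum>\<tau> | poly G \<tau> = 0. 2 * int (Polynomial.order \<tau> G))"
    unfolding inter using summand by (simp add: sum.reindex[OF inj])
  also have "\<dots> = 2 * int (\<Sum>\<tau> | poly G \<tau> = 0. Polynomial.order \<tau> G)"
    by (simp add: sum_distrib_left)
  also have "\<dots> = 4 * int (curve_degree C)" by (simp add: sum_order_roots[OF G(1)] G(2) degC)
  finally show ?thesis .
qed

end
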